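(* Let $D$ be a division ring with infinite center $F$, let $K$ be a subfield of $D$, and let $n$ be a positive integer. If the $n$-th derived subgroup $D^{(n)}$ of $D^*$ is left algebraic of bounded degree $d$ over $K$, or right algebraic of bounded degree $d$ over $K$, then $\dim_F D\le d^2$.
   Context: $D^*=D\setminus\{0\}$ is the multiplicative group of the division ring $D$ (not assumed commutative). $D^{(1)}=D'$ is the commutator subgroup of $D^*$, and for $n>1$, $D^{(n)}$ is the commutator subgroup of $D^{(n-1)}$. A subfield of $D$ is a commutative division subring (not assumed to contain $F$). An element $a\in D$ is left algebraic over $K$ if there is a non-zero polynomial with coefficients $a_0,\dots,a_m\in K$ such that $a_0+a_1a+\cdots+a_ma^m=0$ (coefficients on the left); it is right algebraic over $K$ if $a_0+aa_1+\cdots+a^ma_m=0$ for some $a_0,\dots,a_m\in K$ not all zero (coefficients on the right). The left (resp. right) degree of such an $a$ over $K$ is the least degree of a non-zero polynomial witnessing this. A subset $S\subseteq D$ is left (resp. right) algebraic of bounded degree $d$ over $K$ if every element of $S$ is left (resp. right) algebraic over $K$ of degree at most $d$. *)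

theory Defs
  imports "HOL-Algebra.Embedded_Algebras" "HOL-Algebra.Generated_Groups"
begin

text \<open>
  The library has only commutative fields. As there, the condition on \<^term>\<open>Units R\<close>
  says that every nonzero element is invertible; the group of nonzero elements is then
  \<^term>\<open>units_of R\<close>.
\<close>

locale div_ring = ring R for R (structure) +
  assumes one_not_zero: "\<one> \<noteq> \<zero>"
    and div_ring_Units: "Units R = carrier R - {\<zero>}"

definition ring_center :: "('a, 'b) ring_scheme \<Rightarrow> 'a set" where
  "ring_center R = {z \<in> carrier R. \<forall>x \<in> carrier R. z \<otimes>\<^bsub>R\<^esub> x = x \<otimes>\<^bsub>R\<^esub> z}"

text \<open>
  A nonzero polynomial of degree \<open>m\<close> over \<open>K\<close> is given by coefficients \<open>c 0, ..., c m\<close>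
  in \<open>K\<close> with \<open>c m\<close> nonzero. The values of \<open>c\<close> beyond \<open>m\<close> are irrelevant.
\<close>

definition left_annihilates ::
    "('a, 'b) ring_scheme \<Rightarrow> 'a set \<Rightarrow> nat \<Rightarrow> (nat \<Rightarrow> 'a) \<Rightarrow> 'a \<Rightarrow> bool" where
  "left_annihilates R K m c a \<longleftrightarrow>
     (\<forall>i \<le> m. c i \<in> K) \<and> c m \<noteq> \<zero>\<^bsub>R\<^esub> \<and>
     (\<Oplus>\<^bsub>R\<^esub>i \<in> {..m}. c i \<otimes>\<^bsub>R\<^esub> (a [^]\<^bsub>R\<^esub> i)) = \<zero>\<^bsub>R\<^esub>"

definition right_annihilates ::
    "('a, 'b) ring_scheme \<Rightarrow> 'a set \<Rightarrow> nat \<Rightarrow> (nat \<Rightarrow> 'a) \<Rightarrow> 'a \<Rightarrow> bool" where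
  "right_annihilates R K m c a \<longleftrightarrow>
     (\<forall>i \<le> m. c i \<in> K) \<and> c m \<noteq> \<zero>\<^bsub>R\<^esub> \<and>
     (\<Oplus>\<^bsub>R\<^esub>i \<in> {..m}. (a [^]\<^bsub>R\<^esub> i) \<otimes>\<^bsub>R\<^esub> c i) = \<zero>\<^bsub>R\<^esub>"

definition left_algebraic :: "('a, 'b) ring_scheme \<Rightarrow> 'a set \<Rightarrow> 'a \<Rightarrow> bool" where
  "left_algebraic R K a \<longleftrightarrow> (\<exists>m c. left_annihilates R K m c a)"

definition right_algebraic :: "('a, 'b) ring_scheme \<Rightarrow> 'a set \<Rightarrow> 'a \<Rightarrow> bool" where
  "right_algebraic R K a \<longleftrightarrow> (\<exists>m c. right_annihilates R K m c a)"

text \<open>The degrees are meaningful only for left (right) algebraic elements.\<close>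

definition left_degree :: "('a, 'b) ring_scheme \<Rightarrow> 'a set \<Rightarrow> 'a \<Rightarrow> nat" where
  "left_degree R K a = (LEAST m. \<exists>c. left_annihilates R K m c a)"

definition right_degree :: "('a, 'b) ring_scheme \<Rightarrow> 'a set \<Rightarrow> 'a \<Rightarrow> nat" where
  "right_degree R K a = (LEAST m. \<exists>c. right_annihilates R K m c a)"

definition left_algebraic_bounded ::
    "('a, 'b) ring_scheme \<Rightarrow> 'a set \<Rightarrow> 'a set \<Rightarrow> nat \<Rightarrow> bool" where
  "left_algebraic_bounded R K S d \<longleftrightarrow>
     (\<forall>a \<in> S. left_algebraic R K a \<and> left_degree R K a \<le> d)"

definition right_algebraic_bounded ::
    "('a, 'b) ring_scheme \<Rightarrow> 'a set \<Rightarrow> 'a set \<Rightarrow> nat \<Rightarrow> bool" where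
  "right_algebraic_bounded R K S d \<longleftrightarrow>
     (\<forall>a \<in> S. right_algebraic R K a \<and> right_degree R K a \<le> d)"

definition derived_subgroup :: "('a, 'b) ring_scheme \<Rightarrow> nat \<Rightarrow> 'a set" where
  "derived_subgroup R n = (derived (units_of R) ^^ n) (carrier (units_of R))"

text \<open>
  \<^term>\<open>ring.dimension R m F E\<close> is the library's relation that \<open>E\<close> has a basis of \<open>m\<close>
  elements over \<open>F\<close>, with scalars acting on the left; over the center the side is immaterial.
\<close>

definition dim_le :: "('a, 'b) ring_scheme \<Rightarrow> 'a set \<Rightarrow> nat \<Rightarrow> bool" where
  "dim_le R F b \<longleftrightarrow> (\<exists>m \<le> b. ring.dimension R m F (carrier R))"

end

theory Submission
  imports Defs
begin

text \<open>
  Let \<open>F\<close> be the center, \<open>L \<supseteq> K\<close> a maximal subfield and \<open>N = D\<^sup>(\<^sup>n\<^sup>)\<close>, a normal subgroup that is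
  noncentral unless \<open>D\<close> is commutative. As \<open>N\<close> is normal, right multiplication by an element of \<open>N\<close>
  on the left \<open>L\<close>-space \<open>D\<close> has only Krylov spaces of dimension at most \<open>d\<close>. This condition passes
  to limits \<open>f \<rightarrow> 0\<close> of polynomial families with parameter \<open>f \<in> F\<close>, since \<open>F\<close> is infinite. Applied to
  commutators in \<open>N\<close> of \<open>a \<in> N\<close> with \<open>1 + f x\<close>, it gives the condition for \<open>x - a x a\<^sup>-\<^sup>1\<close>, and for
  \<open>x = y - b y b\<^sup>-\<^sup>1\<close> even for sums of such elements, because these \<open>x\<close> are algebraic over \<open>F\<close> and
  so \<open>(1 + f x)\<^sup>-\<^sup>1\<close> has a central denominator. By genericity the condition then holds for all
  \<open>L\<close>-linear combinations of the corresponding right multiplications. If \<open>e\<^sub>0, \<dots>, e\<^sub>d \<in> D\<close> were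
  independent over \<open>L\<close>, no such combination could map each \<open>e\<^sub>i\<close> to \<open>e\<^sub>i\<^sub>+\<^sub>1\<close>; a functional
  witnessing this yields a nonzero operator of rank at most \<open>d\<close> that commutes with all commutators
  of \<open>N\<close>, hence with \<open>D\<close>, which is absurd. So \<open>dim\<^sub>L D \<le> d\<close>, and more than \<open>d\<^sup>2\<close> elements of \<open>D\<close>
  satisfy a relation \<open>\<Sum> l\<^sub>k u b\<^sub>k = 0\<close> for all \<open>u\<close>, which makes the \<open>b\<^sub>k\<close> dependent over \<open>F\<close>.
\<close>

section \<open>Division rings and their centers\<close>

text \<open>The degree bound is therefore kept as dependence of Krylov lists: independence of
  finitely many vectors depending polynomially on a parameter is an open condition, which is all
  that a limit needs, and linear functionals come from Zorn's lemma.

  L must be its own centralizer: an additive map of D that commutes with L on the left and with D on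
  the right is then left multiplication by an element of L, and every commutation argument ends in
  such a scalar. Commutation with all of D is reached through the Cartan-Brauer-Hua theorem from the
  conjugates of one noncentral element, which is why N must be noncentral.

  The shift of the \<open>e_i\<close> is a convenient operator to exclude because its Krylov list at
  \<open>e_0\<close> is the independent list itself.

  The number d^2 arises as follows: with m = dim_L D, the L-linear operators on D have m^2 matrix
  entries, and right multiplications by elements independent over F remain independent over L.

  Right algebraic elements are handled in the opposite ring, commutative D separately.\<close>

context div_ring
begin

lemma nz_Units: "x \<in> carrier R \<Longrightarrow> x \<noteq> \<zero> \<Longrightarrow> x \<in> Units R"
  by (simp add: div_ring_Units)

lemma inv_closed' [simp]: "x \<in> carrier R \<Longrightarrow> x \<noteq> \<zero> \<Longrightarrow> inv x \<in> carrier R"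
  by (simp add: nz_Units)

lemma inv_right [simp]: "x \<in> carrier R \<Longrightarrow> x \<noteq> \<zero> \<Longrightarrow> x \<otimes> inv x = \<one>"
  by (simp add: nz_Units)

lemma inv_left [simp]: "x \<in> carrier R \<Longrightarrow> x \<noteq> \<zero> \<Longrightarrow> inv x \<otimes> x = \<one>"
  by (simp add: nz_Units)

lemma inv_nonzero [simp]: "x \<in> carrier R \<Longrightarrow> x \<noteq> \<zero> \<Longrightarrow> inv x \<noteq> \<zero>"
  using nz_Units[of x] Units_inv_Units[of x] div_ring_Units by blast

lemma inv_inv' [simp]: "x \<in> carrier R \<Longrightarrow> x \<noteq> \<zero> \<Longrightarrow> inv (inv x) = x"
  by (simp add: nz_Units)

lemma inv_cancel_left [simp]:
  "x \<in> carrier R \<Longrightarrow> x \<noteq> \<zero> \<Longrightarrow> y \<in> carrier R \<Longrightarrow> inv x \<otimes> (x \<otimes> y) = y"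
  "x \<in> carrier R \<Longrightarrow> x \<noteq> \<zero> \<Longrightarrow> y \<in> carrier R \<Longrightarrow> x \<otimes> (inv x \<otimes> y) = y"
  by (simp_all add: m_assoc[symmetric])

lemma inv_cancel_right [simp]:
  "x \<in> carrier R \<Longrightarrow> x \<noteq> \<zero> \<Longrightarrow> y \<in> carrier R \<Longrightarrow> y \<otimes> inv x \<otimes> x = y"
  "x \<in> carrier R \<Longrightarrow> x \<noteq> \<zero> \<Longrightarrow> y \<in> carrier R \<Longrightarrow> y \<otimes> x \<otimes> inv x = y"
  by (simp_all add: m_assoc)

lemma mult_eq_zero_iff:
  assumes "x \<in> carrier R" "y \<in> carrier R"
  shows "x \<otimes> y = \<zero> \<longleftrightarrow> x = \<zero> \<or> y = \<zero>"
proof -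
  have "y = \<zero>" if "x \<otimes> y = \<zero>" "x \<noteq> \<zero>"
    using inv_cancel_left(1)[OF assms(1) that(2) assms(2)] that assms by simp
  then show ?thesis using assms by auto
qed

lemma mult_cancel_left':
  assumes "x \<in> carrier R" "x \<noteq> \<zero>" "y \<in> carrier R" "z \<in> carrier R" "x \<otimes> y = x \<otimes> z"
  shows "y = z"
  using assms by (metis inv_cancel_left(1))

lemma mult_cancel_right':
  assumes "x \<in> carrier R" "x \<noteq> \<zero>" "y \<in> carrier R" "z \<in> carrier R" "y \<otimes> x = z \<otimes> x"
  shows "y = z"
  using assms by (metis inv_cancel_right(2))

lemma inv_mult':
  assumes "x \<in> carrier R" "x \<noteq> \<zero>" "y \<in> carrier R" "y \<noteq> \<zero>"
  shows "inv (x \<otimes> y) = inv y \<otimes> inv x"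
proof -
  have "x \<otimes> y \<otimes> (inv y \<otimes> inv x) = \<one>" "inv y \<otimes> inv x \<otimes> (x \<otimes> y) = \<one>"
    using assms by (simp_all add: m_assoc)
  then show ?thesis using assms by (metis inv_closed' inv_unique' m_closed)
qed

lemma conj_mult:
  assumes "z \<in> carrier R" "z \<noteq> \<zero>" "x \<in> carrier R" "y \<in> carrier R"
  shows "z \<otimes> (x \<otimes> y) \<otimes> inv z = (z \<otimes> x \<otimes> inv z) \<otimes> (z \<otimes> y \<otimes> inv z)"
  using assms by (simp add: m_assoc)

lemma conj_inv:
  assumes "z \<in> carrier R" "z \<noteq> \<zero>" "x \<in> carrier R" "x \<noteq> \<zero>"
  shows "z \<otimes> inv x \<otimes> inv z = inv (z \<otimes> x \<otimes> inv z)"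
  using assms by (simp add: inv_mult' m_assoc mult_eq_zero_iff)

lemma minus_eq_zero_iff:
  assumes "x \<in> carrier R" "y \<in> carrier R"
  shows "x \<ominus> y = \<zero> \<longleftrightarrow> x = y"
  using assms by simp

lemma commute_inv:
  assumes "x \<in> carrier R" "x \<noteq> \<zero>" "y \<in> carrier R" "x \<otimes> y = y \<otimes> x"
  shows "inv x \<otimes> y = y \<otimes> inv x"
proof -
  have "x \<otimes> (inv x \<otimes> y) = x \<otimes> (y \<otimes> inv x)"
    using assms by (simp add: m_assoc[symmetric])
  then show ?thesis using assms by (meson inv_closed' m_closed mult_cancel_left')
qed

text \<open>For \<open>u\<close> not commuting with \<open>a\<close>, comparing the conjugates \<open>c\<close>, \<open>b\<close> of \<open>a\<close> by \<open>u\<close> and \<open>\<one> \<oplus> u\<close>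
  gives \<open>(b \<ominus> c) \<otimes> u = a \<ominus> b\<close>, so that \<open>u\<close> is expressed by conjugates of \<open>a\<close>.\<close>
theorem cartan_brauer_hua:
  assumes S: "S \<subseteq> carrier R"
    and minus: "\<And>x y. x \<in> S \<Longrightarrow> y \<in> S \<Longrightarrow> x \<ominus> y \<in> S"
    and mult: "\<And>x y. x \<in> S \<Longrightarrow> y \<in> S \<Longrightarrow> x \<otimes> y \<in> S"
    and invs: "\<And>x. x \<in> S \<Longrightarrow> x \<noteq> \<zero> \<Longrightarrow> inv x \<in> S"
    and a: "a \<in> carrier R" and conj: "\<And>z. z \<in> carrier R \<Longrightarrow> z \<noteq> \<zero> \<Longrightarrow> z \<otimes> a \<otimes> inv z \<in> S"
    and nc: "a \<notin> ring_center R"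
  shows "S = carrier R"
proof
  have noncommuting: "u \<in> S" if u: "u \<in> carrier R" and ua: "u \<otimes> a \<noteq> a \<otimes> u" for u
  proof -
    define b where "b = (\<one> \<oplus> u) \<otimes> a \<otimes> inv (\<one> \<oplus> u)"
    define c where "c = u \<otimes> a \<otimes> inv u"
    have u0: "u \<noteq> \<zero>" using ua a by auto
    have u1: "\<one> \<oplus> u \<noteq> \<zero>"
    proof
      assume "\<one> \<oplus> u = \<zero>"
      then have "u = \<ominus> \<one>" using u by (metis add.m_comm minus_equality one_closed)
      then show False using ua a by (simp add: l_minus r_minus)
    qed
    have bS: "b \<in> S" and cS: "c \<in> S" and aS: "a \<in> S"
      using conj[of "\<one> \<oplus> u"] conj[of u] conj[of \<one>] u u0 u1 a one_not_zero
      by (auto simp: b_def c_def)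
    then have bc [simp]: "b \<in> carrier R" "c \<in> carrier R" using S by auto
    have 1: "b \<otimes> (\<one> \<oplus> u) = (\<one> \<oplus> u) \<otimes> a" and 2: "c \<otimes> u = u \<otimes> a"
      using u u0 u1 a by (simp_all add: b_def c_def)
    have "b \<oplus> b \<otimes> u = a \<oplus> c \<otimes> u" using 1 2 u a by (simp add: l_distr r_distr)
    have "(b \<ominus> c) \<otimes> u = (b \<oplus> b \<otimes> u) \<ominus> b \<ominus> c \<otimes> u" using u a bc by algebra
    also have "\<dots> = (a \<oplus> c \<otimes> u) \<ominus> b \<ominus> c \<otimes> u" using \<open>b \<oplus> b \<otimes> u = a \<oplus> c \<otimes> u\<close> by simp
    also have "\<dots> = a \<ominus> b" using u a bc by algebra
    finally have 3: "(b \<ominus> c) \<otimes> u = a \<ominus> b" .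
    have "b \<noteq> c"
    proof
      assume "b = c"
      then have "(b \<ominus> c) \<otimes> u = \<zero>" using u a by (simp add: r_neg minus_eq)
      then have "a = b" using 3 a by simp
      then show False using 2 \<open>b = c\<close> ua by simp
    qed
    then have nz: "b \<ominus> c \<noteq> \<zero>" by simp
    have "u = inv (b \<ominus> c) \<otimes> (a \<ominus> b)"
      using inv_cancel_left(1)[OF _ nz u] 3 by simp
    then show "u \<in> S" using mult invs minus bS cS aS nz by metis
  qed
  from nc a obtain w where w: "w \<in> carrier R" "w \<otimes> a \<noteq> a \<otimes> w"
    by (auto simp: ring_center_def)
  show "carrier R \<subseteq> S"
  proof
    fix u assume u: "u \<in> carrier R"
    show "u \<in> S"
    proof (cases "u \<otimes> a = a \<otimes> u")
      case True
      have "(u \<oplus> w) \<otimes> a \<noteq> a \<otimes> (u \<oplus> w)"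
        using u w a True by (simp add: l_distr r_distr)
      then have "u \<oplus> w \<in> S" "w \<in> S" using noncommuting u w by auto
      then have "(u \<oplus> w) \<ominus> w \<in> S" by (rule minus)
      moreover have "(u \<oplus> w) \<ominus> w = u" using u w by algebra
      ultimately show ?thesis by simp
    qed (use u noncommuting in blast)
  qed
qed (rule S)

section \<open>Centralizers and maximal subfields\<close>

definition centralizer :: "'a set \<Rightarrow> 'a set" where
  "centralizer S = {x \<in> carrier R. \<forall>y \<in> S. x \<otimes> y = y \<otimes> x}"

lemma centralizer_closed:
  assumes "S \<subseteq> carrier R"
  shows "centralizer S \<subseteq> carrier R" "\<zero> \<in> centralizer S" "\<one> \<in> centralizer S"
    and "x \<in> centralizer S \<Longrightarrow> y \<in> centralizer S \<Longrightarrow> x \<oplus> y \<in> centralizer S"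
    and "x \<in> centralizer S \<Longrightarrow> \<ominus> x \<in> centralizer S"
    and "x \<in> centralizer S \<Longrightarrow> y \<in> centralizer S \<Longrightarrow> x \<ominus> y \<in> centralizer S"
    and "x \<in> centralizer S \<Longrightarrow> y \<in> centralizer S \<Longrightarrow> x \<otimes> y \<in> centralizer S"
    and "x \<in> centralizer S \<Longrightarrow> x \<noteq> \<zero> \<Longrightarrow> inv x \<in> centralizer S"
proof -
  show mult: "x \<in> centralizer S \<Longrightarrow> y \<in> centralizer S \<Longrightarrow> x \<otimes> y \<in> centralizer S"
    using assms by (auto simp: centralizer_def subset_iff) (metis m_assoc)
  show add: "x \<in> centralizer S \<Longrightarrow> y \<in> centralizer S \<Longrightarrow> x \<oplus> y \<in> centralizer S" for y
    using assms by (auto simp: centralizer_def subset_iff l_distr r_distr)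
  show neg: "x \<in> centralizer S \<Longrightarrow> \<ominus> x \<in> centralizer S" for x
    using assms by (auto simp: centralizer_def subset_iff l_minus r_minus)
  show "x \<in> centralizer S \<Longrightarrow> y \<in> centralizer S \<Longrightarrow> x \<ominus> y \<in> centralizer S"
    using add neg by (simp add: minus_eq)
  show "x \<in> centralizer S \<Longrightarrow> x \<noteq> \<zero> \<Longrightarrow> inv x \<in> centralizer S"
    using assms by (auto simp: centralizer_def subset_iff commute_inv)
qed (use assms in \<open>auto simp: centralizer_def subset_iff\<close>)

lemma subfield_if_commutative:
  assumes K: "K \<subseteq> carrier R" "\<one> \<in> K"
    and neg: "\<And>x. x \<in> K \<Longrightarrow> \<ominus> x \<in> K"
    and add: "\<And>x y. x \<in> K \<Longrightarrow> y \<in> K \<Longrightarrow> x \<oplus> y \<in> K"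
    and mult: "\<And>x y. x \<in> K \<Longrightarrow> y \<in> K \<Longrightarrow> x \<otimes> y \<in> K"
    and invs: "\<And>x. x \<in> K \<Longrightarrow> x \<noteq> \<zero> \<Longrightarrow> inv x \<in> K"
    and comm: "\<And>x y. x \<in> K \<Longrightarrow> y \<in> K \<Longrightarrow> x \<otimes> y = y \<otimes> x"
  shows "subfield K R"
proof (rule subfieldI)
  show "subcring K R"
    by (rule subcringI[OF subringI]) (use assms in auto)
  have "x \<noteq> \<zero>" if "x \<in> Units (R \<lparr> carrier := K \<rparr>)" for x
    using that K one_not_zero by (auto simp: Units_def)
  moreover have "x \<in> Units (R \<lparr> carrier := K \<rparr>)" if "x \<in> K" "x \<noteq> \<zero>" for x
    using that K invs[OF that] by (auto simp: Units_def intro!: bexI[of _ "inv x"])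
  ultimately show "Units (R \<lparr> carrier := K \<rparr>) = K - {\<zero>}"
    by (auto simp: Units_def)
qed

lemma ring_center_eq: "ring_center R = centralizer (carrier R)"
  by (simp add: ring_center_def centralizer_def)

lemma subfield_center: "subfield (ring_center R) R"
proof (rule subfield_if_commutative)
  show "x \<otimes> y = y \<otimes> x" if "x \<in> ring_center R" "y \<in> ring_center R" for x y
    using that unfolding ring_center_def by blast
qed (unfold ring_center_eq, rule centralizer_closed(1,3,4,5,7,8); simp)+

lemma subfield_self_centralizer:
  assumes "L \<subseteq> carrier R" "centralizer L = L"
  shows "subfield L R"
proof (rule subfield_if_commutative)
  show "x \<otimes> y = y \<otimes> x" if "x \<in> L" "y \<in> L" for x y
    using that assms by (auto simp: centralizer_def)
qed (rule assms(1) centralizer_closed(3,4,5,7,8)[OF assms(1), unfolded assms(2)]; assumption?)+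

text \<open>Zorn's lemma is applied to mere commuting subsets, without any ring structure: a maximal
  one absorbs each element of its centralizer, hence equals it, and centralizers are closed under
  all the operations anyway.\<close>

lemma exists_self_centralizer:
  assumes "K \<subseteq> carrier R" "\<And>x y. x \<in> K \<Longrightarrow> y \<in> K \<Longrightarrow> x \<otimes> y = y \<otimes> x"
  shows "\<exists>L. K \<subseteq> L \<and> L \<subseteq> carrier R \<and> centralizer L = L"
proof -
  define A where "A = {L. K \<subseteq> L \<and> L \<subseteq> carrier R \<and> (\<forall>x \<in> L. \<forall>y \<in> L. x \<otimes> y = y \<otimes> x)}"
  have "\<exists>M \<in> A. \<forall>X \<in> A. M \<subseteq> X \<longrightarrow> X = M"
  proof (rule subset_Zorn_nonempty)
    show "A \<noteq> {}" using assms by (auto simp: A_def)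
    show "\<Union>C \<in> A" if "C \<noteq> {}" "subset.chain A C" for C
    proof -
      have C: "C \<subseteq> A" "\<And>X Y. X \<in> C \<Longrightarrow> Y \<in> C \<Longrightarrow> X \<subseteq> Y \<or> Y \<subseteq> X"
        using that by (auto simp: subset_chain_def)
      have "x \<otimes> y = y \<otimes> x" if xy: "x \<in> \<Union>C" "y \<in> \<Union>C" for x y
      proof -
        obtain X Y where "X \<in> C" "Y \<in> C" "x \<in> X" "y \<in> Y" using xy by auto
        with C obtain Z where "Z \<in> C" "x \<in> Z" "y \<in> Z" by blast
        then show ?thesis using C by (auto simp: A_def)
      qed
      moreover have "K \<subseteq> \<Union>C" "\<Union>C \<subseteq> carrier R" using \<open>C \<noteq> {}\<close> C(1) unfolding A_def by blast+
      ultimately show ?thesis by (simp add: A_def)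
    qed
  qed
  then obtain L where L: "L \<in> A" and max: "\<And>X. X \<in> A \<Longrightarrow> L \<subseteq> X \<Longrightarrow> X = L" by blast
  have "x \<in> L" if "x \<in> centralizer L" for x
  proof -
    have "insert x L \<in> A" using L that by (auto simp: A_def centralizer_def)
    with max[of "insert x L"] show ?thesis by auto
  qed
  then have "centralizer L = L" using L by (auto simp: A_def centralizer_def)
  then show ?thesis using L by (auto simp: A_def)
qed

end

section \<open>Normal subgroups of the unit group and their noncentral commutators\<close>

locale normal_units = div_ring +
  fixes N
  assumes N_sub: "N \<subseteq> carrier R - {\<zero>}"
    and N_mult: "x \<in> N \<Longrightarrow> y \<in> N \<Longrightarrow> x \<otimes> y \<in> N"
    and N_inv: "x \<in> N \<Longrightarrow> inv x \<in> N"
    and N_conj: "z \<in> carrier R \<Longrightarrow> z \<noteq> \<zero> \<Longrightarrow> x \<in> N \<Longrightarrow> z \<otimes> x \<otimes> inv z \<in> N"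
begin

lemma N_carrier [simp]: "x \<in> N \<Longrightarrow> x \<in> carrier R"
  and N_nonzero [simp]: "x \<in> N \<Longrightarrow> x \<noteq> \<zero>"
  using N_sub by auto

text \<open>If \<open>a\<close> in \<open>N\<close> were noncentral, the centralizer of
  \<open>N\<close> would be a division subring containing all conjugates of \<open>a\<close>, since
  these lie in the commutative group \<open>N\<close>. By \<open>cartan_brauer_hua\<close> it would
  be everything, and \<open>a\<close> would be central after all.\<close>

lemma center_if_commuting:
  assumes "\<And>a b. a \<in> N \<Longrightarrow> b \<in> N \<Longrightarrow> a \<otimes> b = b \<otimes> a"
  shows "N \<subseteq> ring_center R"
proof (rule ccontr)
  assume "\<not> N \<subseteq> ring_center R"
  then obtain a where a: "a \<in> N" "a \<notin> ring_center R" by auto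
  have "centralizer N = carrier R"
  proof (rule cartan_brauer_hua[of _ a])
    show "z \<otimes> a \<otimes> inv z \<in> centralizer N" if "z \<in> carrier R" "z \<noteq> \<zero>" for z
      using N_conj[OF that a(1)] assms by (auto simp: centralizer_def)
    have N: "N \<subseteq> carrier R" using N_sub by auto
    show "x \<ominus> y \<in> centralizer N" "x \<otimes> y \<in> centralizer N"
      if "x \<in> centralizer N" "y \<in> centralizer N" for x y
      by (rule centralizer_closed(6,7)[OF N that])+
    show "inv x \<in> centralizer N" if "x \<in> centralizer N" "x \<noteq> \<zero>" for x
      by (rule centralizer_closed(8)[OF N that])
    show "centralizer N \<subseteq> carrier R" by (rule centralizer_closed(1)[OF N])
  qed (use a in auto)
  then have "a \<in> ring_center R" using a(1)
    unfolding centralizer_def ring_center_def set_eq_iff by (simp, metis)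
  with a(2) show False ..
qed

end

text \<open>The commutative computation behind \<open>quadratic_over_center\<close>, with
  \<open>f \<otimes> b\<close> for \<open>p\<close>. The difference of the two sides of
  \<open>rel\<close> has the coefficients \<open>e'\<close>, \<open>t\<close> and
  \<open>e' \<otimes> c \<otimes> c\<close>. Fixing \<open>e'\<close> and \<open>t\<close> by sums
  keeps subtraction out of the normalization.\<close>

lemma (in cring) quadratic_relation:
  assumes [simp]: "p \<in> carrier R" "c \<in> carrier R" "e \<in> carrier R" "e' \<in> carrier R" "t \<in> carrier R"
    and rel: "(\<one> \<oplus> c \<otimes> p) \<otimes> (\<one> \<oplus> c \<otimes> p) = e \<otimes> ((\<one> \<oplus> p) \<otimes> (\<one> \<oplus> c \<otimes> c \<otimes> p))"
    and e': "e' \<oplus> e = \<one>" and t: "t \<oplus> e \<otimes> (\<one> \<oplus> c \<otimes> c) = c \<oplus> c"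
  shows "e' \<oplus> t \<otimes> p \<oplus> e' \<otimes> (c \<otimes> c \<otimes> p \<otimes> p) = \<zero>"
proof -
  let ?E = "e \<otimes> ((\<one> \<oplus> p) \<otimes> (\<one> \<oplus> c \<otimes> c \<otimes> p))"
  let ?X = "e' \<oplus> t \<otimes> p \<oplus> e' \<otimes> (c \<otimes> c \<otimes> p \<otimes> p)"
  have "?E = e \<oplus> (e \<otimes> (\<one> \<oplus> c \<otimes> c)) \<otimes> p \<oplus> e \<otimes> (c \<otimes> c \<otimes> p \<otimes> p)"
    by (simp add: l_distr r_distr m_ac a_ac)
  then have "?X \<oplus> ?E = (e' \<oplus> e) \<oplus> (t \<oplus> e \<otimes> (\<one> \<oplus> c \<otimes> c)) \<otimes> p \<oplus> (e' \<oplus> e) \<otimes> (c \<otimes> c \<otimes> p \<otimes> p)"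
    by (simp add: l_distr a_ac del: r_distr)
  also have "\<dots> = \<one> \<oplus> (c \<oplus> c) \<otimes> p \<oplus> \<one> \<otimes> (c \<otimes> c \<otimes> p \<otimes> p)"
    by (simp only: e' t)
  also have "\<dots> = (\<one> \<oplus> c \<otimes> p) \<otimes> (\<one> \<oplus> c \<otimes> p)"
    by (simp add: l_distr r_distr m_ac a_ac)
  also have "\<dots> = \<zero> \<oplus> ?E" by (simp add: rel)
  finally show ?thesis using add.right_cancel[of ?E ?X \<zero>] by simp
qed

context div_ring
begin

lemma center_carrier [simp]: "z \<in> ring_center R \<Longrightarrow> z \<in> carrier R"
  by (simp add: ring_center_def)

lemma center_commute: "z \<in> ring_center R \<Longrightarrow> x \<in> carrier R \<Longrightarrow> x \<otimes> z = z \<otimes> x"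
  unfolding ring_center_def by auto

lemma center_left_commute:
  "z \<in> ring_center R \<Longrightarrow> x \<in> carrier R \<Longrightarrow> y \<in> carrier R \<Longrightarrow> x \<otimes> (z \<otimes> y) = z \<otimes> (x \<otimes> y)"
  by (metis center_carrier center_commute m_assoc)

lemma center_closed [simp]:
  "\<one> \<in> ring_center R" "\<zero> \<in> ring_center R"
  "x \<in> ring_center R \<Longrightarrow> \<ominus> x \<in> ring_center R"
  "x \<in> ring_center R \<Longrightarrow> y \<in> ring_center R \<Longrightarrow> x \<oplus> y \<in> ring_center R"
  "x \<in> ring_center R \<Longrightarrow> y \<in> ring_center R \<Longrightarrow> x \<ominus> y \<in> ring_center R"
  "x \<in> ring_center R \<Longrightarrow> y \<in> ring_center R \<Longrightarrow> x \<otimes> y \<in> ring_center R"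
  "x \<in> ring_center R \<Longrightarrow> x \<noteq> \<zero> \<Longrightarrow> inv x \<in> ring_center R"
  unfolding ring_center_eq by (simp_all add: centralizer_closed)

lemma center_subset_self_centralizer:
  assumes "L \<subseteq> carrier R" "centralizer L = L"
  shows "ring_center R \<subseteq> L"
proof
  fix z assume z: "z \<in> ring_center R"
  then have "z \<in> centralizer L" using assms(1) 
    by (auto simp: centralizer_def) (metis center_commute subsetD)
  then show "z \<in> L" by (simp add: assms(2))
qed

end

context normal_units
begin

text \<open>Conjugation by \<open>a\<close> sends \<open>\<one> \<oplus> z \<otimes> b\<close> to \<open>\<one> \<oplus> z \<otimes> c \<otimes> b\<close>. Comparing the commutator of
  \<open>\<one> \<oplus> f \<otimes> b\<close> and \<open>a\<close> with its conjugate by \<open>a\<close> gives a quadratic equation for \<open>b\<close>, whose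
  constant term varies with \<open>f\<close> unless \<open>c = \<one>\<close>.\<close>
lemma commutator_relation:
  assumes a: "a \<in> N" and b: "b \<in> N" and c: "c \<in> ring_center R" and ab: "a \<otimes> b = c \<otimes> (b \<otimes> a)"
    and central: "\<And>x y. x \<in> N \<Longrightarrow> y \<in> N \<Longrightarrow> x \<otimes> y \<otimes> inv x \<otimes> inv y \<in> ring_center R"
    and b': "b \<notin> ring_center R" and f: "f \<in> ring_center R"
  shows "\<exists>e \<in> ring_center R. (\<one> \<oplus> f \<otimes> c \<otimes> b) \<otimes> (\<one> \<oplus> f \<otimes> c \<otimes> b) =
           e \<otimes> ((\<one> \<oplus> f \<otimes> b) \<otimes> (\<one> \<oplus> f \<otimes> c \<otimes> c \<otimes> b))"
proof -
  note [simp] = a b c f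
  \<comment> \<open>Otherwise \<open>b\<close> would be the central element
    \<open>inv z \<otimes> (\<ominus> \<one>)\<close>.\<close>
  have nz: "\<one> \<oplus> z \<otimes> b \<noteq> \<zero>" if z: "z \<in> ring_center R" for z
  proof
    assume "\<one> \<oplus> z \<otimes> b = \<zero>"
    then have zb: "z \<otimes> b = \<ominus> \<one>" using z by (metis add.m_comm b N_carrier center_carrier m_closed minus_equality one_closed)
    moreover have "\<ominus> \<one> \<noteq> \<zero>" by (metis one_not_zero minus_minus minus_zero one_closed)
    ultimately have "z \<noteq> \<zero>" using zb b by (metis N_carrier l_null)
    then have "b = inv z \<otimes> (\<ominus> \<one>)" using z zb inv_cancel_left(1)[of z b] by simp
    also have "\<dots> \<in> ring_center R" using z \<open>z \<noteq> \<zero>\<close> by (intro center_closed) auto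
    finally show False using b' by simp
  qed
  define P Q S where "P = \<one> \<oplus> f \<otimes> b" and "Q = \<one> \<oplus> f \<otimes> c \<otimes> b" and "S = \<one> \<oplus> f \<otimes> c \<otimes> c \<otimes> b"
  have [simp]: "P \<noteq> \<zero>" "Q \<noteq> \<zero>" "S \<noteq> \<zero>" "P \<in> carrier R" "Q \<in> carrier R" "S \<in> carrier R"
    using nz[of f] nz[of "f \<otimes> c"] nz[of "f \<otimes> c \<otimes> c"] by (auto simp: P_def Q_def S_def)
  have shift: "a \<otimes> (\<one> \<oplus> z \<otimes> b) = (\<one> \<oplus> z \<otimes> c \<otimes> b) \<otimes> a" if z: "z \<in> ring_center R" for z
    using z by (simp add: r_distr l_distr center_left_commute[OF z] m_assoc ab)
  have aP: "a \<otimes> P = Q \<otimes> a" and aQ: "a \<otimes> Q = S \<otimes> a"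
    using shift[of f] shift[of "f \<otimes> c"] by (simp_all add: P_def Q_def S_def m_assoc)
  have comm: "(\<one> \<oplus> z \<otimes> b) \<otimes> (\<one> \<oplus> w \<otimes> b) = (\<one> \<oplus> w \<otimes> b) \<otimes> (\<one> \<oplus> z \<otimes> b)"
    if "z \<in> ring_center R" "w \<in> ring_center R" for z w
  proof -
    have "z \<otimes> b \<otimes> (w \<otimes> b) = w \<otimes> b \<otimes> (z \<otimes> b)"
      using that by (simp add: m_assoc center_left_commute[of w b b] center_left_commute[of z b b])
        (simp add: m_assoc[symmetric] center_commute)
    then show ?thesis using that by (simp add: l_distr r_distr add.m_ac)
  qed
  have QS: "Q \<otimes> S = S \<otimes> Q" unfolding Q_def S_def by (rule comm) simp_all
  define g where "g = P \<otimes> a \<otimes> inv P \<otimes> inv a"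
  have gN: "g \<in> N" unfolding g_def by (intro N_mult N_conj N_inv) simp_all
  have aPi: "a \<otimes> inv P = inv Q \<otimes> a"
  proof -
    have "Q \<otimes> (a \<otimes> inv P) = Q \<otimes> (inv Q \<otimes> a)"
      by (simp add: m_assoc[symmetric] aP[symmetric])
    then show ?thesis by (rule mult_cancel_left'[rotated -1]) simp_all
  qed
  have aQi: "a \<otimes> inv Q = inv S \<otimes> a"
  proof -
    have "S \<otimes> (a \<otimes> inv Q) = S \<otimes> (inv S \<otimes> a)"
      by (simp add: m_assoc[symmetric] aQ[symmetric])
    then show ?thesis by (rule mult_cancel_left'[rotated -1]) simp_all
  qed
  have g: "g = P \<otimes> inv Q" by (simp add: g_def m_assoc aPi)
  \<comment> \<open>Conjugation by \<open>a\<close> takes \<open>g = P \<otimes> inv Q\<close> to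
    \<open>Q \<otimes> inv S\<close>. The two differ by the central factor \<open>e\<close>, and
    clearing denominators gives \<open>Q \<otimes> Q = e \<otimes> (P \<otimes> S)\<close>.\<close>
  define e where "e = a \<otimes> g \<otimes> inv a \<otimes> inv g"
  have e [simp]: "e \<in> ring_center R" unfolding e_def by (rule central) (use gN in simp_all)
  have "a \<otimes> g = e \<otimes> (g \<otimes> a)" using gN by (simp add: e_def m_assoc)
  moreover have "a \<otimes> g = Q \<otimes> inv S \<otimes> a"
    by (simp add: g m_assoc[symmetric] aP) (simp add: m_assoc aQi)
  ultimately have "Q \<otimes> inv S \<otimes> a = e \<otimes> g \<otimes> a" using gN by (simp add: m_assoc)
  then have "Q \<otimes> inv S = e \<otimes> g" by (rule mult_cancel_right'[rotated -1]) (use gN in simp_all)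
  then have "Q \<otimes> inv S \<otimes> S \<otimes> Q = e \<otimes> (P \<otimes> inv Q) \<otimes> S \<otimes> Q" by (simp add: g)
  then have "Q \<otimes> Q = e \<otimes> (P \<otimes> (inv Q \<otimes> (S \<otimes> Q)))" by (simp add: m_assoc)
  also have "inv Q \<otimes> (S \<otimes> Q) = S" by (simp add: QS[symmetric])
  finally show ?thesis using e unfolding P_def Q_def S_def by blast
qed

text \<open>The relation from \<open>commutator_relation\<close> is solved for the quadratic term.
  After division by \<open>e'\<close> and \<open>f \<otimes> f\<close> its constant term is
  \<open>inv (f \<otimes> f)\<close>, so the left side is fixed while the right side visibly depends
  on \<open>f\<close>.\<close>

lemma quadratic_over_center:
  assumes a: "a \<in> N" and b: "b \<in> N" and c: "c \<in> ring_center R" and ab: "a \<otimes> b = c \<otimes> (b \<otimes> a)" "c \<noteq> \<one>"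
    and central: "\<And>x y. x \<in> N \<Longrightarrow> y \<in> N \<Longrightarrow> x \<otimes> y \<otimes> inv x \<otimes> inv y \<in> ring_center R"
    and b': "b \<notin> ring_center R" and f: "f \<in> ring_center R" "f \<noteq> \<zero>"
  shows "\<exists>s \<in> ring_center R. c \<otimes> c \<otimes> b \<otimes> b = s \<otimes> b \<ominus> inv (f \<otimes> f)"
proof -
  note [simp] = a b c f
  obtain e where e [simp]: "e \<in> ring_center R" and
    rel: "(\<one> \<oplus> f \<otimes> c \<otimes> b) \<otimes> (\<one> \<oplus> f \<otimes> c \<otimes> b) = e \<otimes> ((\<one> \<oplus> f \<otimes> b) \<otimes> (\<one> \<oplus> f \<otimes> c \<otimes> c \<otimes> b))"
    using commutator_relation[OF a b c ab(1) central b' f(1)] by blast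
  \<comment> \<open>A maximal subfield containing \<open>b\<close> also contains the center, so the
    relation can be treated in a commutative ring.\<close>
  obtain L where L: "{b} \<subseteq> L" "L \<subseteq> carrier R" "centralizer L = L"
    using exists_self_centralizer[of "{b}"] by auto
  then have FL: "ring_center R \<subseteq> L" by (intro center_subset_self_centralizer)
  have "field (R\<lparr>carrier := L\<rparr>)"
    using subfield_iff(2)[OF subfield_self_centralizer[OF L(2,3)]] .
  then have cr: "cring (R\<lparr>carrier := L\<rparr>)"
    by (simp add: domain_def field_def)
  define e' where "e' = \<one> \<ominus> e"
  define t where "t = (c \<oplus> c) \<ominus> e \<otimes> (\<one> \<oplus> c \<otimes> c)"
  have e' [simp]: "e' \<in> ring_center R" and t [simp]: "t \<in> ring_center R" by (simp_all add: e'_def t_def)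
  have e'e: "e' \<oplus> e = \<one>" using center_carrier[OF e] unfolding e'_def by algebra
  have tt: "t \<oplus> e \<otimes> (\<one> \<oplus> c \<otimes> c) = c \<oplus> c"
    using center_carrier[OF e] center_carrier[OF c] unfolding t_def by algebra
  have rel': "(\<one> \<oplus> c \<otimes> (f \<otimes> b)) \<otimes> (\<one> \<oplus> c \<otimes> (f \<otimes> b))
      = e \<otimes> ((\<one> \<oplus> f \<otimes> b) \<otimes> (\<one> \<oplus> c \<otimes> c \<otimes> (f \<otimes> b)))"
    using rel by (simp add: m_assoc center_left_commute[OF f(1)])
  have "f \<otimes> b \<in> L" using L FL f(1) subfieldE(1)[OF subfield_self_centralizer[OF L(2,3)]]
    by (meson insert_subset subringE(6) subsetD)
  then have q0: "e' \<oplus> t \<otimes> (f \<otimes> b) \<oplus> e' \<otimes> (c \<otimes> c \<otimes> (f \<otimes> b) \<otimes> (f \<otimes> b)) = \<zero>"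
    using cring.quadratic_relation[OF cr, of "f \<otimes> b" c e e' t] FL rel' e'e tt by (auto simp: subset_iff)
  \<comment> \<open>For \<open>e = \<one>\<close> only \<open>t = \<zero>\<close> would remain,
    which says that \<open>c \<ominus> \<one>\<close> has square zero, against
    \<open>c \<noteq> \<one>\<close>.\<close>
  have e'0: "e' \<noteq> \<zero>"
  proof
    assume z: "e' = \<zero>"
    then have "t = \<zero>" using q0 f(2) b' by (auto simp: mult_eq_zero_iff)
    moreover have "e = \<one>" using z e'e by simp
    ultimately have cc: "\<one> \<oplus> c \<otimes> c = c \<oplus> c" using tt by simp
    have cR: "c \<in> carrier R" "c \<otimes> c \<in> carrier R" by simp_all
    have "(c \<ominus> \<one>) \<otimes> c = c \<otimes> c \<ominus> c" by (simp add: minus_eq l_distr l_minus)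
    also have "\<dots> = (\<one> \<oplus> c \<otimes> c) \<ominus> \<one> \<ominus> c" using cR by algebra
    also have "\<dots> = (c \<oplus> c) \<ominus> \<one> \<ominus> c" by (simp only: cc)
    also have "\<dots> = c \<ominus> \<one>" using cR by algebra
    also have "\<dots> = (c \<ominus> \<one>) \<otimes> \<one>" by simp
    finally have "c \<ominus> \<one> = \<zero>" using ab(2) mult_cancel_left'[of "c \<ominus> \<one>" c \<one>] by auto
    then show False using ab(2) by simp
  qed
  define X where "X = c \<otimes> c \<otimes> b \<otimes> b"
  have [simp]: "X \<in> carrier R" by (simp add: X_def)
  have "c \<otimes> c \<otimes> (f \<otimes> b) \<otimes> (f \<otimes> b) = (f \<otimes> f) \<otimes> X"
  proof -
    have "c \<otimes> (c \<otimes> (f \<otimes> y)) = f \<otimes> (c \<otimes> (c \<otimes> y))" if "y \<in> carrier R" for y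
      using that by (simp add: center_left_commute[OF f(1), of c])
    moreover have "b \<otimes> (f \<otimes> b) = f \<otimes> (b \<otimes> b)" by (simp add: center_left_commute[OF f(1)])
    ultimately show ?thesis by (simp add: X_def m_assoc)
  qed
  then have q': "e' \<oplus> (t \<otimes> f) \<otimes> b \<oplus> e' \<otimes> ((f \<otimes> f) \<otimes> X) = \<zero>"
    using q0 by (simp add: m_assoc)
  have ff: "f \<otimes> f \<noteq> \<zero>" "f \<otimes> f \<in> ring_center R" by (simp_all add: mult_eq_zero_iff)
  define s where "s = \<ominus> (inv (f \<otimes> f) \<otimes> (inv e' \<otimes> (t \<otimes> f)))"
  have s: "s \<in> ring_center R" unfolding s_def using ff e'0 by (intro center_closed) auto
  have "inv (f \<otimes> f) \<otimes> (inv e' \<otimes> (e' \<oplus> (t \<otimes> f) \<otimes> b \<oplus> e' \<otimes> ((f \<otimes> f) \<otimes> X))) = \<zero>"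
    using q' ff e'0 by simp
  then have "inv (f \<otimes> f) \<oplus> inv (f \<otimes> f) \<otimes> (inv e' \<otimes> ((t \<otimes> f) \<otimes> b)) \<oplus> X = \<zero>"
    using ff e'0 by (simp add: r_distr)
  then have 1: "inv (f \<otimes> f) \<oplus> (\<ominus> s) \<otimes> b \<oplus> X = \<zero>"
    using ff e'0 by (simp add: s_def m_assoc)
  have ic: "inv (f \<otimes> f) \<in> carrier R" using ff by simp
  have "X = (inv (f \<otimes> f) \<oplus> (\<ominus> s) \<otimes> b \<oplus> X) \<oplus> s \<otimes> b \<ominus> inv (f \<otimes> f)"
    using center_carrier[OF s] N_carrier[OF b] \<open>X \<in> _\<close> ic by algebra
  also have "\<dots> = \<zero> \<oplus> s \<otimes> b \<ominus> inv (f \<otimes> f)" by (simp only: 1)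
  also have "\<dots> = s \<otimes> b \<ominus> inv (f \<otimes> f)" using s by simp
  finally show ?thesis using s by (auto simp: X_def)
qed

text \<open>Suppose all commutators are central and \<open>a\<close>, \<open>b\<close> do not
  commute. Subtracting the equations of \<open>quadratic_over_center\<close> for \<open>f\<close>
  and for \<open>\<one>\<close> gives \<open>(r \<ominus> s) \<otimes> b = inv (f \<otimes> f)
  \<ominus> \<one>\<close>. As \<open>b\<close> is noncentral, both sides vanish, so
  \<open>f\<close> is \<open>\<one>\<close> or \<open>\<ominus> \<one>\<close> for every nonzero
  central \<open>f\<close>, and the center is finite. Hence \<open>N\<close> is commutative, and
  therefore central.\<close>

theorem exists_noncentral_commutator:
  assumes inf: "infinite (ring_center R)" and nc: "\<not> N \<subseteq> ring_center R"
  shows "\<exists>a \<in> N. \<exists>b \<in> N. a \<otimes> b \<otimes> inv a \<otimes> inv b \<notin> ring_center R"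
proof (rule ccontr)
  assume "\<not> ?thesis"
  then have central: "\<And>x y. x \<in> N \<Longrightarrow> y \<in> N \<Longrightarrow> x \<otimes> y \<otimes> inv x \<otimes> inv y \<in> ring_center R" by blast
  have "a \<otimes> b = b \<otimes> a" if a [simp]: "a \<in> N" and b [simp]: "b \<in> N" for a b
  proof (rule ccontr)
    assume ne: "a \<otimes> b \<noteq> b \<otimes> a"
    define c where "c = a \<otimes> b \<otimes> inv a \<otimes> inv b"
    have c: "c \<in> ring_center R" unfolding c_def by (rule central) simp_all
    have ab: "a \<otimes> b = c \<otimes> (b \<otimes> a)" by (simp add: c_def m_assoc)
    then have c1: "c \<noteq> \<one>" using ne by auto
    have b': "b \<notin> ring_center R" using ne center_commute[of b a] by auto
    have quad: "\<exists>s \<in> ring_center R. c \<otimes> c \<otimes> b \<otimes> b = s \<otimes> b \<ominus> inv (f \<otimes> f)"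
      if "f \<in> ring_center R" "f \<noteq> \<zero>" for f
      using quadratic_over_center[OF a b c ab c1 _ b' that] central by blast
    obtain s where s: "s \<in> ring_center R" "c \<otimes> c \<otimes> b \<otimes> b = s \<otimes> b \<ominus> inv (\<one> \<otimes> \<one>)"
      using quad[of \<one>] one_not_zero by auto
    have "f \<in> {\<zero>, \<one>, \<ominus> \<one>}" if f [simp]: "f \<in> ring_center R" for f
    proof (cases "f = \<zero>")
      case False
      obtain r where r: "r \<in> ring_center R" "c \<otimes> c \<otimes> b \<otimes> b = r \<otimes> b \<ominus> inv (f \<otimes> f)"
        using quad[OF f False] by blast
      have ff: "f \<otimes> f \<noteq> \<zero>" "f \<otimes> f \<in> ring_center R" "inv (f \<otimes> f) \<in> ring_center R"
        using False by (simp_all add: mult_eq_zero_iff)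
      have ic: "inv (f \<otimes> f) \<in> carrier R" using ff by simp
      have eq: "r \<otimes> b \<ominus> inv (f \<otimes> f) = s \<otimes> b \<ominus> \<one>" using r s by simp
      have "(r \<ominus> s) \<otimes> b = (r \<otimes> b \<ominus> inv (f \<otimes> f)) \<oplus> inv (f \<otimes> f) \<ominus> s \<otimes> b"
        using center_carrier[OF r(1)] center_carrier[OF s(1)] N_carrier[OF b] ic by algebra
      also have "\<dots> = (s \<otimes> b \<ominus> \<one>) \<oplus> inv (f \<otimes> f) \<ominus> s \<otimes> b" by (simp only: eq)
      also have "\<dots> = inv (f \<otimes> f) \<ominus> \<one>"
        using center_carrier[OF r(1)] center_carrier[OF s(1)] N_carrier[OF b] ic by algebra
      finally have rs: "(r \<ominus> s) \<otimes> b = inv (f \<otimes> f) \<ominus> \<one>" .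
      have "r \<ominus> s = \<zero>"
      proof (rule ccontr)
        assume nz: "r \<ominus> s \<noteq> \<zero>"
        have "b = inv (r \<ominus> s) \<otimes> (inv (f \<otimes> f) \<ominus> \<one>)"
          using inv_cancel_left(1)[OF _ nz, of b] rs r(1) s(1) by simp
        also have "\<dots> \<in> ring_center R" using r(1) s(1) ff nz by (intro center_closed) auto
        finally show False using b' by simp
      qed
      then have "inv (f \<otimes> f) \<ominus> \<one> = \<zero>" using rs b by (metis N_carrier l_null)
      then have "inv (f \<otimes> f) = \<one>" using ic minus_eq_zero_iff one_closed by blast
      then have "f \<otimes> f = \<one>" using ff by (metis center_carrier inv_inv' inv_one)
      then have "(f \<ominus> \<one>) \<otimes> (f \<oplus> \<one>) = \<zero>"
      proof -
        have fR: "f \<in> carrier R" "f \<otimes> f \<in> carrier R" by simp_all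
        have "(f \<ominus> \<one>) \<otimes> (f \<oplus> \<one>) = (f \<otimes> f \<ominus> f) \<oplus> (f \<ominus> \<one>)"
          by (simp add: r_distr minus_eq l_distr l_minus)
        also have "\<dots> = f \<otimes> f \<ominus> \<one>" using fR by algebra
        finally have "(f \<ominus> \<one>) \<otimes> (f \<oplus> \<one>) = f \<otimes> f \<ominus> \<one>" .
        then show ?thesis using \<open>f \<otimes> f = \<one>\<close> by simp
      qed
      then have "f \<ominus> \<one> = \<zero> \<or> f \<oplus> \<one> = \<zero>" by (simp add: mult_eq_zero_iff)
      then show ?thesis by (auto simp: minus_equality)
    qed simp
    then have "ring_center R \<subseteq> {\<zero>, \<one>, \<ominus> \<one>}" by blast
    then show False using inf by (meson finite.emptyI finite.insertI finite_subset)
  qed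
  then show False using center_if_commuting nc by blast
qed

end

section \<open>The derived series of the unit group\<close>

context div_ring
begin

lemma derived_subgroup_normal: "derived_subgroup R n \<lhd> units_of R"
proof (induction n)
  case 0
  interpret U: group "units_of R" by (rule units_group)
  show ?case by (simp add: derived_subgroup_def U.normal_self)
next
  case (Suc n)
  then show ?case
    using group.derived_is_normal[OF units_group] by (simp add: derived_subgroup_def)
qed

lemma normal_units_derived_subgroup: "normal_units R (derived_subgroup R n)"
proof -
  interpret M: normal "derived_subgroup R n" "units_of R" by (rule derived_subgroup_normal)
  have U: "carrier (units_of R) = carrier R - {\<zero>}" by (simp add: units_of_carrier div_ring_Units)
  show ?thesis
  proof
    show sub: "derived_subgroup R n \<subseteq> carrier R - {\<zero>}" using M.subset U by simp
    show "x \<otimes> y \<in> derived_subgroup R n" if "x \<in> derived_subgroup R n" "y \<in> derived_subgroup R n" for x y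
      using subgroup.m_closed[OF M.subgroup_axioms that] by (simp add: units_of_mult)
    show "inv x \<in> derived_subgroup R n" if "x \<in> derived_subgroup R n" for x
    proof -
      have "x \<in> Units R" using that sub nz_Units by blast
      then show ?thesis
        using subgroup.m_inv_closed[OF M.subgroup_axioms that] by (simp add: units_of_inv)
    qed
    show "z \<otimes> x \<otimes> inv z \<in> derived_subgroup R n"
      if "z \<in> carrier R" "z \<noteq> \<zero>" "x \<in> derived_subgroup R n" for z x
      using M.inv_op_closed2[of z x] that U by (simp add: units_of_mult units_of_inv nz_Units)
  qed
qed

lemma derived_subgroup_noncentral:
  assumes "infinite (ring_center R)" "ring_center R \<noteq> carrier R"
  shows "\<not> derived_subgroup R n \<subseteq> ring_center R"
proof (induction n)
  case 0
  have "carrier R - {\<zero>} \<subseteq> ring_center R \<Longrightarrow> carrier R \<subseteq> ring_center R" by auto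
  then show ?case using assms(2)
    by (auto simp: derived_subgroup_def units_of_carrier div_ring_Units)
next
  case (Suc n)
  interpret normal_units R "derived_subgroup R n" by (rule normal_units_derived_subgroup)
  obtain a b where ab: "a \<in> derived_subgroup R n" "b \<in> derived_subgroup R n"
    "a \<otimes> b \<otimes> inv a \<otimes> inv b \<notin> ring_center R"
    using exists_noncentral_commutator assms(1) Suc by blast
  have "a \<otimes>\<^bsub>units_of R\<^esub> b \<otimes>\<^bsub>units_of R\<^esub> inv\<^bsub>units_of R\<^esub> a \<otimes>\<^bsub>units_of R\<^esub> inv\<^bsub>units_of R\<^esub> b
     \<in> derived (units_of R) (derived_subgroup R n)"
    unfolding derived_def using ab by (intro generate.incl) blast
  then have "a \<otimes> b \<otimes> inv a \<otimes> inv b \<in> derived_subgroup R (Suc n)"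
    using ab by (simp add: derived_subgroup_def units_of_mult units_of_inv nz_Units)
  then show ?case using ab(3) by blast
qed

end

section \<open>Polynomials and linear operators over a maximal subfield\<close>

text \<open>The constant coefficient comes first, and the parameter stands to the left of the
  coefficients: these are vectors of the left L-space D, while the parameter is a scalar. This side
  is what makes \<open>linop_horner\<close> true.\<close>

primrec (in ring) horner :: "'a list \<Rightarrow> 'a \<Rightarrow> 'a" where
  "horner [] \<alpha> = \<zero>"
| "horner (c # cs) \<alpha> = c \<oplus> \<alpha> \<otimes> horner cs \<alpha>"

fun (in ring) padd :: "'a list \<Rightarrow> 'a list \<Rightarrow> 'a list" where
  "padd [] q = q"
| "padd p [] = p"
| "padd (a # p) (b # q) = (a \<oplus> b) # padd p q"

primrec (in ring) pmul :: "'a list \<Rightarrow> 'a list \<Rightarrow> 'a list" where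
  "pmul [] q = []"
| "pmul (a # p) q = padd (map ((\<otimes>) a) q) (\<zero> # pmul p q)"

context ring
begin

lemma horner_closed [simp]: "set cs \<subseteq> carrier R \<Longrightarrow> \<alpha> \<in> carrier R \<Longrightarrow> horner cs \<alpha> \<in> carrier R"
  by (induction cs) auto

lemma set_padd: "subring K R \<Longrightarrow> set p \<subseteq> K \<Longrightarrow> set q \<subseteq> K \<Longrightarrow> set (padd p q) \<subseteq> K"
  by (induction p q rule: padd.induct) (auto simp: subringE)

lemma set_pmul: "subring K R \<Longrightarrow> set p \<subseteq> K \<Longrightarrow> set q \<subseteq> K \<Longrightarrow> set (pmul p q) \<subseteq> K"
proof (induction p)
  case (Cons a p)
  then have "set (map ((\<otimes>) a) q) \<subseteq> K" "set (\<zero> # pmul p q) \<subseteq> K"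
    using subringE(2,6)[OF Cons.prems(1)] by auto
  then show ?case using set_padd[OF Cons.prems(1)] by simp
qed simp

lemmas set_padd_carrier [simp] = set_padd[OF carrier_is_subring]
lemmas set_pmul_carrier [simp] = set_pmul[OF carrier_is_subring]

lemma horner_padd:
  assumes "set p \<subseteq> carrier R" "set q \<subseteq> carrier R" "\<alpha> \<in> carrier R"
  shows "horner (padd p q) \<alpha> = horner p \<alpha> \<oplus> horner q \<alpha>"
  using assms by (induction p q rule: padd.induct) (simp_all add: r_distr a_ac)

lemma horner_map_mult:
  assumes "set q \<subseteq> carrier R" "\<alpha> \<in> carrier R" "a \<in> carrier R" "a \<otimes> \<alpha> = \<alpha> \<otimes> a"
  shows "horner (map ((\<otimes>) a) q) \<alpha> = a \<otimes> horner q \<alpha>"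
  using assms(1)
proof (induction q)
  case (Cons b q)
  then have "a \<otimes> (\<alpha> \<otimes> horner q \<alpha>) = \<alpha> \<otimes> (a \<otimes> horner q \<alpha>)"
    using assms by (simp add: m_assoc[symmetric])
  then show ?case using Cons assms by (simp add: r_distr)
qed (use assms in simp)

text \<open>Only the coefficients of the left factor have to move past the parameter;
  \<open>q\<close> may have arbitrary coefficients.\<close>

lemma horner_pmul:
  assumes "set p \<subseteq> carrier R" "set q \<subseteq> carrier R" "\<alpha> \<in> carrier R"
    and "\<And>a. a \<in> set p \<Longrightarrow> a \<otimes> \<alpha> = \<alpha> \<otimes> a"
  shows "horner (pmul p q) \<alpha> = horner p \<alpha> \<otimes> horner q \<alpha>"
  using assms(1,4)
proof (induction p)
  case (Cons a p)
  have "set (map ((\<otimes>) a) q) \<subseteq> carrier R" using Cons.prems assms by auto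
  then show ?case using Cons assms
    by (simp add: horner_padd horner_map_mult l_distr m_assoc)
qed (use assms in simp)

lemma horner_uminus:
  assumes "set p \<subseteq> carrier R" "\<alpha> \<in> carrier R"
  shows "horner (map (a_inv R) p) \<alpha> = \<ominus> horner p \<alpha>"
  using assms by (induction p) (simp_all add: r_minus minus_add)

end

section \<open>Linear operators and functionals over a maximal subfield\<close>

locale self_centralizing = div_ring +
  fixes L
  assumes L_sub: "L \<subseteq> carrier R" and L_self: "centralizer L = L"
begin

lemma subfield_L: "subfield L R"
  by (rule subfield_self_centralizer[OF L_sub L_self])

lemma subring_L: "subring L R"
  by (rule subfieldE(1)[OF subfield_L])

lemma L_carrier [simp]: "x \<in> L \<Longrightarrow> x \<in> carrier R"
  using L_sub by auto

lemma L_closed [simp]: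
  "\<zero> \<in> L" "\<one> \<in> L" "x \<in> L \<Longrightarrow> \<ominus> x \<in> L" "x \<in> L \<Longrightarrow> y \<in> L \<Longrightarrow> x \<oplus> y \<in> L"
  "x \<in> L \<Longrightarrow> y \<in> L \<Longrightarrow> x \<ominus> y \<in> L" "x \<in> L \<Longrightarrow> y \<in> L \<Longrightarrow> x \<otimes> y \<in> L"
  using subringE[OF subring_L] by (auto simp: minus_eq)

lemma L_inv [simp]: "x \<in> L \<Longrightarrow> x \<noteq> \<zero> \<Longrightarrow> inv x \<in> L"
  using subfield_m_inv(1)[OF subfield_L, of x] by auto

lemma L_commute: "x \<in> L \<Longrightarrow> y \<in> L \<Longrightarrow> x \<otimes> y = y \<otimes> x"
  by (rule subfieldE(4)[OF subfield_L])

lemma center_L [simp]: "z \<in> ring_center R \<Longrightarrow> z \<in> L"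
  using center_subset_self_centralizer[OF L_sub L_self] by auto

lemma in_L_if_commute: "x \<in> carrier R \<Longrightarrow> (\<And>l. l \<in> L \<Longrightarrow> x \<otimes> l = l \<otimes> x) \<Longrightarrow> x \<in> L"
  using L_self unfolding centralizer_def by blast

definition linop :: "('a \<Rightarrow> 'a) \<Rightarrow> bool" where
  "linop S \<longleftrightarrow> (\<forall>u \<in> carrier R. S u \<in> carrier R) \<and>
     (\<forall>u \<in> carrier R. \<forall>v \<in> carrier R. S (u \<oplus> v) = S u \<oplus> S v) \<and>
     (\<forall>l \<in> L. \<forall>u \<in> carrier R. S (l \<otimes> u) = l \<otimes> S u)"

definition functional :: "('a \<Rightarrow> 'a) \<Rightarrow> bool" where
  "functional g \<longleftrightarrow> linop g \<and> (\<forall>u \<in> carrier R. g u \<in> L)"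

lemma linop_closed [simp]: "linop S \<Longrightarrow> u \<in> carrier R \<Longrightarrow> S u \<in> carrier R"
  and linop_add: "linop S \<Longrightarrow> u \<in> carrier R \<Longrightarrow> v \<in> carrier R \<Longrightarrow> S (u \<oplus> v) = S u \<oplus> S v"
  and linop_smult: "linop S \<Longrightarrow> l \<in> L \<Longrightarrow> u \<in> carrier R \<Longrightarrow> S (l \<otimes> u) = l \<otimes> S u"
  by (simp_all add: linop_def)

lemma linop_zero: "linop S \<Longrightarrow> S \<zero> = \<zero>"
  using linop_smult[of S \<zero> \<zero>] by simp

lemma linop_uminus:
  assumes "linop S" "u \<in> carrier R" shows "S (\<ominus> u) = \<ominus> S u"
  using linop_smult[OF assms(1) _ assms(2), of "\<ominus> \<one>"] assms by (simp add: l_minus)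

lemma linop_minus: "linop S \<Longrightarrow> u \<in> carrier R \<Longrightarrow> v \<in> carrier R \<Longrightarrow> S (u \<ominus> v) = S u \<ominus> S v"
  by (simp add: minus_eq linop_add linop_uminus)

lemma functional_L [simp]: "functional g \<Longrightarrow> u \<in> carrier R \<Longrightarrow> g u \<in> L"
  and functional_linop [simp]: "functional g \<Longrightarrow> linop g"
  by (simp_all add: functional_def)

lemma linop_right_mult: "c \<in> carrier R \<Longrightarrow> linop (\<lambda>u. u \<otimes> c)"
  by (simp add: linop_def l_distr m_assoc)

lemma linop_combine:
  "linop S \<Longrightarrow> set Ks \<subseteq> L \<Longrightarrow> set Us \<subseteq> carrier R \<Longrightarrow> S (combine Ks Us) = combine Ks (map S Us)"
proof (induction Ks Us rule: combine.induct)
  case (1 k Ks u Us)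
  then have "set Ks \<subseteq> carrier R" by auto
  with 1 show ?case by (simp add: linop_add linop_smult)
qed (simp_all add: linop_zero)

lemma linop_horner:
  assumes "linop S" "set cs \<subseteq> carrier R" "\<alpha> \<in> L"
  shows "S (horner cs \<alpha>) = horner (map S cs) \<alpha>"
  using assms(2) by (induction cs) (simp_all add: assms linop_zero linop_add linop_smult)

text \<open>A subspace \<open>H\<close> maximal among those that contain \<open>W\<close> but not
  \<open>\<tau>\<close> is a hyperplane: every \<open>x\<close> is congruent to a unique multiple of
  \<open>\<tau>\<close> modulo \<open>H\<close>, and \<open>\<phi>\<close> reads off the factor.
  Vectors are families over an arbitrary index type, so that both single elements and tuples of
  elements of D are covered.\<close>

lemma exists_separating_functional:
  assumes W: "\<And>x i. x \<in> W \<Longrightarrow> x i \<in> carrier R" "(\<lambda>i. \<zero>) \<in> W"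
    and add: "\<And>x y. x \<in> W \<Longrightarrow> y \<in> W \<Longrightarrow> (\<lambda>i::'i. x i \<oplus> y i) \<in> W"
    and smult: "\<And>l x. l \<in> L \<Longrightarrow> x \<in> W \<Longrightarrow> (\<lambda>i. l \<otimes> x i) \<in> W"
    and \<tau>: "\<And>i. \<tau> i \<in> carrier R" "\<tau> \<notin> W"
  shows "\<exists>\<phi>. (\<forall>x. (\<forall>i. x i \<in> carrier R) \<longrightarrow> \<phi> x \<in> L) \<and>
    (\<forall>x y. (\<forall>i. x i \<in> carrier R) \<longrightarrow> (\<forall>i. y i \<in> carrier R) \<longrightarrow> \<phi> (\<lambda>i. x i \<oplus> y i) = \<phi> x \<oplus> \<phi> y) \<and>
    (\<forall>l \<in> L. \<forall>x. (\<forall>i. x i \<in> carrier R) \<longrightarrow> \<phi> (\<lambda>i. l \<otimes> x i) = l \<otimes> \<phi> x) \<and>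
    (\<forall>x \<in> W. \<phi> x = \<zero>) \<and> \<phi> \<tau> = \<one>"
proof -
  define V where "V = {x. \<forall>i::'i. x i \<in> carrier R}"
  define sub where "sub H \<longleftrightarrow> H \<subseteq> V \<and> (\<lambda>i. \<zero>) \<in> H \<and> (\<forall>x \<in> H. \<forall>y \<in> H. (\<lambda>i. x i \<oplus> y i) \<in> H) \<and>
    (\<forall>l \<in> L. \<forall>x \<in> H. (\<lambda>i. l \<otimes> x i) \<in> H)" for H
  define A where "A = {H. sub H \<and> W \<subseteq> H \<and> \<tau> \<notin> H}"
  have "\<exists>M \<in> A. \<forall>X \<in> A. M \<subseteq> X \<longrightarrow> X = M"
  proof (rule subset_Zorn_nonempty)
    have "W \<in> A" using W add smult \<tau> by (auto simp: A_def sub_def V_def)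
    then show "A \<noteq> {}" by auto
    show "\<Union>C \<in> A" if ne: "C \<noteq> {}" and "subset.chain A C" for C
    proof -
      have C: "C \<subseteq> A" "\<And>X Y. X \<in> C \<Longrightarrow> Y \<in> C \<Longrightarrow> X \<subseteq> Y \<or> Y \<subseteq> X"
        using that by (auto simp: subset_chain_def)
      then have Cs: "\<And>X. X \<in> C \<Longrightarrow> sub X \<and> W \<subseteq> X \<and> \<tau> \<notin> X" by (auto simp: A_def)
      have "(\<lambda>i. x i \<oplus> y i) \<in> \<Union>C" if xy: "x \<in> \<Union>C" "y \<in> \<Union>C" for x y
      proof -
        obtain X Y where "X \<in> C" "Y \<in> C" "x \<in> X" "y \<in> Y" using xy by auto
        with C obtain Z where "Z \<in> C" "x \<in> Z" "y \<in> Z" by blast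
        then show ?thesis using Cs[of Z] unfolding sub_def by blast
      qed
      moreover have "(\<lambda>i. l \<otimes> x i) \<in> \<Union>C" if "l \<in> L" "x \<in> \<Union>C" for l x
        using that Cs unfolding sub_def by blast
      moreover have "\<Union>C \<subseteq> V" "(\<lambda>i. \<zero>) \<in> \<Union>C" "W \<subseteq> \<Union>C" "\<tau> \<notin> \<Union>C"
        using ne Cs unfolding sub_def by blast+
      ultimately show ?thesis by (simp add: A_def sub_def)
    qed
  qed
  then obtain H where "H \<in> A" and max: "\<And>X. X \<in> A \<Longrightarrow> H \<subseteq> X \<Longrightarrow> X = H" by blast
  then have H: "H \<subseteq> V" "(\<lambda>i. \<zero>) \<in> H" "W \<subseteq> H" "\<tau> \<notin> H"
    and Hadd: "\<And>x y. x \<in> H \<Longrightarrow> y \<in> H \<Longrightarrow> (\<lambda>i. x i \<oplus> y i) \<in> H"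
    and Hsm: "\<And>l x. l \<in> L \<Longrightarrow> x \<in> H \<Longrightarrow> (\<lambda>i. l \<otimes> x i) \<in> H"
    by (auto simp: A_def sub_def)
  have HV: "x i \<in> carrier R" if "x \<in> H" for x i using that H by (auto simp: V_def)
  have ex: "\<exists>l \<in> L. (\<lambda>i. x i \<ominus> l \<otimes> \<tau> i) \<in> H" if x: "\<And>i. x i \<in> carrier R" for x
  proof (cases "x \<in> H")
    case True
    have "(\<lambda>i. x i \<ominus> \<zero> \<otimes> \<tau> i) = x" using x \<tau>(1) by (simp add: minus_eq)
    then show ?thesis using True by (intro bexI[of _ \<zero>]) auto
  next
    case False
    \<comment> \<open>This is \<open>H\<close> enlarged by the multiples of \<open>x\<close>. By
      maximality it contains \<open>\<tau>\<close>, and the resulting equation can be solved for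
      \<open>x\<close> because \<open>l = \<zero>\<close> would put \<open>\<tau>\<close> into
      \<open>H\<close>.\<close>
    define X where "X = {(\<lambda>i. h i \<oplus> l \<otimes> x i) | h l. h \<in> H \<and> l \<in> L}"
    have memX: "(\<lambda>i. h i \<oplus> l \<otimes> x i) \<in> X" if "h \<in> H" "l \<in> L" for h l
      using that by (auto simp: X_def)
    have HX: "H \<subseteq> X"
    proof
      fix h assume h: "h \<in> H"
      have "(\<lambda>i. h i \<oplus> \<zero> \<otimes> x i) = h" using HV[OF h] x by simp
      then show "h \<in> X" using memX[OF h L_closed(1)] by simp
    qed
    have "(\<lambda>i. \<zero> \<oplus> \<one> \<otimes> x i) = x" using x by simp
    then have xX: "x \<in> X" using memX[OF H(2) L_closed(2)] by simp
    have "sub X" unfolding sub_def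
    proof (intro conjI ballI)
      show "X \<subseteq> V" using HV x by (auto simp: X_def V_def)
      show "(\<lambda>i. \<zero>) \<in> X" using HX H(2) by auto
    next
      fix y z assume "y \<in> X" "z \<in> X"
      then obtain h l h' l' where y: "y = (\<lambda>i. h i \<oplus> l \<otimes> x i)" "z = (\<lambda>i. h' i \<oplus> l' \<otimes> x i)"
        "h \<in> H" "h' \<in> H" "l \<in> L" "l' \<in> L" by (auto simp: X_def)
      have "(\<lambda>i. y i \<oplus> z i) = (\<lambda>i. (h i \<oplus> h' i) \<oplus> (l \<oplus> l') \<otimes> x i)"
        using y HV x by (simp add: l_distr a_ac)
      then show "(\<lambda>i. y i \<oplus> z i) \<in> X" 
        using memX[OF Hadd[OF y(3,4)] L_closed(4)[OF y(5,6)]] by simp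
    next
      fix k y assume k: "k \<in> L" and "y \<in> X"
      then obtain h l where y: "y = (\<lambda>i. h i \<oplus> l \<otimes> x i)" "h \<in> H" "l \<in> L" by (auto simp: X_def)
      have "(\<lambda>i. k \<otimes> y i) = (\<lambda>i. (k \<otimes> h i) \<oplus> (k \<otimes> l) \<otimes> x i)"
        using y k HV x by (simp add: r_distr m_assoc)
      then show "(\<lambda>i. k \<otimes> y i) \<in> X" 
        using memX[OF Hsm[OF k y(2)] L_closed(6)[OF k y(3)]] by simp
    qed
    moreover have "X \<noteq> H" using xX False by auto
    ultimately have "\<tau> \<in> X" using max[of X] HX H(3) unfolding A_def by blast
    then obtain h l where hl: "\<tau> = (\<lambda>i. h i \<oplus> l \<otimes> x i)" "h \<in> H" "l \<in> L" by (auto simp: X_def)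
    have l0: "l \<noteq> \<zero>"
    proof
      assume "l = \<zero>"
      then have "\<tau> = h" using hl HV x by simp
      then show False using hl H(4) by simp
    qed
    define m where "m = inv l"
    have m: "m \<in> L" "m \<otimes> l = \<one>" using l0 hl by (simp_all add: m_def)
    have "(\<lambda>i. x i \<ominus> m \<otimes> \<tau> i) = (\<lambda>i. \<ominus> m \<otimes> h i)"
    proof
      fix i
      have c: "x i \<in> carrier R" "h i \<in> carrier R" "m \<in> carrier R" "l \<in> carrier R" using x HV hl m by auto
      have "x i \<ominus> m \<otimes> \<tau> i = x i \<ominus> (m \<otimes> h i \<oplus> (m \<otimes> l) \<otimes> x i)"
        using c by (simp add: hl r_distr m_assoc)
      also have "\<dots> = x i \<ominus> (m \<otimes> h i \<oplus> x i)" using c m by simp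
      also have "\<dots> = \<ominus> m \<otimes> h i" using c by algebra
      finally show "x i \<ominus> m \<otimes> \<tau> i = \<ominus> m \<otimes> h i" .
    qed
    then show ?thesis using Hsm[OF _ hl(2), of "\<ominus> m"] m by (intro bexI[of _ m]) simp_all
  qed
  define \<phi> where "\<phi> x = (SOME l. l \<in> L \<and> (\<lambda>i. x i \<ominus> l \<otimes> \<tau> i) \<in> H)" for x
  have \<phi>: "\<phi> x \<in> L" "(\<lambda>i. x i \<ominus> \<phi> x \<otimes> \<tau> i) \<in> H" if "\<And>i. x i \<in> carrier R" for x
  proof -
    have "\<exists>l. l \<in> L \<and> (\<lambda>i. x i \<ominus> l \<otimes> \<tau> i) \<in> H" using ex[of x] that by (simp only: Bex_def)
    then have "\<phi> x \<in> L \<and> (\<lambda>i. x i \<ominus> \<phi> x \<otimes> \<tau> i) \<in> H" unfolding \<phi>_def by (rule someI_ex)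
    then show "\<phi> x \<in> L" "(\<lambda>i. x i \<ominus> \<phi> x \<otimes> \<tau> i) \<in> H" by (rule conjunct1, rule conjunct2)
  qed
  have uniq: "\<phi> x = l" if x: "\<And>i. x i \<in> carrier R" and l: "l \<in> L" "(\<lambda>i. x i \<ominus> l \<otimes> \<tau> i) \<in> H" for x l
  proof (rule ccontr)
    assume ne: "\<phi> x \<noteq> l"
    let ?k = "l \<ominus> \<phi> x"
    have k: "?k \<in> L" "?k \<noteq> \<zero>" using ne l \<phi>[OF x] by auto
    have "(\<lambda>i. (x i \<ominus> \<phi> x \<otimes> \<tau> i) \<oplus> \<ominus> \<one> \<otimes> (x i \<ominus> l \<otimes> \<tau> i)) \<in> H"
      by (rule Hadd[OF \<phi>(2)[OF x] Hsm[OF _ l(2)]]) simp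
    also have "(\<lambda>i. (x i \<ominus> \<phi> x \<otimes> \<tau> i) \<oplus> \<ominus> \<one> \<otimes> (x i \<ominus> l \<otimes> \<tau> i)) = (\<lambda>i. ?k \<otimes> \<tau> i)"
    proof
      fix i
      have c: "x i \<in> carrier R" "\<tau> i \<in> carrier R" "\<phi> x \<in> carrier R" "l \<in> carrier R"
        using x \<tau>(1) \<phi>(1)[OF x] l by auto
      then have "\<ominus> \<one> \<otimes> (x i \<ominus> l \<otimes> \<tau> i) = \<ominus> (x i \<ominus> l \<otimes> \<tau> i)" by (simp add: l_minus)
      then show "(x i \<ominus> \<phi> x \<otimes> \<tau> i) \<oplus> \<ominus> \<one> \<otimes> (x i \<ominus> l \<otimes> \<tau> i) = ?k \<otimes> \<tau> i"
        using c by simp algebra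
    qed
    finally have "(\<lambda>i. ?k \<otimes> \<tau> i) \<in> H" .
    from Hsm[OF L_inv[OF k] this] have "(\<lambda>i. inv ?k \<otimes> (?k \<otimes> \<tau> i)) \<in> H" .
    also have "(\<lambda>i. inv ?k \<otimes> (?k \<otimes> \<tau> i)) = \<tau>" using k \<tau>(1) by simp
    finally show False using H(4) by simp
  qed
  show ?thesis
  proof (intro exI[of _ \<phi>] conjI allI impI ballI)
    show "\<phi> x \<in> L" if "\<forall>i. x i \<in> carrier R" for x using \<phi> that by blast
    fix x y :: "'i \<Rightarrow> 'a" assume x: "\<forall>i. x i \<in> carrier R" and y: "\<forall>i. y i \<in> carrier R"
    show "\<phi> (\<lambda>i. x i \<oplus> y i) = \<phi> x \<oplus> \<phi> y"
    proof (rule uniq)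
      have "(\<lambda>i. (x i \<ominus> \<phi> x \<otimes> \<tau> i) \<oplus> (y i \<ominus> \<phi> y \<otimes> \<tau> i)) \<in> H"
        using \<phi> x y by (intro Hadd) blast+
      also have "(\<lambda>i. (x i \<ominus> \<phi> x \<otimes> \<tau> i) \<oplus> (y i \<ominus> \<phi> y \<otimes> \<tau> i))
        = (\<lambda>i. (x i \<oplus> y i) \<ominus> (\<phi> x \<oplus> \<phi> y) \<otimes> \<tau> i)"
      proof
        fix i
        have "x i \<in> carrier R" "y i \<in> carrier R" "\<tau> i \<in> carrier R" "\<phi> x \<in> carrier R" "\<phi> y \<in> carrier R"
          using x y \<tau>(1) \<phi>(1)[of x] \<phi>(1)[of y] by auto
        then show "(x i \<ominus> \<phi> x \<otimes> \<tau> i) \<oplus> (y i \<ominus> \<phi> y \<otimes> \<tau> i) = (x i \<oplus> y i) \<ominus> (\<phi> x \<oplus> \<phi> y) \<otimes> \<tau> i"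
          by algebra
      qed
      finally show "(\<lambda>i. (x i \<oplus> y i) \<ominus> (\<phi> x \<oplus> \<phi> y) \<otimes> \<tau> i) \<in> H" .
    qed (use x y \<phi> in auto)
  next
    fix l x assume l: "l \<in> L" and x: "\<forall>i::'i. x i \<in> carrier R"
    show "\<phi> (\<lambda>i. l \<otimes> x i) = l \<otimes> \<phi> x"
    proof (rule uniq)
      have "(\<lambda>i. l \<otimes> (x i \<ominus> \<phi> x \<otimes> \<tau> i)) \<in> H" using \<phi> x l by (intro Hsm) blast+
      also have "(\<lambda>i. l \<otimes> (x i \<ominus> \<phi> x \<otimes> \<tau> i)) = (\<lambda>i. l \<otimes> x i \<ominus> (l \<otimes> \<phi> x) \<otimes> \<tau> i)"
        using x l \<phi>(1)[of x] \<tau>(1) by (simp add: minus_eq r_distr r_minus m_assoc)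
      finally show "(\<lambda>i. l \<otimes> x i \<ominus> (l \<otimes> \<phi> x) \<otimes> \<tau> i) \<in> H" .
    qed (use x l \<phi> in auto)
  next
    fix x assume x: "x \<in> W"
    have "(\<lambda>i. x i \<ominus> \<zero> \<otimes> \<tau> i) = x" using W(1)[OF x] \<tau>(1) by (simp add: minus_eq)
    then show "\<phi> x = \<zero>" using x H(3) W(1) by (intro uniq) auto
  next
    have "(\<lambda>i. \<tau> i \<ominus> \<one> \<otimes> \<tau> i) = (\<lambda>i. \<zero>)" using \<tau>(1) by (simp add: minus_eq r_neg)
    then show "\<phi> \<tau> = \<one>" using \<tau>(1) H(2) by (intro uniq) auto
  qed
qed

lemma exists_functional_nonzero:
  assumes u: "u \<in> carrier R" "u \<noteq> \<zero>"
  shows "\<exists>g. functional g \<and> g u \<noteq> \<zero>"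
proof -
  \<comment> \<open>Constant families embed D into the space of families.\<close>
  let ?V = "\<lambda>x::nat \<Rightarrow> 'a. \<forall>i. x i \<in> carrier R"
  have "(\<lambda>i::nat. u) \<notin> {\<lambda>i. \<zero>}" using u(2) by (metis singletonD)
  then have "\<exists>\<phi>. (\<forall>x. ?V x \<longrightarrow> \<phi> x \<in> L) \<and>
      (\<forall>x y. ?V x \<longrightarrow> ?V y \<longrightarrow> \<phi> (\<lambda>i. x i \<oplus> y i) = \<phi> x \<oplus> \<phi> y) \<and>
      (\<forall>l \<in> L. \<forall>x. ?V x \<longrightarrow> \<phi> (\<lambda>i. l \<otimes> x i) = l \<otimes> \<phi> x) \<and>
      (\<forall>x \<in> {\<lambda>i. \<zero>}. \<phi> x = \<zero>) \<and> \<phi> (\<lambda>i. u) = \<one>"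
    by (intro exists_separating_functional) (use u in auto)
  then obtain \<phi> where \<phi>: "\<And>x. ?V x \<Longrightarrow> \<phi> x \<in> L"
    "\<And>x y. ?V x \<Longrightarrow> ?V y \<Longrightarrow> \<phi> (\<lambda>i. x i \<oplus> y i) = \<phi> x \<oplus> \<phi> y"
    "\<And>l x. l \<in> L \<Longrightarrow> ?V x \<Longrightarrow> \<phi> (\<lambda>i. l \<otimes> x i) = l \<otimes> \<phi> x"
    "\<phi> (\<lambda>i. u) = \<one>" by blast
  have "functional (\<lambda>x. \<phi> (\<lambda>_. x))" by (auto simp: functional_def linop_def \<phi>(1,2,3))
  moreover have "\<phi> (\<lambda>_. u) \<noteq> \<zero>" using \<phi>(4) one_not_zero by simp
  ultimately show ?thesis by blast
qed

end

context ring
begin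

lemma independent_iff:
  assumes K: "subfield K R" and Us: "set Us \<subseteq> carrier R"
  shows "independent K Us \<longleftrightarrow>
    (\<forall>Ks. set Ks \<subseteq> K \<longrightarrow> length Ks = length Us \<longrightarrow> combine Ks Us = \<zero> \<longrightarrow> set Ks \<subseteq> {\<zero>})"
proof
  assume "independent K Us"
  then show "\<forall>Ks. set Ks \<subseteq> K \<longrightarrow> length Ks = length Us \<longrightarrow> combine Ks Us = \<zero> \<longrightarrow> set Ks \<subseteq> {\<zero>}"
    using independent_imp_trivial_combine[OF K, of Us] by (metis order_refl take_all_iff)
next
  assume triv: "\<forall>Ks. set Ks \<subseteq> K \<longrightarrow> length Ks = length Us \<longrightarrow> combine Ks Us = \<zero> \<longrightarrow> set Ks \<subseteq> {\<zero>}"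
  show "independent K Us"
  proof (rule ccontr)
    assume "\<not> independent K Us"
    then obtain Ks where Ks: "length Ks = length Us" "combine Ks Us = \<zero>" "set Ks \<subseteq> K" "set Ks \<noteq> {\<zero>}"
      using dependent_imp_non_trivial_combine[OF K Us] by metis
    with triv have "set Ks \<subseteq> {\<zero>}" by blast
    with Ks(4) have "Ks = []" by (cases Ks) auto
    with Ks(1) have "Us = []" by simp
    with \<open>\<not> independent K Us\<close> show False by simp
  qed
qed

lemma combine_in_Span:
  assumes "subfield K R" "set Us \<subseteq> carrier R" "set Ks \<subseteq> K"
  shows "combine Ks Us \<in> Span K Us"
  using Span_eq_combine_set[OF assms(1,2)] assms(3) by blast

end

section \<open>Fraction-free elimination and generic independence\<close>

context self_centralizing
begin

lemmas L_independent_iff = independent_iff[OF subfield_L]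

text \<open>The map \<open>v \<mapsto> g u \<otimes> v \<ominus> g v \<otimes> u\<close> is
  \<open>g u\<close> times the projection along \<open>u\<close> onto the kernel of
  \<open>g\<close>. It is linear because L is commutative. Avoiding the division by
  \<open>g u\<close> keeps it polynomial when \<open>u\<close> and \<open>v\<close> depend
  polynomially on a parameter.\<close>

lemma combine_eliminate:
  assumes g: "functional g" and u: "u \<in> carrier R" and "set Us \<subseteq> carrier R" "set Ks \<subseteq> L"
  shows "combine Ks (map (\<lambda>v. g u \<otimes> v \<ominus> g v \<otimes> u) Us) = g u \<otimes> combine Ks Us \<ominus> g (combine Ks Us) \<otimes> u"
  using assms(3,4)
proof (induction Ks Us rule: combine.induct)
  case (1 k Ks v Us)
  define w where "w = combine Ks Us"
  have "set Ks \<subseteq> carrier R" using 1 by auto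
  then have w: "w \<in> carrier R" using 1 by (simp add: w_def)
  have k: "k \<in> L" and v: "v \<in> carrier R" using 1 by auto
  have gw: "g (k \<otimes> v \<oplus> w) = k \<otimes> g v \<oplus> g w"
    using linop_add[of g "k \<otimes> v" w] linop_smult[of g k v] g k v w by simp
  have comm: "k \<otimes> g u = g u \<otimes> k" by (rule L_commute) (use k g u in auto)
  have "combine (k # Ks) (map (\<lambda>v. g u \<otimes> v \<ominus> g v \<otimes> u) (v # Us))
     = k \<otimes> (g u \<otimes> v \<ominus> g v \<otimes> u) \<oplus> (g u \<otimes> w \<ominus> g w \<otimes> u)"
    using 1 by (simp add: w_def)
  also have "\<dots> = (k \<otimes> g u) \<otimes> v \<ominus> k \<otimes> g v \<otimes> u \<oplus> (g u \<otimes> w \<ominus> g w \<otimes> u)"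
    using k v w u L_carrier[OF functional_L[OF g u]] L_carrier[OF functional_L[OF g v]]
    by (simp add: r_distr minus_eq r_minus m_assoc)
  also have "\<dots> = (g u \<otimes> k) \<otimes> v \<ominus> k \<otimes> g v \<otimes> u \<oplus> (g u \<otimes> w \<ominus> g w \<otimes> u)"
    by (simp only: comm)
  also have "\<dots> = g u \<otimes> (k \<otimes> v \<oplus> w) \<ominus> (k \<otimes> g v \<oplus> g w) \<otimes> u"
    using L_carrier[OF k] v w u L_carrier[OF functional_L[OF g u]] L_carrier[OF functional_L[OF g v]]
      L_carrier[OF functional_L[OF g w]] by algebra
  finally show ?case by (simp add: w_def[symmetric] gw)
qed (simp_all add: minus_eq linop_zero g u)

text \<open>For \<open>g u \<noteq> \<zero>\<close> the elimination map has exactly the multiples of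
  \<open>u\<close> as its kernel, so it preserves and reflects independence modulo
  \<open>u\<close>.\<close>

lemma independent_eliminate_iff:
  assumes g: "functional g" "g u \<noteq> \<zero>" and u: "u \<in> carrier R" and Us: "set Us \<subseteq> carrier R"
  shows "independent L (u # Us) \<longleftrightarrow> independent L (map (\<lambda>v. g u \<otimes> v \<ominus> g v \<otimes> u) Us)" (is "?A \<longleftrightarrow> ?B")
proof -
  have gL: "g v \<in> L" if "v \<in> carrier R" for v using g that by simp
  have B: "set (map (\<lambda>v. g u \<otimes> v \<ominus> g v \<otimes> u) Us) \<subseteq> carrier R"
    using Us u L_carrier[OF gL] by (auto simp: subset_iff)
  have A: "set (u # Us) \<subseteq> carrier R" using u Us by simp
  have u0: "u \<noteq> \<zero>" using g linop_zero by auto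
  note iffs = L_independent_iff[OF A] L_independent_iff[OF B]
  show ?thesis
  proof
    assume ind: ?A
    show ?B unfolding iffs
    proof (intro allI impI)
      fix Ks assume Ks: "set Ks \<subseteq> L" "length Ks = length (map (\<lambda>v. g u \<otimes> v \<ominus> g v \<otimes> u) Us)"
        "combine Ks (map (\<lambda>v. g u \<otimes> v \<ominus> g v \<otimes> u) Us) = \<zero>"
      define w where "w = combine Ks Us"
      have KR: "set Ks \<subseteq> carrier R" using Ks by auto
      then have w: "w \<in> carrier R" using Us by (simp add: w_def)
      have rel: "g u \<otimes> w \<ominus> g w \<otimes> u = \<zero>"
        using Ks combine_eliminate[OF g(1) u Us Ks(1)] by (simp add: w_def)
      have "combine (\<ominus> g w # map ((\<otimes>) (g u)) Ks) (u # Us) = \<ominus> g w \<otimes> u \<oplus> g u \<otimes> w"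
        using combine_r_distr[OF KR Us, of "g u"] L_carrier[OF gL[OF u]] by (simp add: w_def)
      also have "\<dots> = g u \<otimes> w \<ominus> g w \<otimes> u"
        using u w L_carrier[OF gL[OF u]] L_carrier[OF gL[OF w]] by algebra
      finally have "combine (\<ominus> g w # map ((\<otimes>) (g u)) Ks) (u # Us) = \<zero>" using rel by simp
      moreover have "set (\<ominus> g w # map ((\<otimes>) (g u)) Ks) \<subseteq> L"
        using gL u w Ks(1) by auto
      ultimately have "set (\<ominus> g w # map ((\<otimes>) (g u)) Ks) \<subseteq> {\<zero>}"
        using ind[unfolded iffs] Ks(2) by (metis length_Cons length_map)
      then have "\<And>k. k \<in> set Ks \<Longrightarrow> g u \<otimes> k = \<zero>" by auto
      then show "set Ks \<subseteq> {\<zero>}" using KR g(2) L_carrier[OF gL[OF u]] mult_eq_zero_iff by blast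
    qed
  next
    assume ind: ?B
    show ?A unfolding iffs
    proof (intro allI impI)
      fix Ms assume Ms: "set Ms \<subseteq> L" "length Ms = length (u # Us)" "combine Ms (u # Us) = \<zero>"
      then obtain k Ks where M: "Ms = k # Ks" by (cases Ms) auto
      have k: "k \<in> L" and Ks: "set Ks \<subseteq> L" "length Ks = length Us" using Ms M by auto
      have KR: "set Ks \<subseteq> carrier R" using Ks by auto
      define w where "w = combine Ks Us"
      have w: "w \<in> carrier R" using Us KR by (simp add: w_def)
      have "k \<otimes> u \<oplus> w = \<zero>" using Ms M by (simp add: w_def)
      then have wk: "w = \<ominus> (k \<otimes> u)" using k u w by (metis L_carrier add.m_comm m_closed minus_equality)
      have "g w = \<ominus> (k \<otimes> g u)"
        using linop_uminus[of g "k \<otimes> u"] linop_smult[of g k u] g k u by (simp add: wk)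
      then have "g u \<otimes> w \<ominus> g w \<otimes> u = \<ominus> (g u \<otimes> (k \<otimes> u)) \<oplus> k \<otimes> g u \<otimes> u"
        using k u L_carrier[OF gL[OF u]] by (simp add: wk minus_eq r_minus l_minus)
      also have "\<dots> = \<zero>"
        using L_commute[of "g u" k] k u L_carrier[OF gL[OF u]] gL[OF u] by (simp add: m_assoc[symmetric] l_neg)
      finally have "combine Ks (map (\<lambda>v. g u \<otimes> v \<ominus> g v \<otimes> u) Us) = \<zero>"
        using combine_eliminate[OF g(1) u Us Ks(1)] by (simp add: w_def)
      then have Kz: "set Ks \<subseteq> {\<zero>}"
        by (intro iffs(2)[THEN iffD1, OF ind, rule_format, OF Ks(1)]) (simp_all only: length_map Ks(2))
      then have "Ks = replicate (length Us) \<zero>" using Ks(2) by (metis replicate_eqI singletonD subsetD)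
      then have "w = \<zero>" using combine_replicate[OF Us] by (simp add: w_def)
      then have "k = \<zero>" using \<open>k \<otimes> u \<oplus> w = \<zero>\<close> k u u0 by (simp add: mult_eq_zero_iff)
      then show "set Ms \<subseteq> {\<zero>}" using Kz M by simp
    qed
  qed
qed

text \<open>Synthetic division: the constant coefficient of the quotient is the value of the tail
  \<open>cs\<close> at \<open>\<beta>\<close>, and the remaining coefficients are the quotient of
  the tail.\<close>

lemma horner_factor:
  assumes "\<beta> \<in> L" "set p \<subseteq> L"
  shows "\<exists>q. set q \<subseteq> L \<and> length q \<le> length p - 1 \<and>
    (\<forall>\<alpha> \<in> L. horner p \<alpha> = horner p \<beta> \<oplus> (\<alpha> \<ominus> \<beta>) \<otimes> horner q \<alpha>)"
  using assms(2)
proof (induction p)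
  case Nil
  show ?case using assms(1) by (intro exI[of _ "[]"]) auto
next
  case (Cons c cs)
  then obtain q where q: "set q \<subseteq> L" "length q \<le> length cs - 1"
    "\<And>\<alpha>. \<alpha> \<in> L \<Longrightarrow> horner cs \<alpha> = horner cs \<beta> \<oplus> (\<alpha> \<ominus> \<beta>) \<otimes> horner q \<alpha>" by auto
  show ?case
  proof (cases "cs = []")
    case True
    then show ?thesis using Cons.prems assms(1) by (intro exI[of _ "[]"]) auto
  next
    case False
    have hL: "horner cs \<beta> \<in> L"
      using Cons.prems assms(1) by (induction cs) auto
    have cR: "set cs \<subseteq> carrier R" "c \<in> carrier R" and qR: "set q \<subseteq> carrier R" using Cons.prems q(1) by auto
    have "horner (c # cs) \<alpha> = horner (c # cs) \<beta> \<oplus> (\<alpha> \<ominus> \<beta>) \<otimes> horner (horner cs \<beta> # q) \<alpha>"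
      if \<alpha>: "\<alpha> \<in> L" for \<alpha>
    proof -
      define h k where "h = horner cs \<beta>" and "k = horner q \<alpha>"
      have hk: "h \<in> carrier R" "k \<in> carrier R" "\<alpha> \<in> carrier R" "\<beta> \<in> carrier R" "c \<in> carrier R"
        using cR qR \<alpha> assms(1) by (auto simp: h_def k_def)
      have comm: "\<alpha> \<otimes> \<beta> = \<beta> \<otimes> \<alpha>" by (rule L_commute[OF \<alpha> assms(1)])
      have "horner (c # cs) \<alpha> = c \<oplus> \<alpha> \<otimes> (h \<oplus> (\<alpha> \<ominus> \<beta>) \<otimes> k)" using q(3)[OF \<alpha>] by (simp add: h_def k_def)
      also have "\<dots> = c \<oplus> \<alpha> \<otimes> h \<oplus> (\<alpha> \<otimes> \<alpha> \<ominus> \<alpha> \<otimes> \<beta>) \<otimes> k" using hk by algebra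
      also have "\<dots> = c \<oplus> \<alpha> \<otimes> h \<oplus> (\<alpha> \<otimes> \<alpha> \<ominus> \<beta> \<otimes> \<alpha>) \<otimes> k" by (simp only: comm)
      also have "\<dots> = (c \<oplus> \<beta> \<otimes> h) \<oplus> (\<alpha> \<ominus> \<beta>) \<otimes> (h \<oplus> \<alpha> \<otimes> k)" using hk by algebra
      finally show ?thesis by (simp add: h_def k_def)
    qed
    moreover have "length (horner cs \<beta> # q) \<le> length (c # cs) - 1" using q(2) False by (cases cs) auto
    ultimately show ?thesis using q(1) hL by (intro exI[of _ "horner cs \<beta> # q"]) auto
  qed
qed

lemma finite_horner_zeros:
  assumes "set p \<subseteq> L" "\<alpha>0 \<in> L" "horner p \<alpha>0 \<noteq> \<zero>"
  shows "finite {\<alpha> \<in> L. horner p \<alpha> = \<zero>}"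
  using assms(1,3)
proof (induction "length p" arbitrary: p rule: less_induct)
  case less
  show ?case
  proof (cases "\<exists>\<beta> \<in> L. horner p \<beta> = \<zero>")
    case True
    then obtain \<beta> where \<beta>: "\<beta> \<in> L" "horner p \<beta> = \<zero>" by blast
    obtain q where q: "set q \<subseteq> L" "length q \<le> length p - 1"
      "\<And>\<alpha>. \<alpha> \<in> L \<Longrightarrow> horner p \<alpha> = horner p \<beta> \<oplus> (\<alpha> \<ominus> \<beta>) \<otimes> horner q \<alpha>"
      using horner_factor[OF \<beta>(1) less.prems(1)] by blast
    have qR: "set q \<subseteq> carrier R" using q(1) by auto
    have p: "horner p \<alpha> = (\<alpha> \<ominus> \<beta>) \<otimes> horner q \<alpha>" if "\<alpha> \<in> L" for \<alpha>
      using q(3)[OF that] \<beta> qR that by simp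
    have "p \<noteq> []" using less.prems by auto
    moreover have "horner q \<alpha>0 \<noteq> \<zero>" using p[OF assms(2)] less.prems \<beta> assms(2) by auto
    ultimately have "finite {\<alpha> \<in> L. horner q \<alpha> = \<zero>}" using q(1,2) by (intro less.hyps) (cases p, auto)
    moreover have "{\<alpha> \<in> L. horner p \<alpha> = \<zero>} \<subseteq> insert \<beta> {\<alpha> \<in> L. horner q \<alpha> = \<zero>}"
      using p qR \<beta>(1) by (auto simp: mult_eq_zero_iff)
    ultimately show ?thesis by (meson finite.insertI finite_subset)
  next
    case False
    then show ?thesis by (metis (mono_tags, lifting) Collect_empty_eq finite.emptyI)
  qed
qed

text \<open>Elimination with a functional that does not vanish on the first vector reduces the number of
  vectors, at the cost of excluding the zeros of one polynomial.\<close>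
theorem generic_independence:
  assumes "\<And>cs. cs \<in> set css \<Longrightarrow> set cs \<subseteq> carrier R" and \<alpha>0: "\<alpha>0 \<in> L"
    and "independent L (map (\<lambda>cs. horner cs \<alpha>0) css)"
  shows "finite {\<alpha> \<in> L. \<not> independent L (map (\<lambda>cs. horner cs \<alpha>) css)}"
  using assms(1,3)
proof (induction "length css" arbitrary: css)
  case (Suc n)
  then obtain ds ess where css: "css = ds # ess" by (cases css) auto
  have ds: "set ds \<subseteq> carrier R" and es: "\<And>es. es \<in> set ess \<Longrightarrow> set es \<subseteq> carrier R"
    using Suc.prems(1) css by auto
  define u where "u \<alpha> = horner ds \<alpha>" for \<alpha>
  have uR: "u \<alpha> \<in> carrier R" if "\<alpha> \<in> L" for \<alpha> using ds that by (simp add: u_def)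
  have esR: "set (map (\<lambda>cs. horner cs \<alpha>) ess) \<subseteq> carrier R" if "\<alpha> \<in> L" for \<alpha>
    using es that by auto
  have "u \<alpha>0 \<noteq> \<zero>"
  proof
    assume "u \<alpha>0 = \<zero>"
    moreover have "u \<alpha>0 \<notin> Span L (map (\<lambda>cs. horner cs \<alpha>0) ess)"
      using Suc.prems(2) independent_backwards(1) unfolding css u_def by (metis list.simps(9))
    ultimately show False using Span_subgroup_props(2)[OF subfield_L esR[OF \<alpha>0]] by simp
  qed
  then obtain g where g: "functional g" "g (u \<alpha>0) \<noteq> \<zero>"
    using exists_functional_nonzero uR \<alpha>0 by blast
  have gR: "set (map g cs) \<subseteq> L" if "set cs \<subseteq> carrier R" for cs using that g(1) by auto
  \<comment> \<open>Elimination carried out on coefficient lists. In both products the factor with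
    coefficients in L stands on the left, as \<open>horner_pmul\<close> requires. The functional
    \<open>g\<close> is chosen once, at \<open>\<alpha>0\<close>, so elimination is valid wherever
    the polynomial \<open>map g ds\<close> does not vanish.\<close>
  define elim where "elim cs = padd (pmul (map g ds) cs) (map (a_inv R) (pmul (map g cs) ds))" for cs
  have elim: "set (elim cs) \<subseteq> carrier R"
    "\<And>\<alpha>. \<alpha> \<in> L \<Longrightarrow> horner (elim cs) \<alpha> = g (u \<alpha>) \<otimes> horner cs \<alpha> \<ominus> g (horner cs \<alpha>) \<otimes> u \<alpha>"
    if cs: "set cs \<subseteq> carrier R" for cs
  proof -
    have G: "set (map g ds) \<subseteq> carrier R" "set (map g cs) \<subseteq> carrier R"
      using gR[OF ds] gR[OF cs] L_sub by blast+
    have 1: "set (pmul (map g ds) cs) \<subseteq> carrier R" "set (pmul (map g cs) ds) \<subseteq> carrier R"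
      using G ds cs set_pmul_carrier by blast+
    then have 2: "set (map (a_inv R) (pmul (map g cs) ds)) \<subseteq> carrier R" by auto
    show "set (elim cs) \<subseteq> carrier R" unfolding elim_def using 1 2 set_padd_carrier by blast
    fix \<alpha> assume \<alpha>: "\<alpha> \<in> L"
    have "a \<otimes> \<alpha> = \<alpha> \<otimes> a" if "a \<in> set (map g ds) \<union> set (map g cs)" for a
      using that gR[OF ds] gR[OF cs] \<alpha> L_commute by blast
    then have "horner (pmul (map g ds) cs) \<alpha> = horner (map g ds) \<alpha> \<otimes> horner cs \<alpha>"
      "horner (pmul (map g cs) ds) \<alpha> = horner (map g cs) \<alpha> \<otimes> horner ds \<alpha>"
      by (intro horner_pmul G cs ds L_carrier[OF \<alpha>]; simp)+
    then show "horner (elim cs) \<alpha> = g (u \<alpha>) \<otimes> horner cs \<alpha> \<ominus> g (horner cs \<alpha>) \<otimes> u \<alpha>"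
      using 1 2 G ds cs \<alpha> g(1)
      by (simp add: elim_def horner_padd horner_uminus linop_horner u_def minus_eq)
  qed
  have mapelim: "map (\<lambda>cs. horner cs \<alpha>) (map elim ess) =
      map (\<lambda>v. g (u \<alpha>) \<otimes> v \<ominus> g v \<otimes> u \<alpha>) (map (\<lambda>cs. horner cs \<alpha>) ess)" if "\<alpha> \<in> L" for \<alpha>
    using elim(2)[OF es that] by simp
  have iff: "independent L (map (\<lambda>cs. horner cs \<alpha>) css) \<longleftrightarrow>
      independent L (map (\<lambda>cs. horner cs \<alpha>) (map elim ess))" if "\<alpha> \<in> L" "g (u \<alpha>) \<noteq> \<zero>" for \<alpha>
    using independent_eliminate_iff[OF g(1) that(2) uR[OF that(1)] esR[OF that(1)]]
    by (simp only: mapelim[OF that(1)] css list.map u_def)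
  have "finite {\<alpha> \<in> L. \<not> independent L (map (\<lambda>cs. horner cs \<alpha>) (map elim ess))}"
  proof (rule Suc.hyps(1))
    show "n = length (map elim ess)" using Suc.hyps(2) css by simp
    show "set cs \<subseteq> carrier R" if "cs \<in> set (map elim ess)" for cs using that elim(1) es by auto
    show "independent L (map (\<lambda>cs. horner cs \<alpha>0) (map elim ess))"
      using iff[OF \<alpha>0 g(2)] Suc.prems(2) by simp
  qed
  moreover have "finite {\<alpha> \<in> L. horner (map g ds) \<alpha> = \<zero>}"
    using finite_horner_zeros[OF gR[OF ds] \<alpha>0] g ds \<alpha>0 by (simp add: linop_horner[symmetric] u_def)
  moreover have "{\<alpha> \<in> L. \<not> independent L (map (\<lambda>cs. horner cs \<alpha>) css)} \<subseteq>
     {\<alpha> \<in> L. \<not> independent L (map (\<lambda>cs. horner cs \<alpha>) (map elim ess))} \<union> {\<alpha> \<in> L. horner (map g ds) \<alpha> = \<zero>}"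
  proof
    fix \<alpha> assume \<alpha>: "\<alpha> \<in> {\<alpha> \<in> L. \<not> independent L (map (\<lambda>cs. horner cs \<alpha>) css)}"
    then have \<alpha>L: "\<alpha> \<in> L" by simp
    then have "g (u \<alpha>) = horner (map g ds) \<alpha>" using g(1) ds by (simp add: linop_horner u_def)
    then show "\<alpha> \<in> {\<alpha> \<in> L. \<not> independent L (map (\<lambda>cs. horner cs \<alpha>) (map elim ess))} \<union>
        {\<alpha> \<in> L. horner (map g ds) \<alpha> = \<zero>}"
      using \<alpha> iff[OF \<alpha>L] by (cases "g (u \<alpha>) = \<zero>") (simp_all only: mem_Collect_eq Un_iff simp_thms)
  qed
  ultimately show ?case by (meson finite_UnI finite_subset)
qed simp

end

section \<open>Locally bounded operators\<close>

text \<open>The highest power comes first, because \<open>independent\<close> and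
  \<open>Span\<close> build lists by adding the new vector at the head.\<close>

primrec krylov :: "('a \<Rightarrow> 'a) \<Rightarrow> 'a \<Rightarrow> nat \<Rightarrow> 'a list" where
  "krylov S v 0 = []"
| "krylov S v (Suc k) = (S ^^ k) v # krylov S v k"

lemma length_krylov [simp]: "length (krylov S v k) = k"
  by (induction k) auto

lemma set_krylov: "set (krylov S v k) = (\<lambda>i. (S ^^ i) v) ` {..<k}"
  by (induction k) (auto simp: lessThan_Suc)

context self_centralizing
begin

lemma Span_closed:
  assumes "set Us \<subseteq> carrier R"
  shows "Span L Us \<subseteq> carrier R" "\<zero> \<in> Span L Us"
    "u \<in> Span L Us \<Longrightarrow> v \<in> Span L Us \<Longrightarrow> u \<oplus> v \<in> Span L Us"
    "u \<in> Span L Us \<Longrightarrow> \<ominus> u \<in> Span L Us"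
    "u \<in> Span L Us \<Longrightarrow> v \<in> Span L Us \<Longrightarrow> u \<ominus> v \<in> Span L Us"
    "l \<in> L \<Longrightarrow> u \<in> Span L Us \<Longrightarrow> l \<otimes> u \<in> Span L Us"
    "u \<in> set Us \<Longrightarrow> u \<in> Span L Us"
  using Span_subgroup_props[OF subfield_L assms] Span_smult_closed[OF subfield_L assms]
    Span_base_incl[OF subfield_L assms]
  by (simp_all add: minus_eq subset_iff del: Span.simps)

lemma independent_length_le_Span:
  assumes "independent L Ws" "set Ws \<subseteq> Span L Us" "set Us \<subseteq> carrier R"
  shows "length Ws \<le> length Us"
proof -
  have "\<exists>Vs. independent L Vs \<and> Span L Vs = Span L Us \<and> length Vs \<le> length Us"
    using assms(3)
  proof (induction Us)
    case (Cons u Us)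
    then obtain Vs where Vs: "independent L Vs" "Span L Vs = Span L Us" "length Vs \<le> length Us" by auto
    have Us: "set Us \<subseteq> carrier R" "u \<in> carrier R" using Cons.prems by auto
    show ?case
    proof (cases "u \<in> Span L Us")
      case True
      then have "set (u # Us) \<subseteq> Span L Us" using Span_closed(7)[OF Us(1)] by auto
      then have "Span L (u # Us) = Span L Us"
        using mono_Span_subset[OF subfield_L _ Us(1)] mono_Span[OF subfield_L Us] by blast
      then show ?thesis using Vs by (intro exI[of _ Vs]) auto
    next
      case False
      then have "independent L (u # Vs)" using Vs Us by (intro li_Cons) auto
      moreover have "Span L (u # Vs) = Span L (u # Us)" using Vs by simp
      ultimately show ?thesis using Vs(3) by (intro exI[of _ "u # Vs"]) (simp del: Span.simps)
    qed
  qed auto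
  then obtain Vs where Vs: "independent L Vs" "Span L Vs = Span L Us" "length Vs \<le> length Us" by blast
  then show ?thesis using independent_length_le[OF subfield_L assms(1) Vs(1)] assms(2) by simp
qed

lemma linop_funpow:
  assumes "linop S" "v \<in> carrier R" shows "(S ^^ i) v \<in> carrier R"
  by (induction i) (use assms in auto)

lemma set_krylov_carrier: "linop S \<Longrightarrow> v \<in> carrier R \<Longrightarrow> set (krylov S v k) \<subseteq> carrier R"
  by (auto simp: set_krylov linop_funpow)

text \<open>By \<open>locally_bounded_iff\<close> this means that every vector lies in an invariant
  subspace of dimension at most \<open>d\<close>. The form with Krylov lists suits specialization,
  since it involves finitely many explicit vectors; invariant subspaces suit algebraic changes of
  the operator. There is no bound on the dimension of D itself.\<close>

definition locally_bounded :: "nat \<Rightarrow> ('a \<Rightarrow> 'a) \<Rightarrow> bool" where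
  "locally_bounded d S \<longleftrightarrow> (\<forall>v \<in> carrier R. \<not> independent L (krylov S v (Suc d)))"

text \<open>A vector in the span of its predecessors makes that span invariant, by
  \<open>krylov_invariant\<close>. The value \<open>j = 0\<close> is possible and means
  \<open>v = \<zero>\<close>.\<close>

lemma dependent_krylovE:
  assumes "linop S" "v \<in> carrier R" "\<not> independent L (krylov S v k)"
  obtains j where "j < k" "(S ^^ j) v \<in> Span L (krylov S v j)"
proof -
  have "\<exists>j<k. (S ^^ j) v \<in> Span L (krylov S v j)"
    using assms(3)
  proof (induction k)
    case (Suc k)
    show ?case
    proof (cases "independent L (krylov S v k)")
      case True
      then have "(S ^^ k) v \<in> Span L (krylov S v k)"
        using Suc.prems li_Cons[OF linop_funpow[OF assms(1,2)]] by fastforce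
      then show ?thesis by blast
    next
      case False
      then show ?thesis using Suc.IH less_SucI by blast
    qed
  qed simp
  then show ?thesis using that by blast
qed

lemma Span_invariant:
  assumes "linop S" "set Us \<subseteq> carrier R" "\<And>u. u \<in> set Us \<Longrightarrow> S u \<in> Span L Us" "u \<in> Span L Us"
  shows "S u \<in> Span L Us"
proof -
  obtain Ks where Ks: "set Ks \<subseteq> L" "u = combine Ks Us"
    using assms(4) Span_eq_combine_set[OF subfield_L assms(2)] by blast
  then have "S u = combine Ks (map S Us)" by (simp add: linop_combine assms)
  moreover have "set (map S Us) \<subseteq> carrier R" using assms(1,2) by auto
  ultimately have "S u \<in> Span L (map S Us)" using combine_in_Span[OF subfield_L _ Ks(1)] by simp
  moreover have "Span L (map S Us) \<subseteq> Span L Us"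
    by (rule mono_Span_subset[OF subfield_L _ assms(2)]) (use assms(3) in auto)
  ultimately show ?thesis by blast
qed

lemma krylov_invariant:
  assumes "linop S" "v \<in> carrier R" "(S ^^ j) v \<in> Span L (krylov S v j)" "u \<in> Span L (krylov S v j)"
  shows "S u \<in> Span L (krylov S v j)"
proof (rule Span_invariant[OF assms(1) _ _ assms(4)])
  show sub: "set (krylov S v j) \<subseteq> carrier R" by (rule set_krylov_carrier[OF assms(1,2)])
  fix u assume "u \<in> set (krylov S v j)"
  then obtain i where i: "i < j" "u = (S ^^ i) v" by (auto simp: set_krylov)
  show "S u \<in> Span L (krylov S v j)"
  proof (cases "Suc i = j")
    case True
    then show ?thesis using assms(3) i by auto
  next
    case False
    then have "(S ^^ Suc i) v \<in> set (krylov S v j)"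
      unfolding set_krylov using i(1) by (intro imageI) auto
    then show ?thesis using Span_closed(7)[OF sub] i(2) by simp
  qed
qed

lemma start_in_krylov_Span:
  assumes "linop S" "v \<in> carrier R" "(S ^^ j) v \<in> Span L (krylov S v j)"
  shows "v \<in> Span L (krylov S v j)"
proof (cases j)
  case 0
  then show ?thesis using assms(3) by simp
next
  case (Suc k)
  then have "v \<in> set (krylov S v j)" 
    unfolding set_krylov by (intro image_eqI[of _ _ 0]) simp_all
  then show ?thesis by (rule Span_closed(7)[OF set_krylov_carrier[OF assms(1,2)]])
qed

lemma locally_bounded_iff:
  assumes S: "linop S"
  shows "locally_bounded d S \<longleftrightarrow> (\<forall>v \<in> carrier R. \<exists>Us. set Us \<subseteq> carrier R \<and> length Us \<le> d \<and>
    v \<in> Span L Us \<and> (\<forall>u \<in> Span L Us. S u \<in> Span L Us))" (is "_ \<longleftrightarrow> (\<forall>v \<in> carrier R. ?P v)")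
proof -
  have "\<not> independent L (krylov S v (Suc d)) \<longleftrightarrow> ?P v" if v: "v \<in> carrier R" for v
  proof
    assume "\<not> independent L (krylov S v (Suc d))"
    then obtain j where j: "j < Suc d" "(S ^^ j) v \<in> Span L (krylov S v j)"
      using dependent_krylovE[OF S v] by blast
    then show "?P v"
      using set_krylov_carrier[OF S v] start_in_krylov_Span[OF S v j(2)] krylov_invariant[OF S v j(2)]
      by (intro exI[of _ "krylov S v j"]) (simp del: Span.simps)
  next
    assume "?P v"
    then obtain Us where Us: "set Us \<subseteq> carrier R" "length Us \<le> d" "v \<in> Span L Us"
      "\<And>u. u \<in> Span L Us \<Longrightarrow> S u \<in> Span L Us" by blast
    have "(S ^^ i) v \<in> Span L Us" for i by (induction i) (use Us in \<open>simp_all del: Span.simps\<close>)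
    then have "set (krylov S v (Suc d)) \<subseteq> Span L Us" unfolding set_krylov by blast
    then show "\<not> independent L (krylov S v (Suc d))"
      using independent_length_le_Span[OF _ _ Us(1), of "krylov S v (Suc d)"] Us(2) by auto
  qed
  then show ?thesis by (simp add: locally_bounded_def del: Span.simps krylov.simps)
qed

text \<open>Subspaces are closed under left scalars, so those invariant under \<open>S\<close> are
  invariant under \<open>S'\<close> too.\<close>

lemma locally_bounded_affine:
  assumes S: "linop S" "locally_bounded d S" and S': "linop S'"
    and lm: "l \<in> L" "m \<in> L" "\<And>u. u \<in> carrier R \<Longrightarrow> S' u = l \<otimes> S u \<oplus> m \<otimes> u"
  shows "locally_bounded d S'"
  unfolding locally_bounded_iff[OF S']
proof
  fix v assume "v \<in> carrier R"
  then obtain Us where Us: "set Us \<subseteq> carrier R" "length Us \<le> d" "v \<in> Span L Us"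
    "\<And>u. u \<in> Span L Us \<Longrightarrow> S u \<in> Span L Us" using S(2) unfolding locally_bounded_iff[OF S(1)] by blast
  have "S' u \<in> Span L Us" if "u \<in> Span L Us" for u
  proof -
    have "u \<in> carrier R" using that Span_closed(1)[OF Us(1)] by blast
    then show ?thesis using Us(4)[OF that] that Span_closed(3,6)[OF Us(1)] lm
      by (simp del: Span.simps)
  qed
  with Us show "\<exists>Us. set Us \<subseteq> carrier R \<and> length Us \<le> d \<and> v \<in> Span L Us \<and>
      (\<forall>u \<in> Span L Us. S' u \<in> Span L Us)" by blast
qed

text \<open>From the endpoint \<open>w\<close> of the Krylov list of \<open>S'\<close>, the operator
  \<open>S\<close> walks back through the same vectors. The two Krylov lists thus have the same
  elements in opposite order.\<close>

lemma locally_bounded_inverse: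
  assumes S: "linop S" "locally_bounded d S" and S': "linop S'"
    and inv: "\<And>u. u \<in> carrier R \<Longrightarrow> S (S' u) = u"
  shows "locally_bounded d S'"
  unfolding locally_bounded_def
proof (rule ballI, rule notI)
  fix v assume v: "v \<in> carrier R" and ind: "independent L (krylov S' v (Suc d))"
  define w where "w = (S' ^^ d) v"
  have w: "w \<in> carrier R" unfolding w_def by (rule linop_funpow[OF S' v])
  have pow: "(S ^^ i) ((S' ^^ (i + k)) v) = (S' ^^ k) v" for i k
  proof (induction i)
    case (Suc i)
    have "(S ^^ Suc i) ((S' ^^ (Suc i + k)) v) = (S ^^ i) (S (S' ((S' ^^ (i + k)) v)))"
      by (simp only: funpow_Suc_right o_apply) simp
    also have "\<dots> = (S ^^ i) ((S' ^^ (i + k)) v)" using inv linop_funpow[OF S' v] by simp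
    finally show ?case using Suc by simp
  qed simp
  have pow': "(S ^^ i) w = (S' ^^ (d - i)) v" if "i \<le> d" for i
    using pow[of i "d - i"] that by (simp add: w_def)
  have "set (krylov S w (Suc d)) = (\<lambda>i. (S' ^^ (d - i)) v) ` {..<Suc d}"
    unfolding set_krylov by (rule image_cong) (simp_all add: pow')
  also have "\<dots> = (\<lambda>i. (S' ^^ i) v) ` ((\<lambda>i. d - i) ` {..<Suc d})" by (simp only: image_image)
  also have "(\<lambda>i. d - i) ` {..<Suc d} = {..<Suc d}"
  proof -
    have "x \<in> (\<lambda>i. d - i) ` {..<Suc d}" if "x < Suc d" for x
      by (rule image_eqI[of _ _ "d - x"]) (use that in auto)
    then show ?thesis by auto
  qed
  finally have "set (krylov S' v (Suc d)) = set (krylov S w (Suc d))" by (simp only: set_krylov)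
  then have "independent L (krylov S w (Suc d))"
    using independent_same_set[OF subfield_L _ _ ind, of "krylov S w (Suc d)"] by simp
  then show False using S(2) w unfolding locally_bounded_def by blast
qed

text \<open>An operator family that is polynomial in \<open>\<alpha>\<close> is encoded by its action \<open>P\<close> on coefficient lists.\<close>
lemma locally_bounded_specialize:
  assumes A: "A \<subseteq> L" "\<alpha>0 \<in> A"
    and P: "\<And>cs. set cs \<subseteq> carrier R \<Longrightarrow> set (P cs) \<subseteq> carrier R"
      "\<And>cs \<alpha>. set cs \<subseteq> carrier R \<Longrightarrow> \<alpha> \<in> A \<Longrightarrow> horner (P cs) \<alpha> = T \<alpha> (horner cs \<alpha>)"
    and inf: "infinite {\<alpha> \<in> A. locally_bounded d (T \<alpha>)}"
  shows "locally_bounded d (T \<alpha>0)"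
  unfolding locally_bounded_def
proof (rule ballI, rule notI)
  fix v assume v: "v \<in> carrier R" and ind: "independent L (krylov (T \<alpha>0) v (Suc d))"
  \<comment> \<open>The list \<open>(P ^^ i) [v]\<close> holds the coefficients of the polynomial
    vector with value \<open>(T \<alpha> ^^ i) v\<close> at \<open>\<alpha>\<close>;
    \<open>rev\<close> produces the order of \<open>krylov\<close>.\<close>
  define css where "css = rev (map (\<lambda>i. (P ^^ i) [v]) [0..<Suc d])"
  have c: "set ((P ^^ i) [v]) \<subseteq> carrier R" for i by (induction i) (use P(1) v in auto)
  have h: "horner ((P ^^ i) [v]) \<alpha> = (T \<alpha> ^^ i) v" if "\<alpha> \<in> A" for \<alpha> i
  proof (induction i)
    case 0
    then show ?case using v that A by auto
  next
    case (Suc i)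
    then show ?case using P(2)[OF c that] by simp
  qed
  have "rev (map (\<lambda>i. horner ((P ^^ i) [v]) \<alpha>) [0..<k]) = krylov (T \<alpha>) v k" if "\<alpha> \<in> A" for \<alpha> k
    by (induction k) (simp_all add: h[OF that])
  then have eq: "map (\<lambda>cs. horner cs \<alpha>) css = krylov (T \<alpha>) v (Suc d)" if "\<alpha> \<in> A" for \<alpha>
    using that unfolding css_def rev_map map_map o_def by (simp only: rev_map)
  have "finite {\<alpha> \<in> L. \<not> independent L (map (\<lambda>cs. horner cs \<alpha>) css)}"
  proof (rule generic_independence)
    show "set cs \<subseteq> carrier R" if "cs \<in> set css" for cs using that c by (auto simp: css_def)
    show "\<alpha>0 \<in> L" using A by blast
    show "independent L (map (\<lambda>cs. horner cs \<alpha>0) css)" using ind by (simp only: eq[OF A(2)])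
  qed
  moreover have "{\<alpha> \<in> A. locally_bounded d (T \<alpha>)} \<subseteq>
      {\<alpha> \<in> L. \<not> independent L (map (\<lambda>cs. horner cs \<alpha>) css)}"
  proof
    fix \<alpha> assume "\<alpha> \<in> {\<alpha> \<in> A. locally_bounded d (T \<alpha>)}"
    then have \<alpha>: "\<alpha> \<in> A" "\<not> independent L (krylov (T \<alpha>) v (Suc d))"
      using v unfolding locally_bounded_def by blast+
    then show "\<alpha> \<in> {\<alpha> \<in> L. \<not> independent L (map (\<lambda>cs. horner cs \<alpha>) css)}"
      using A(1) by (simp only: eq mem_Collect_eq) blast
  qed
  ultimately show False using inf finite_subset by blast
qed

text \<open>Right multiplication by \<open>horner q f\<close> acts on coefficient lists as
  multiplication by \<open>q\<close>. For this \<open>f\<close> has to pass arbitrary coefficients,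
  so here the parameter is central and not merely in L.\<close>

lemma locally_bounded_horner:
  assumes q: "set q \<subseteq> carrier R"
    and inf: "infinite {f \<in> ring_center R. locally_bounded d (\<lambda>u. u \<otimes> horner q f)}"
  shows "locally_bounded d (\<lambda>u. u \<otimes> horner q \<zero>)"
proof (rule locally_bounded_specialize[where T = "\<lambda>f u. u \<otimes> horner q f" and A = "ring_center R"
      and P = "\<lambda>cs. pmul cs q" and d = d])
  fix cs f assume cs: "set cs \<subseteq> carrier R" and f: "f \<in> ring_center R"
  show "horner (pmul cs q) f = horner cs f \<otimes> horner q f"
    by (rule horner_pmul[OF cs q]) (use cs f center_commute in auto)
qed (use q inf in auto)

text \<open>The scalar acts from the left, where every element of L is an admissible parameter. The
  infinite set of central scalars therefore suffices to reach all of L.\<close>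

lemma locally_bounded_extend_scalar:
  assumes S: "linop S" and c: "c \<in> carrier R" and l: "l \<in> L"
    and inf: "infinite (ring_center R)"
    and bd: "\<And>f. f \<in> ring_center R \<Longrightarrow> locally_bounded d (\<lambda>u. S u \<oplus> f \<otimes> (u \<otimes> c))"
  shows "locally_bounded d (\<lambda>u. S u \<oplus> l \<otimes> (u \<otimes> c))"
proof (rule locally_bounded_specialize[where T = "\<lambda>l u. S u \<oplus> l \<otimes> (u \<otimes> c)" and A = L
      and P = "\<lambda>cs. padd (map S cs) (\<zero> # map (\<lambda>u. u \<otimes> c) cs)" and d = d])
  fix cs assume cs: "set cs \<subseteq> carrier R"
  have 1: "set (map S cs) \<subseteq> carrier R" "set (\<zero> # map (\<lambda>u. u \<otimes> c) cs) \<subseteq> carrier R"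
    using cs c S by auto
  show "set (padd (map S cs) (\<zero> # map (\<lambda>u. u \<otimes> c) cs)) \<subseteq> carrier R"
    by (rule set_padd_carrier[OF 1])
  fix \<alpha> assume \<alpha>: "\<alpha> \<in> L"
  have "horner (map (\<lambda>u. u \<otimes> c) cs) \<alpha> = horner cs \<alpha> \<otimes> c"
    using linop_horner[OF linop_right_mult[OF c] cs \<alpha>] by simp
  then show "horner (padd (map S cs) (\<zero> # map (\<lambda>u. u \<otimes> c) cs)) \<alpha> = S (horner cs \<alpha>) \<oplus> \<alpha> \<otimes> (horner cs \<alpha> \<otimes> c)"
    using horner_padd[OF 1 L_carrier[OF \<alpha>]] linop_horner[OF S cs \<alpha>] cs c \<alpha> by simp
next
  have "ring_center R \<subseteq> {\<alpha> \<in> L. locally_bounded d (\<lambda>u. S u \<oplus> \<alpha> \<otimes> (u \<otimes> c))}" using bd by auto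
  then show "infinite {\<alpha> \<in> L. locally_bounded d (\<lambda>u. S u \<oplus> \<alpha> \<otimes> (u \<otimes> c))}"
    using inf infinite_super by blast
qed (use l in auto)

end

section \<open>Generalized polynomial identities and algebraicity\<close>

primrec (in ring) lsum :: "('c \<Rightarrow> 'a) \<Rightarrow> 'c list \<Rightarrow> 'a" where
  "lsum f [] = \<zero>"
| "lsum f (x # xs) = f x \<oplus> lsum f xs"

context ring
begin

lemma lsum_closed [simp]: "(\<And>x. x \<in> set xs \<Longrightarrow> f x \<in> carrier R) \<Longrightarrow> lsum f xs \<in> carrier R"
  by (induction xs) auto

lemma lsum_cong: "(\<And>x. x \<in> set xs \<Longrightarrow> f x = g x) \<Longrightarrow> lsum f xs = lsum g xs"
  by (induction xs) auto

lemma lsum_map: "lsum f (map h xs) = lsum (\<lambda>x. f (h x)) xs"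
  by (induction xs) auto

lemma lsum_append:
  "(\<And>x. x \<in> set xs \<union> set ys \<Longrightarrow> f x \<in> carrier R) \<Longrightarrow> lsum f (xs @ ys) = lsum f xs \<oplus> lsum f ys"
  by (induction xs) (auto simp: a_assoc)

lemma lsum_add:
  "(\<And>x. x \<in> set xs \<Longrightarrow> f x \<in> carrier R \<and> g x \<in> carrier R) \<Longrightarrow>
    lsum (\<lambda>x. f x \<oplus> g x) xs = lsum f xs \<oplus> lsum g xs"
  by (induction xs) (auto simp: a_ac)

lemma lsum_mult_left:
  "(\<And>x. x \<in> set xs \<Longrightarrow> f x \<in> carrier R) \<Longrightarrow> a \<in> carrier R \<Longrightarrow>
    lsum (\<lambda>x. a \<otimes> f x) xs = a \<otimes> lsum f xs"
  by (induction xs) (auto simp: r_distr)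

lemma lsum_mult_right:
  "(\<And>x. x \<in> set xs \<Longrightarrow> f x \<in> carrier R) \<Longrightarrow> a \<in> carrier R \<Longrightarrow>
    lsum (\<lambda>x. f x \<otimes> a) xs = lsum f xs \<otimes> a"
  by (induction xs) (auto simp: l_distr)

lemma lsum_uminus:
  "(\<And>x. x \<in> set xs \<Longrightarrow> f x \<in> carrier R) \<Longrightarrow> lsum (\<lambda>x. \<ominus> f x) xs = \<ominus> lsum f xs"
  by (induction xs) (auto simp: minus_add)

lemma lsum_minus:
  assumes "\<And>x. x \<in> set xs \<Longrightarrow> f x \<in> carrier R \<and> g x \<in> carrier R"
  shows "lsum (\<lambda>x. f x \<ominus> g x) xs = lsum f xs \<ominus> lsum g xs"
  using assms by (simp add: minus_eq lsum_add lsum_uminus)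

lemma combine_map_minus:
  fixes f g :: "'a \<Rightarrow> 'a"
  assumes "set Us \<subseteq> carrier R" "\<And>d. d \<in> set ds \<Longrightarrow> f d \<in> carrier R \<and> g d \<in> carrier R"
  shows "combine (map (\<lambda>d. f d \<ominus> g d) ds) Us = combine (map f ds) Us \<ominus> combine (map g ds) Us"
  using assms
proof (induction ds Us rule: combine.induct)
  case (1 d ds u Us)
  define X Y where "X = combine (map f ds) Us" and "Y = combine (map g ds) Us"
  have "set (map f ds) \<subseteq> carrier R" "set (map g ds) \<subseteq> carrier R" using 1(3) by auto
  then have c: "X \<in> carrier R" "Y \<in> carrier R" using 1(2) by (auto simp: X_def Y_def)
  have d: "f d \<in> carrier R" "g d \<in> carrier R" "u \<in> carrier R" using 1 by auto
  have "combine (map (\<lambda>d. f d \<ominus> g d) (d # ds)) (u # Us) = (f d \<ominus> g d) \<otimes> u \<oplus> (X \<ominus> Y)"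
    using 1 by (simp add: X_def Y_def)
  also have "\<dots> = (f d \<otimes> u \<oplus> X) \<ominus> (g d \<otimes> u \<oplus> Y)" using c d by algebra
  finally show ?case by (simp add: X_def Y_def)
qed (simp_all add: minus_eq)

end

context div_ring
begin

text \<open>Elements independent over the center stay independent as right multiplications, with
  coefficients from D on the left. If the first coefficient \<open>d\<close> is nonzero, division by
  it gives a relation with coefficients \<open>es\<close> and leading term
  \<open>u \<otimes> b\<close>. Replacing \<open>u\<close> by \<open>x \<otimes> u\<close> and
  subtracting \<open>x\<close> times the relation leaves a shorter one with coefficients
  \<open>e \<otimes> x \<ominus> x \<otimes> e\<close>. By induction the \<open>es\<close> are
  central, and \<open>u = \<one>\<close> exhibits \<open>b\<close> in the span of the
  others.\<close>

lemma generalized_polynomial_identity: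
  assumes "independent (ring_center R) bs" "length ds = length bs" "set ds \<subseteq> carrier R"
    and "\<And>u. u \<in> carrier R \<Longrightarrow> combine ds (map ((\<otimes>) u) bs) = \<zero>"
  shows "set ds \<subseteq> {\<zero>}"
  using assms
proof (induction bs arbitrary: ds rule: list.induct)
  case (Cons b bs)
  then obtain d ds' where ds: "ds = d # ds'" by (cases ds) auto
  have ind: "independent (ring_center R) bs" "b \<notin> Span (ring_center R) bs" and b: "b \<in> carrier R"
    using independent_backwards[OF Cons.prems(1)] by auto
  have bs: "set bs \<subseteq> carrier R" by (rule independent_in_carrier[OF ind(1)])
  have d: "d \<in> carrier R" and ds': "set ds' \<subseteq> carrier R" using Cons.prems ds by auto
  have ubs: "set (map ((\<otimes>) u) bs) \<subseteq> carrier R" if "u \<in> carrier R" for u using that bs by auto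
  have rel: "d \<otimes> (u \<otimes> b) \<oplus> combine ds' (map ((\<otimes>) u) bs) = \<zero>" if "u \<in> carrier R" for u
    using Cons.prems(4)[OF that] ds by simp
  have "d = \<zero>"
  proof (rule ccontr)
    assume d0: "d \<noteq> \<zero>"
    define es where "es = map ((\<otimes>) (inv d)) ds'"
    have es: "set es \<subseteq> carrier R" using d d0 ds' by (auto simp: es_def)
    have rel': "combine es (map ((\<otimes>) u) bs) = \<ominus> (u \<otimes> b)" if u: "u \<in> carrier R" for u
    proof -
      have c: "combine ds' (map ((\<otimes>) u) bs) \<in> carrier R" using ds' ubs[OF u] by blast
      have "inv d \<otimes> (d \<otimes> (u \<otimes> b) \<oplus> combine ds' (map ((\<otimes>) u) bs)) = \<zero>"
        using rel[OF u] d d0 by simp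
      then have "u \<otimes> b \<oplus> inv d \<otimes> combine ds' (map ((\<otimes>) u) bs) = \<zero>"
        using c d d0 u b by (simp add: r_distr)
      then have "u \<otimes> b \<oplus> combine es (map ((\<otimes>) u) bs) = \<zero>"
        unfolding es_def using combine_r_distr[OF ds' ubs[OF u], of "inv d"] d d0 by simp
      moreover have "combine es (map ((\<otimes>) u) bs) \<in> carrier R" using es ubs[OF u] by blast
      ultimately show ?thesis using u b by (metis add.m_comm m_closed minus_equality)
    qed
    have "e \<in> ring_center R" if e: "e \<in> set es" for e
    proof -
      have "e \<otimes> x = x \<otimes> e" if x: "x \<in> carrier R" for x
      proof -
        have "set (map (\<lambda>e. e \<otimes> x \<ominus> x \<otimes> e) es) \<subseteq> {\<zero>}"
        proof (rule Cons.IH[OF ind(1)])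
          show "length (map (\<lambda>e. e \<otimes> x \<ominus> x \<otimes> e) es) = length bs"
            using Cons.prems(2) ds by (simp add: es_def)
          show "set (map (\<lambda>e. e \<otimes> x \<ominus> x \<otimes> e) es) \<subseteq> carrier R" using es x by auto
          fix u assume u: "u \<in> carrier R"
          have shift: "combine (map (\<lambda>e. e \<otimes> x) es) (map ((\<otimes>) u) bs) = combine es (map ((\<otimes>) (x \<otimes> u)) bs)"
            using es bs
          proof (induction es bs rule: combine.induct)
            case (1 k Ks v Us)
            then show ?case using x u by (simp add: m_assoc)
          qed simp_all
          have "combine (map (\<lambda>e. e \<otimes> x \<ominus> x \<otimes> e) es) (map ((\<otimes>) u) bs)
            = combine (map (\<lambda>e. e \<otimes> x) es) (map ((\<otimes>) u) bs) \<ominus> combine (map ((\<otimes>) x) es) (map ((\<otimes>) u) bs)"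
            by (rule combine_map_minus[OF ubs[OF u]]) (use es x in auto)
          also have "\<dots> = \<ominus> (x \<otimes> u \<otimes> b) \<ominus> x \<otimes> (\<ominus> (u \<otimes> b))"
            using shift rel' x u combine_r_distr[OF es ubs[OF u] x] by simp
          also have "\<dots> = \<zero>" using x u b by (simp add: minus_eq r_minus m_assoc l_neg)
          finally show "combine (map (\<lambda>e. e \<otimes> x \<ominus> x \<otimes> e) es) (map ((\<otimes>) u) bs) = \<zero>" .
        qed
        then have "e \<otimes> x \<ominus> x \<otimes> e = \<zero>" using e by auto
        then show ?thesis using e es x by (simp add: subset_iff)
      qed
      then show ?thesis using e es unfolding ring_center_def by blast
    qed
    then have "combine es bs \<in> Span (ring_center R) bs"
      by (intro combine_in_Span[OF subfield_center bs]) blast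
    moreover have "combine es bs = \<ominus> b"
    proof -
      have "map ((\<otimes>) \<one>) bs = bs" using bs by (intro map_idI) auto
      then show ?thesis using rel'[of \<one>] b by simp
    qed
    ultimately have "\<ominus> (\<ominus> b) \<in> Span (ring_center R) bs"
      using Span_subgroup_props(4)[OF subfield_center bs] by metis
    then show False using ind(2) b by simp
  qed
  moreover have "set ds' \<subseteq> {\<zero>}"
  proof (rule Cons.IH[OF ind(1) _ ds'])
    show "length ds' = length bs" using Cons.prems(2) ds by simp
    show "combine ds' (map ((\<otimes>) u) bs) = \<zero>" if u: "u \<in> carrier R" for u
    proof -
      have "combine ds' (map ((\<otimes>) u) bs) \<in> carrier R" using ds' ubs[OF u] by blast
      then show ?thesis using rel[OF u] u b \<open>d = \<zero>\<close> by simp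
    qed
  qed
  ultimately show ?case using ds by simp
qed simp

section \<open>Algebraicity over the center\<close>

definition algebraic_over_center :: "'a \<Rightarrow> bool" where
  "algebraic_over_center x \<longleftrightarrow>
     (\<exists>p. set p \<subseteq> ring_center R \<and> p \<noteq> [] \<and> last p \<noteq> \<zero> \<and> horner p x = \<zero>)"

lemma horner_append_zero: "set p \<subseteq> carrier R \<Longrightarrow> x \<in> carrier R \<Longrightarrow> horner (p @ [\<zero>]) x = horner p x"
  by (induction p) auto

lemma algebraic_over_centerI:
  assumes "set p \<subseteq> ring_center R" "\<not> set p \<subseteq> {\<zero>}" "x \<in> carrier R" "horner p x = \<zero>"
  shows "algebraic_over_center x"
  using assms(1,2,4)
proof (induction p rule: rev_induct)
  case (snoc c p)
  show ?case
  proof (cases "c = \<zero>")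
    case True
    have "set p \<subseteq> carrier R" using snoc.prems(1) by auto
    then show ?thesis using snoc True horner_append_zero[of p x] assms(3) by auto
  next
    case False
    then show ?thesis using snoc.prems unfolding algebraic_over_center_def
      by (intro exI[of _ "p @ [c]"]) auto
  qed
qed simp

lemma horner_commute:
  assumes "set p \<subseteq> ring_center R" "x \<in> carrier R"
  shows "x \<otimes> horner p x = horner p x \<otimes> x"
  using assms(1)
proof (induction p)
  case (Cons c p)
  then have p: "set p \<subseteq> carrier R" "c \<in> ring_center R" by auto
  have h: "horner p x \<in> carrier R" "c \<in> carrier R" using p assms(2) by simp_all
  have "x \<otimes> horner p x \<otimes> x = x \<otimes> (horner p x \<otimes> x)" using h assms(2) by (simp only: m_assoc)
  then have "x \<otimes> (x \<otimes> horner p x) = x \<otimes> horner p x \<otimes> x" using Cons by simp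
  then show ?case using h assms(2) center_commute[OF p(2) assms(2)] by (simp add: l_distr r_distr)
qed (use assms in simp)

lemma combine_powers:
  assumes "set p \<subseteq> ring_center R" "x \<in> carrier R"
  shows "combine p (map (\<lambda>i. x [^] i) [j..<j + length p]) = horner p x \<otimes> x [^] j"
  using assms(1)
proof (induction p arbitrary: j)
  case (Cons c p)
  have p: "set p \<subseteq> carrier R" "c \<in> carrier R" "set p \<subseteq> ring_center R" using Cons.prems by auto
  have h: "horner p x \<in> carrier R" using p assms(2) by simp
  have "combine (c # p) (map (\<lambda>i. x [^] i) [j..<j + length (c # p)]) =
      c \<otimes> x [^] j \<oplus> combine p (map (\<lambda>i. x [^] i) [Suc j..<Suc j + length p])"
    by (simp add: upt_conv_Cons del: upt_Suc)
  also have "\<dots> = c \<otimes> x [^] j \<oplus> horner p x \<otimes> (x [^] j \<otimes> x)"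
    using Cons.IH[OF p(3), of "Suc j"] by simp
  also have "x [^] j \<otimes> x = x \<otimes> x [^] j" using nat_pow_comm[of x j 1] assms(2) by simp
  also have "horner p x \<otimes> (x \<otimes> x [^] j) = x \<otimes> horner p x \<otimes> x [^] j"
    using h assms(2) by (simp add: horner_commute[OF p(3) assms(2)] m_assoc)
  finally show ?case using h assms(2) p by (simp add: l_distr)
qed (use assms in simp)

lemma algebraic_if_dependent_powers:
  assumes "x \<in> carrier R" "\<not> independent (ring_center R) (map (\<lambda>i. x [^] i) [0..<k])"
  shows "algebraic_over_center x"
proof -
  have "set (map (\<lambda>i. x [^] (i::nat)) [0..<k]) \<subseteq> carrier R" using assms(1) by auto
  then obtain p where p: "length p = length (map (\<lambda>i. x [^] (i::nat)) [0..<k])"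
    "combine p (map (\<lambda>i. x [^] i) [0..<k]) = \<zero>" "set p \<subseteq> ring_center R" "set p \<noteq> {\<zero>}"
    using dependent_imp_non_trivial_combine[OF subfield_center _ assms(2)] by metis
  have len: "length p = k" using p(1) by simp
  have "p \<noteq> []"
  proof
    assume "p = []"
    then have "k = 0" using len by simp
    then show False using assms(2) by simp
  qed
  then have "\<not> set p \<subseteq> {\<zero>}" using p(4) by (cases p) auto
  moreover have "set p \<subseteq> carrier R" using p(3) by auto
  then have "horner p x = \<zero>"
    using combine_powers[OF p(3) assms(1), of 0] p(2) len assms(1) by simp
  ultimately show ?thesis by (intro algebraic_over_centerI[OF p(3)] assms(1))
qed

lemma horner_conj:
  assumes "set p \<subseteq> ring_center R" "x \<in> carrier R" "a \<in> carrier R" "a \<noteq> \<zero>"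
  shows "horner p (a \<otimes> x \<otimes> inv a) = a \<otimes> horner p x \<otimes> inv a"
  using assms(1)
proof (induction p)
  case (Cons c p)
  then have p: "set p \<subseteq> carrier R" "c \<in> ring_center R" by auto
  have "c = a \<otimes> c \<otimes> inv a"
    using center_commute[OF p(2) assms(3)] p assms by (simp add: m_assoc)
  then show ?case using Cons p assms by (simp add: conj_mult r_distr l_distr m_assoc)
qed (use assms in simp)

lemma algebraic_conj:
  assumes "algebraic_over_center x" "x \<in> carrier R" "a \<in> carrier R" "a \<noteq> \<zero>"
  shows "algebraic_over_center (a \<otimes> x \<otimes> inv a)"
proof -
  obtain p where p: "set p \<subseteq> ring_center R" "p \<noteq> []" "last p \<noteq> \<zero>" "horner p x = \<zero>"
    using assms(1) by (auto simp: algebraic_over_center_def)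
  then have "horner p (a \<otimes> x \<otimes> inv a) = \<zero>" using horner_conj[OF p(1) assms(2-4)] assms by simp
  with p show ?thesis unfolding algebraic_over_center_def by blast
qed

end

context self_centralizing
begin

text \<open>The operator sending \<open>u\<close> to the sum of the terms
  \<open>l_i \<otimes> u \<otimes> c [^] i\<close>. Left multiplications by L commute with each
  other and with right multiplication by \<open>c\<close>, so these operators behave like
  polynomials in one variable over L.\<close>

primrec opoly :: "'a \<Rightarrow> 'a list \<Rightarrow> 'a \<Rightarrow> 'a" where
  "opoly c [] u = \<zero>"
| "opoly c (l # ls) u = l \<otimes> u \<oplus> opoly c ls (u \<otimes> c)"

lemma opoly_closed [simp]: "set ls \<subseteq> L \<Longrightarrow> c \<in> carrier R \<Longrightarrow> u \<in> carrier R \<Longrightarrow> opoly c ls u \<in> carrier R"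
  by (induction ls arbitrary: u) auto

lemma opoly_combine:
  "c \<in> carrier R \<Longrightarrow> u \<in> carrier R \<Longrightarrow>
    opoly c ls (u \<otimes> c [^] j) = combine ls (map (\<lambda>i. u \<otimes> c [^] i) [j..<j + length ls])"
proof (induction ls arbitrary: j)
  case (Cons l ls)
  have "u \<otimes> c [^] j \<otimes> c = u \<otimes> c [^] Suc j" using Cons.prems by (simp add: m_assoc)
  then show ?case using Cons.IH[of "Suc j"] Cons.prems by (simp add: upt_conv_Cons del: nat_pow_Suc upt_Suc)
qed simp

lemma linop_opoly: "set ls \<subseteq> L \<Longrightarrow> c \<in> carrier R \<Longrightarrow> linop (opoly c ls)"
proof (induction ls)
  case Nil
  then show ?case by (simp add: linop_def)
next
  case (Cons l ls)
  then have IH: "linop (opoly c ls)" and l: "l \<in> L" and c: "c \<in> carrier R" by auto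
  show ?case unfolding linop_def
  proof (intro conjI ballI)
    fix u v assume uv: "u \<in> carrier R" "v \<in> carrier R"
    show "opoly c (l # ls) u \<in> carrier R" using Cons.prems uv by (intro opoly_closed)
    show "opoly c (l # ls) (u \<oplus> v) = opoly c (l # ls) u \<oplus> opoly c (l # ls) v"
      using uv l c IH by (simp add: l_distr r_distr linop_add[OF IH] a_ac)
  next
    fix k u assume k: "k \<in> L" and u: "u \<in> carrier R"
    have "l \<otimes> (k \<otimes> u) = k \<otimes> (l \<otimes> u)" using k l u by (simp add: m_assoc[symmetric] L_commute)
    then show "opoly c (l # ls) (k \<otimes> u) = k \<otimes> opoly c (l # ls) u"
      using k u l c IH linop_smult[OF IH k, of "u \<otimes> c"] by (simp add: r_distr m_assoc)
  qed
qed

lemma opoly_shift: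
  "set ls \<subseteq> L \<Longrightarrow> c \<in> carrier R \<Longrightarrow> u \<in> carrier R \<Longrightarrow> opoly c ls (u \<otimes> c) = opoly c ls u \<otimes> c"
proof (induction ls arbitrary: u)
  case (Cons l ls)
  then show ?case by (simp add: l_distr m_assoc[of l u c])
qed simp

lemma opoly_shift_pow:
  assumes "set ls \<subseteq> L" "c \<in> carrier R" "u \<in> carrier R"
  shows "opoly c ls (u \<otimes> c [^] (k::nat)) = opoly c ls u \<otimes> c [^] k"
proof (induction k)
  case (Suc k)
  have "opoly c ls (u \<otimes> c [^] Suc k) = opoly c ls ((u \<otimes> c [^] k) \<otimes> c)"
    using assms by (simp add: m_assoc)
  also have "\<dots> = opoly c ls (u \<otimes> c [^] k) \<otimes> c"
    by (rule opoly_shift) (use assms in auto)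
  also have "\<dots> = opoly c ls u \<otimes> c [^] Suc k"
    using assms by (simp add: Suc m_assoc)
  finally show ?case .
qed (use assms in simp)

lemma opoly_zeros: "c \<in> carrier R \<Longrightarrow> u \<in> carrier R \<Longrightarrow> opoly c (replicate k \<zero>) u = \<zero>"
  by (induction k arbitrary: u) auto

lemma opoly_append:
  assumes "set ms \<subseteq> L" "set ls \<subseteq> L" "c \<in> carrier R" "u \<in> carrier R"
  shows "opoly c (ls @ ms) u = opoly c ls u \<oplus> opoly c ms (u \<otimes> c [^] length ls)"
  using assms(2,4)
proof (induction ls arbitrary: u)
  case (Cons l ls)
  have pw: "u \<otimes> c \<otimes> c [^] length ls = u \<otimes> c [^] Suc (length ls)"
    using Cons.prems assms(3) nat_pow_comm[of c "length ls" 1] by (simp add: m_assoc)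
  have m: "opoly c ms (u \<otimes> c [^] Suc (length ls)) \<in> carrier R"
    using Cons.prems assms by (intro opoly_closed m_closed nat_pow_closed)
  have "opoly c (ls @ ms) (u \<otimes> c) = opoly c ls (u \<otimes> c) \<oplus> opoly c ms (u \<otimes> c [^] Suc (length ls))"
    using Cons.IH[of "u \<otimes> c"] Cons.prems assms(3) by (simp only: pw) simp
  then show ?case using Cons.prems assms(3) m by (simp add: a_assoc del: nat_pow_Suc)
qed (use assms in simp)

lemma opoly_add:
  assumes "c \<in> carrier R" "length as = length bs" "set as \<subseteq> L" "set bs \<subseteq> L" "u \<in> carrier R"
  shows "opoly c (map2 (\<oplus>) as bs) u = opoly c as u \<oplus> opoly c bs u"
  using assms(2-5)
proof (induction as bs arbitrary: u rule: list_induct2)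
  case (Cons a as b bs)
  then show ?case using assms(1) by (simp add: l_distr a_ac)
qed simp

lemma opoly_mult:
  assumes "c \<in> carrier R" "set as \<subseteq> L" "l \<in> L" "u \<in> carrier R"
  shows "opoly c (map ((\<otimes>) l) as) u = l \<otimes> opoly c as u"
  using assms(2,4) by (induction as arbitrary: u) (use assms in \<open>auto simp: r_distr m_assoc\<close>)

lemma set_map2_add: "set as \<subseteq> L \<Longrightarrow> set bs \<subseteq> L \<Longrightarrow> set (map2 (\<oplus>) as bs) \<subseteq> L"
  by (induction as bs rule: list_induct2') auto

text \<open>Composition is multiplication of polynomials. The coefficient list is padded with zeros,
  so that its length, which counts in the final relation, is known exactly.\<close>

lemma opoly_compose:
  assumes "set ls \<subseteq> L" "set ms \<subseteq> L" "c \<in> carrier R"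
  shows "\<exists>ns. set ns \<subseteq> L \<and> length ns = length ls + length ms \<and>
    (\<forall>u \<in> carrier R. opoly c ns u = opoly c ls (opoly c ms u))"
  using assms(1)
proof (induction ls)
  case Nil
  show ?case using assms(3)
    by (intro exI[of _ "replicate (length ms) \<zero>"]) (auto simp: opoly_zeros)
next
  case (Cons l ls)
  then obtain ns where ns: "set ns \<subseteq> L" "length ns = length ls + length ms"
    "\<And>u. u \<in> carrier R \<Longrightarrow> opoly c ns u = opoly c ls (opoly c ms u)" by auto
  have l: "l \<in> L" using Cons.prems by simp
  \<comment> \<open>Padding to the length of \<open>\<zero> # ns\<close> is essential, since
    \<open>map2\<close> would cut off the longer list.\<close>
  define ks where "ks = map ((\<otimes>) l) ms @ replicate (Suc (length ls)) \<zero>"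
  have lms: "set (map ((\<otimes>) l) ms) \<subseteq> L" using l assms(2) by auto
  have ks: "set ks \<subseteq> L" "length ks = Suc (length ls) + length ms"
    using lms by (auto simp: ks_def)
  have z: "set (replicate (Suc (length ls)) \<zero>) \<subseteq> L" by auto
  have "opoly c (map2 (\<oplus>) ks (\<zero> # ns)) u = opoly c (l # ls) (opoly c ms u)"
    if u: "u \<in> carrier R" for u
  proof -
    have "opoly c (map2 (\<oplus>) ks (\<zero> # ns)) u = opoly c ks u \<oplus> opoly c (\<zero> # ns) u"
      by (rule opoly_add) (use ks ns u assms in auto)
    moreover have "opoly c ks u = l \<otimes> opoly c ms u"
      using opoly_append[OF z lms assms(3) u] opoly_zeros[OF assms(3), of _ "Suc (length ls)"]
        opoly_mult[OF assms(3,2) l u] u l assms by (simp add: ks_def del: replicate_Suc)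
    moreover have "opoly c (\<zero> # ns) u = opoly c ls (opoly c ms u \<otimes> c)"
      using ns u assms Cons.prems by (simp add: opoly_shift)
    ultimately show ?thesis by simp
  qed
  moreover have "set (map2 (\<oplus>) ks (\<zero> # ns)) \<subseteq> L" by (rule set_map2_add) (use ks ns in auto)
  ultimately show ?case using ks(2) ns(2) by (intro exI[of _ "map2 (\<oplus>) ks (\<zero> # ns)"]) simp
qed

lemma krylov_right_mult:
  "c \<in> carrier R \<Longrightarrow> u \<in> carrier R \<Longrightarrow> krylov (\<lambda>u. u \<otimes> c) u k = rev (map (\<lambda>i. u \<otimes> c [^] i) [0..<k])"
proof (induction k)
  case (Suc k)
  have "((\<lambda>u. u \<otimes> c) ^^ k) u = u \<otimes> c [^] k" using Suc.prems by (induction k) (auto simp: m_assoc)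
  then show ?case using Suc by simp
qed simp

text \<open>Let \<open>v\<close> have a Krylov space \<open>U\<close> of maximal dimension under right multiplication by \<open>c\<close>, with
  minimal polynomial \<open>p\<close>. Genericity applied to \<open>v \<oplus> f \<otimes> u\<close> shows that \<open>p(c)\<close> maps everything into
  \<open>U\<close>; hence \<open>p(c)\<^sup>2\<close> vanishes, which is a generalized polynomial identity.\<close>
theorem algebraic_if_locally_bounded:
  assumes c: "c \<in> carrier R" and bd: "locally_bounded d (\<lambda>u. u \<otimes> c)" and inf: "infinite (ring_center R)"
  shows "algebraic_over_center c"
proof -
  define T where "T = (\<lambda>u. u \<otimes> c)"
  have T: "linop T" unfolding T_def by (rule linop_right_mult[OF c])
  \<comment> \<open>The bound \<open>d\<close> need not be attained; \<open>r = k - 1\<close> is the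
    largest Krylov dimension that does occur, and it occurs at \<open>v\<close>.\<close>
  define k where "k = (LEAST k. \<forall>v \<in> carrier R. \<not> independent L (krylov T v k))"
  have "\<forall>v \<in> carrier R. \<not> independent L (krylov T v (Suc d))"
    using bd unfolding locally_bounded_def T_def .
  then have k: "\<forall>v \<in> carrier R. \<not> independent L (krylov T v k)"
    unfolding k_def by (rule LeastI)
  have "k \<noteq> 0" using k by (metis krylov.simps(1) li_Nil zero_closed)
  then obtain r where r: "k = Suc r" by (cases k) auto
  have "\<not> (\<forall>v \<in> carrier R. \<not> independent L (krylov T v r))"
    using not_less_Least[of r "\<lambda>k. \<forall>v \<in> carrier R. \<not> independent L (krylov T v k)"] r
    unfolding k_def by simp
  then obtain v where v: "v \<in> carrier R" and ind: "independent L (krylov T v r)" by blast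
  define U where "U = Span L (krylov T v r)"
  have kv: "set (krylov T v r) \<subseteq> carrier R" by (rule set_krylov_carrier[OF T v])
  have "(T ^^ r) v \<in> U" unfolding U_def
    using k v r li_Cons[OF linop_funpow[OF T v] _ ind] by fastforce
  have pow: "(T ^^ i) u = u \<otimes> c [^] i" if "u \<in> carrier R" for i u
    using that c by (induction i) (auto simp: T_def m_assoc)
  have U: "U = Span L (map (\<lambda>i. v \<otimes> c [^] i) [0..<r])"
    unfolding U_def
    by (rule Span_same_set[OF subfield_L kv]) (simp add: T_def krylov_right_mult[OF c v])
  have sv: "set (map (\<lambda>i. v \<otimes> c [^] (i::nat)) [0..<r]) \<subseteq> carrier R" using v c by auto
  obtain ls where ls: "set ls \<subseteq> L" "length ls = r"
    "v \<otimes> c [^] r = combine ls (map (\<lambda>i. v \<otimes> c [^] i) [0..<r])"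
    using \<open>(T ^^ r) v \<in> U\<close> Span_mem_iff_length_version[OF subfield_L sv] unfolding U pow[OF v]
    by auto
  have lsv: "v \<otimes> c [^] r = opoly c ls v"
    using ls(3) opoly_combine[OF c v, of ls 0] ls(2) v c by simp
  \<comment> \<open>\<open>Q\<close> is the minimal polynomial of \<open>v\<close> evaluated at
    right multiplication by \<open>c\<close>. It vanishes on \<open>U\<close> because it vanishes at
    \<open>v\<close> and commutes with that multiplication.\<close>
  define Q where "Q u = u \<otimes> c [^] r \<ominus> opoly c ls u" for u
  have lop: "linop (opoly c ls)" by (rule linop_opoly[OF ls(1) c])
  have cp: "c [^] r \<in> carrier R" using c by simp
  have Q: "linop Q" unfolding linop_def
  proof (intro conjI ballI)
    fix u w assume uw: "u \<in> carrier R" "w \<in> carrier R"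
    show "Q u \<in> carrier R" using uw cp lop by (simp add: Q_def)
    have "opoly c ls u \<in> carrier R" "opoly c ls w \<in> carrier R" using uw lop by simp_all
    then show "Q (u \<oplus> w) = Q u \<oplus> Q w" unfolding Q_def linop_add[OF lop uw] using uw cp by algebra
  next
    fix l u assume lu: "l \<in> L" "u \<in> carrier R"
    then show "Q (l \<otimes> u) = l \<otimes> Q u"
      unfolding Q_def linop_smult[OF lop lu] using cp lop by (simp add: minus_eq r_distr r_minus m_assoc)
  qed
  have cc: "c \<otimes> c [^] r = c [^] r \<otimes> c" using nat_pow_comm[of c r 1] c by simp
  have Qshift: "Q (u \<otimes> c) = Q u \<otimes> c" if u: "u \<in> carrier R" for u
  proof -
    have "u \<otimes> c \<otimes> c [^] r = u \<otimes> c [^] r \<otimes> c" using u c cp by (simp add: m_assoc cc)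
    then show ?thesis using u c cp ls(1)
      by (simp add: Q_def opoly_shift minus_eq l_distr l_minus)
  qed
  have Qv: "Q v = \<zero>" using lsv linop_closed[OF lop v] by (simp add: Q_def minus_eq r_neg)
  have Qpow: "Q (v \<otimes> c [^] (i::nat)) = \<zero>" for i
  proof (induction i)
    case (Suc i)
    have "Q (v \<otimes> c [^] Suc i) = Q (v \<otimes> c [^] i \<otimes> c)" using v c by (simp add: m_assoc)
    also have "\<dots> = \<zero>" using Qshift[of "v \<otimes> c [^] i"] Suc v c by simp
    finally show ?case .
  qed (use v Qv in simp)
  have QU: "Q w = \<zero>" if "w \<in> U" for w
  proof -
    obtain Ks where Ks: "set Ks \<subseteq> L" "w = combine Ks (map (\<lambda>i. v \<otimes> c [^] i) [0..<r])"
      using \<open>w \<in> U\<close> Span_eq_combine_set[OF subfield_L sv] unfolding U by blast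
    have z: "map Q (map (\<lambda>i. v \<otimes> c [^] i) [0..<r]) = replicate r \<zero>"
      using Qpow by (simp add: map_replicate_trivial o_def map_replicate_const)
    have "combine Ks (replicate m \<zero>) = \<zero>" if "set Ks \<subseteq> carrier R" for m Ks
      using that
    proof (induction Ks arbitrary: m)
      case (Cons k Ks)
      then show ?case by (cases m) auto
    qed simp
    moreover have "set Ks \<subseteq> carrier R" using Ks(1) by auto
    ultimately show ?thesis using linop_combine[OF Q Ks(1) sv] Ks(2) z by metis
  qed
  have QV: "Q u \<in> U" if u: "u \<in> carrier R" for u
  proof (rule ccontr)
    assume notin: "Q u \<notin> U"
    \<comment> \<open>At the parameter \<open>\<zero>\<close> these are \<open>Q u\<close> and the
      Krylov list of \<open>v\<close>, which are independent. So for some nonzero central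
      \<open>f\<close>, \<open>Q u\<close> is also independent of the Krylov list of
      \<open>w = v \<oplus> f \<otimes> u\<close>.\<close>
    define css where "css = [Q u] # map (\<lambda>i. [v \<otimes> c [^] i, u \<otimes> c [^] i]) (rev [0..<r])"
    have h: "map (\<lambda>cs. horner cs f) css = Q u # krylov T (v \<oplus> f \<otimes> u) r" if f: "f \<in> ring_center R" for f
    proof -
      have "horner [v \<otimes> c [^] i, u \<otimes> c [^] i] f = (v \<oplus> f \<otimes> u) \<otimes> c [^] i" for i :: nat
        using f u v c by (simp add: l_distr m_assoc)
      moreover have "horner [Q u] f = Q u" using f u Q by simp
      ultimately show ?thesis
        using krylov_right_mult[OF c, of "v \<oplus> f \<otimes> u" r] f u v
        by (simp add: css_def T_def o_def rev_map del: horner.simps)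
    qed
    have "finite {\<alpha> \<in> L. \<not> independent L (map (\<lambda>cs. horner cs \<alpha>) css)}"
    proof (rule generic_independence[of _ \<zero>])
      show "set cs \<subseteq> carrier R" if "cs \<in> set css" for cs
        using that u v c Q by (auto simp: css_def)
      have "v \<oplus> \<zero> \<otimes> u = v" using u v by simp
      then show "independent L (map (\<lambda>cs. horner cs \<zero>) css)"
        using h[of \<zero>] li_Cons[of "Q u" L "krylov T v r"] ind notin u Q
        by (simp add: U_def del: Span.simps)
    qed simp
    then have "finite ({\<alpha> \<in> L. \<not> independent L (map (\<lambda>cs. horner cs \<alpha>) css)} \<union> {\<zero>})" by simp
    then have "\<not> ring_center R \<subseteq> {\<alpha> \<in> L. \<not> independent L (map (\<lambda>cs. horner cs \<alpha>) css)} \<union> {\<zero>}"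
      using inf finite_subset by blast
    then obtain f where f: "f \<in> ring_center R" "f \<noteq> \<zero>" "independent L (map (\<lambda>cs. horner cs f) css)"
      using center_L by blast
    define w where "w = v \<oplus> f \<otimes> u"
    have w: "w \<in> carrier R" using f u v by (simp add: w_def)
    have ind': "independent L (Q u # krylov T w r)" using f(3) h[OF f(1)] by (simp only: w_def)
    have kw: "set (krylov T w r) \<subseteq> carrier R" by (rule set_krylov_carrier[OF T w])
    \<comment> \<open>Otherwise that span would contain \<open>Q w = f \<otimes> Q u\<close>, hence
      \<open>Q u\<close>. The Krylov list of \<open>w\<close> thus has \<open>r + 1\<close>
      independent members, against the choice of \<open>r\<close>.\<close>
    have "(T ^^ r) w \<notin> Span L (krylov T w r)"
    proof
      assume a: "(T ^^ r) w \<in> Span L (krylov T w r)"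
      have "opoly c ls w \<in> Span L (krylov T w r)"
      proof -
        have "set (map (\<lambda>i. w \<otimes> c [^] (i::nat)) [0..<r]) \<subseteq> carrier R" using w c by auto
        then have "opoly c ls w \<in> Span L (map (\<lambda>i. w \<otimes> c [^] i) [0..<r])"
          using combine_in_Span[OF subfield_L _ ls(1)] opoly_combine[OF c w, of ls 0] ls(2) w c by simp
        moreover have "Span L (krylov T w r) = Span L (map (\<lambda>i. w \<otimes> c [^] i) [0..<r])"
          by (rule Span_same_set[OF subfield_L kw]) (simp add: T_def krylov_right_mult[OF c w])
        ultimately show ?thesis by simp
      qed
      then have "w \<otimes> c [^] r \<ominus> opoly c ls w \<in> Span L (krylov T w r)"
        using a pow[OF w] Span_closed(5)[OF kw] by metis
      then have "Q w \<in> Span L (krylov T w r)" by (simp only: Q_def)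
      moreover have "Q w = f \<otimes> Q u"
        using linop_add[OF Q v, of "f \<otimes> u"] linop_smult[OF Q center_L[OF f(1)] u] u Qv f Q
        by (simp add: w_def)
      ultimately have "inv f \<otimes> (f \<otimes> Q u) \<in> Span L (krylov T w r)"
        using Span_closed(6)[OF kw] f by simp
      then have "Q u \<in> Span L (krylov T w r)" using f u Q by simp
      then show False using independent_backwards(1)[OF ind'] by simp
    qed
    then have "independent L (krylov T w (Suc r))"
      using li_Cons[OF linop_funpow[OF T w]] independent_backwards(2)[OF ind'] by simp
    then show False using k w r by blast
  qed
  obtain ms where ms: "set ms \<subseteq> L" "length ms = r + r"
    "\<And>u. u \<in> carrier R \<Longrightarrow> opoly c ms u = opoly c ls (opoly c ls u)"
    using opoly_compose[OF ls(1) ls(1) c] ls(2) by metis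
  define zs where "zs = replicate r \<zero> @ ls"
  have zs: "set zs \<subseteq> L" "length zs = r + r" using ls by (auto simp: zs_def)
  have opz: "opoly c zs u = opoly c ls (u \<otimes> c [^] r)" if u: "u \<in> carrier R" for u
  proof -
    have "set (replicate r \<zero>) \<subseteq> L" by auto
    from opoly_append[OF ls(1) this c u] show ?thesis
      using opoly_zeros[OF c u] ls(1) u c by (simp add: zs_def)
  qed
  \<comment> \<open>\<open>ns @ [\<ominus> \<one>]\<close> lists the coefficients of the negative of
    the square of \<open>Q\<close>: twice the mixed term, minus the square of
    \<open>opoly c ls\<close>, and \<open>\<ominus> \<one>\<close> at the power
    \<open>r + r\<close>. The last entry makes the identity nontrivial.\<close>
  define ns where "ns = map2 (\<oplus>) (map2 (\<oplus>) zs zs) (map ((\<otimes>) (\<ominus> \<one>)) ms)"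
  have nm: "set (map ((\<otimes>) (\<ominus> \<one>)) ms) \<subseteq> L" using ms(1) by auto
  have ns: "set ns \<subseteq> L" "length ns = r + r" unfolding ns_def
    using set_map2_add[OF set_map2_add[OF zs(1) zs(1)] nm] zs(2) ms(2) by simp_all
  have rel: "opoly c (ns @ [\<ominus> \<one>]) u = \<zero>" if u: "u \<in> carrier R" for u
  proof -
    define X Y Z where "X = u \<otimes> c [^] (r + r)" and "Y = opoly c ls (u \<otimes> c [^] r)"
      and "Z = opoly c ls (opoly c ls u)"
    have XYZ: "X \<in> carrier R" "Y \<in> carrier R" "Z \<in> carrier R"
      using u c ls(1) by (auto simp: X_def Y_def Z_def)
    have w: "u \<otimes> c [^] r \<in> carrier R" "opoly c ls u \<in> carrier R" using u c ls(1) by auto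
    have "Q (Q u) = \<zero>" by (rule QU[OF QV[OF u]])
    moreover have "Q u \<otimes> c [^] r = X \<ominus> Y"
      using u c ls(1) by (simp add: Q_def X_def Y_def minus_eq l_distr l_minus m_assoc nat_pow_mult opoly_shift_pow)
    moreover have "opoly c ls (Q u) = Y \<ominus> Z"
      using linop_minus[OF lop w] by (simp add: Q_def Y_def Z_def)
    ultimately have "X \<ominus> Y \<ominus> (Y \<ominus> Z) = \<zero>" unfolding Q_def[of "Q u"] by simp
    then have "\<ominus> (X \<ominus> Y \<ominus> (Y \<ominus> Z)) = \<zero>" by simp
    moreover have "\<ominus> (X \<ominus> Y \<ominus> (Y \<ominus> Z)) = Y \<oplus> Y \<ominus> Z \<ominus> X" using XYZ by algebra
    ultimately have 1: "Y \<oplus> Y \<ominus> Z \<ominus> X = \<zero>" by simp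
    have "opoly c ns u = opoly c (map2 (\<oplus>) zs zs) u \<oplus> opoly c (map ((\<otimes>) (\<ominus> \<one>)) ms) u"
      unfolding ns_def by (rule opoly_add[OF c _ set_map2_add[OF zs(1) zs(1)] nm u]) (simp add: zs ms)
    also have "\<dots> = Y \<oplus> Y \<ominus> Z"
      using opoly_add[OF c refl zs(1) zs(1) u] opoly_mult[OF c ms(1) _ u, of "\<ominus> \<one>"] ms(3)[OF u] opz[OF u] XYZ
      by (simp add: Y_def Z_def l_minus minus_eq)
    finally have "opoly c ns u = Y \<oplus> Y \<ominus> Z" .
    moreover have "opoly c [\<ominus> \<one>] (u \<otimes> c [^] length ns) = \<ominus> X"
      using u c by (simp add: ns(2) X_def l_minus)
    moreover have "opoly c (ns @ [\<ominus> \<one>]) u = opoly c ns u \<oplus> opoly c [\<ominus> \<one>] (u \<otimes> c [^] length ns)"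
      by (rule opoly_append) (use ns u c in auto)
    ultimately show ?thesis using 1 by (simp add: minus_eq)
  qed
  have "\<not> independent (ring_center R) (map (\<lambda>i. c [^] i) [0..<Suc (r + r)])"
  proof
    assume ind: "independent (ring_center R) (map (\<lambda>i. c [^] i) [0..<Suc (r + r)])"
    have "set (ns @ [\<ominus> \<one>]) \<subseteq> {\<zero>}"
    proof (rule generalized_polynomial_identity[OF ind])
      show "set (ns @ [\<ominus> \<one>]) \<subseteq> carrier R" using ns(1) by auto
      show "length (ns @ [\<ominus> \<one>]) = length (map (\<lambda>i. c [^] i) [0..<Suc (r + r)])" using ns(2) by simp
      show "combine (ns @ [\<ominus> \<one>]) (map ((\<otimes>) u) (map (\<lambda>i. c [^] i) [0..<Suc (r + r)])) = \<zero>"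
        if u: "u \<in> carrier R" for u
        using opoly_combine[OF c u, of "ns @ [\<ominus> \<one>]" 0] rel[OF u] u c ns(2)
        by (simp add: o_def del: upt_Suc)
    qed
    then have "\<ominus> \<one> = \<zero>" by simp
    then show False by (metis one_not_zero minus_minus minus_zero one_closed)
  qed
  then show ?thesis by (rule algebraic_if_dependent_powers[OF c])
qed

end

section \<open>Tangent elements of a normal subgroup\<close>

context ring
begin

lemma horner_monomial: "c \<in> carrier R \<Longrightarrow> f \<in> carrier R \<Longrightarrow> horner (replicate k \<zero> @ [c]) f = f [^] k \<otimes> c"
proof (induction k)
  case (Suc k)
  then show ?case using nat_pow_comm[of f k 1] by (simp add: m_assoc[symmetric])
qed simp

end

section \<open>Inverses of \<open>\<one> \<oplus> f \<otimes> x\<close> with central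
  denominators\<close>

context div_ring
begin

lemma horner_center: "set p \<subseteq> ring_center R \<Longrightarrow> f \<in> ring_center R \<Longrightarrow> horner p f \<in> ring_center R"
  by (induction p) auto

text \<open>After multiplication by a power of \<open>f\<close>, the value \<open>horner P x\<close>
  is a form in \<open>f\<close> and \<open>f \<otimes> x\<close>. Modulo
  \<open>\<one> \<oplus> f \<otimes> x\<close> the latter is \<open>\<ominus> \<one>\<close>, which
  leaves a central polynomial \<open>p\<close> in \<open>f\<close> whose constant coefficient is the
  last coefficient of \<open>P\<close> up to sign.\<close>

lemma one_plus_mult_homogenize:
  assumes "P \<noteq> []" "set P \<subseteq> ring_center R" "last P \<noteq> \<zero>" and x: "x \<in> carrier R"
  shows "\<exists>p q. set p \<subseteq> ring_center R \<and> set q \<subseteq> carrier R \<and> horner p \<zero> \<noteq> \<zero> \<and>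
    (\<forall>f \<in> ring_center R. f [^] (length P - 1) \<otimes> horner P x = horner p f \<oplus> (\<one> \<oplus> f \<otimes> x) \<otimes> horner q f)"
  using assms(1-3)
proof (induction P)
  case (Cons c P)
  show ?case
  proof (cases "P = []")
    case True
    then show ?thesis using Cons.prems x by (intro exI[of _ "[c]"] exI[of _ "[]"]) auto
  next
    case False
    then obtain p q where p: "set p \<subseteq> ring_center R" and q: "set q \<subseteq> carrier R" and p0: "horner p \<zero> \<noteq> \<zero>"
      and pq: "\<And>f. f \<in> ring_center R \<Longrightarrow>
        f [^] (length P - 1) \<otimes> horner P x = horner p f \<oplus> (\<one> \<oplus> f \<otimes> x) \<otimes> horner q f"
      using Cons by auto
    obtain k where k: "length P = Suc k" using False by (cases P) auto
    have P: "set P \<subseteq> carrier R" and c: "c \<in> ring_center R" using Cons.prems by auto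
    have h: "horner P x \<in> carrier R" using P x by simp
    have pR: "set p \<subseteq> carrier R" using p by auto
    \<comment> \<open>With \<open>E = f [^] k \<otimes> horner P x\<close>, the new left side is
      \<open>f [^] Suc k \<otimes> c \<oplus> f \<otimes> x \<otimes> E\<close>. Writing
      \<open>f \<otimes> x\<close> as
      \<open>(\<one> \<oplus> f \<otimes> x) \<ominus> \<one>\<close> and inserting the known
      expression for the subtracted \<open>E\<close> gives \<open>p'\<close> and
      \<open>q'\<close>.\<close>
    define p' where "p' = padd (replicate (Suc k) \<zero> @ [c]) (map (a_inv R) p)"
    define q' where "q' = padd (replicate k \<zero> @ [horner P x]) (map (a_inv R) q)"
    have sets: "set (replicate (Suc k) \<zero> @ [c]) \<subseteq> ring_center R" "set (map (a_inv R) p) \<subseteq> ring_center R"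
      "set (replicate k \<zero> @ [horner P x]) \<subseteq> carrier R" "set (map (a_inv R) q) \<subseteq> carrier R"
      using c p q h by auto
    have setsR: "set (replicate (Suc k) \<zero> @ [c]) \<subseteq> carrier R" "set (map (a_inv R) p) \<subseteq> carrier R"
      using sets(1,2) center_carrier by blast+
    have hp': "horner p' f = f [^] Suc k \<otimes> c \<ominus> horner p f"
      and hq': "horner q' f = f [^] k \<otimes> horner P x \<ominus> horner q f" if "f \<in> carrier R" for f
      unfolding p'_def q'_def using that setsR sets(3,4) pR q h c
      by (simp_all only: horner_padd horner_uminus horner_monomial center_carrier minus_eq)
    have "f [^] (length (c # P) - 1) \<otimes> horner (c # P) x = horner p' f \<oplus> (\<one> \<oplus> f \<otimes> x) \<otimes> horner q' f"
      if f: "f \<in> ring_center R" for f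
    proof -
      define E A B where "E = f [^] k \<otimes> horner P x" and "A = horner p f" and "B = horner q f"
      have fk: "f [^] k \<in> ring_center R" using f by (induction k) auto
      have cs: "E \<in> carrier R" "A \<in> carrier R" "B \<in> carrier R" "f \<in> carrier R" "x \<in> carrier R"
        "f [^] k \<in> carrier R"
        using h fk f pR q x by (simp_all add: E_def A_def B_def)
      have E: "E = A \<oplus> (\<one> \<oplus> f \<otimes> x) \<otimes> B" using pq[OF f] k by (simp add: E_def A_def B_def)
      define G where "G = f [^] Suc k"
      have Gf: "G = f \<otimes> f [^] k" using cs center_commute[OF f, of "f [^] k"] by (simp add: G_def)
      have G: "G \<in> carrier R" "G \<otimes> c \<in> carrier R" using cs c by (simp_all add: Gf)
      have "f [^] k \<otimes> (x \<otimes> horner P x) = x \<otimes> E"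
        unfolding E_def by (rule center_left_commute[OF fk x h, symmetric])
      then have "G \<otimes> (x \<otimes> horner P x) = f \<otimes> x \<otimes> E" using cs h by (simp add: Gf m_assoc)
      then have "G \<otimes> horner (c # P) x = G \<otimes> c \<oplus> f \<otimes> x \<otimes> E"
        using c h x G by (simp add: r_distr)
      also have "\<dots> = G \<otimes> c \<ominus> E \<oplus> (\<one> \<oplus> f \<otimes> x) \<otimes> E"
      proof -
        have "(\<one> \<oplus> f \<otimes> x) \<otimes> E = E \<oplus> f \<otimes> x \<otimes> E" using cs by (simp add: l_distr)
        moreover have "U \<ominus> E \<oplus> (E \<oplus> H) = U \<oplus> H" if "U \<in> carrier R" "H \<in> carrier R" for U H
        proof -
          have "U \<ominus> E \<oplus> (E \<oplus> H) = U \<oplus> (\<ominus> E \<oplus> (E \<oplus> H))"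
            using that cs(1) by (simp only: minus_eq a_assoc add.inv_closed add.m_closed)
          also have "\<ominus> E \<oplus> (E \<oplus> H) = H" using that cs(1) by (metis a_assoc a_inv_closed l_neg l_zero)
          finally show ?thesis .
        qed
        ultimately show ?thesis using G cs by simp
      qed
      also have "\<dots> = G \<otimes> c \<ominus> (A \<oplus> (\<one> \<oplus> f \<otimes> x) \<otimes> B) \<oplus> (\<one> \<oplus> f \<otimes> x) \<otimes> E"
        using arg_cong[OF E, of "\<lambda>e. G \<otimes> c \<ominus> e \<oplus> (\<one> \<oplus> f \<otimes> x) \<otimes> E"] .
      also have "\<dots> = (G \<otimes> c \<ominus> A) \<oplus> (\<one> \<oplus> f \<otimes> x) \<otimes> (E \<ominus> B)"
      proof -
        have "U \<ominus> (A \<oplus> Z \<otimes> B) \<oplus> Z \<otimes> E = (U \<ominus> A) \<oplus> Z \<otimes> (E \<ominus> B)"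
          if "U \<in> carrier R" "Z \<in> carrier R" for U Z
          using that cs(1-3) by algebra
        then show ?thesis using G cs by simp
      qed
      finally show ?thesis using hp'[OF cs(4)] hq'[OF cs(4)] k
        by (simp only: E_def A_def B_def G_def list.size diff_Suc_1 add_Suc_right add_0_right)
    qed
    moreover have "horner p' \<zero> \<noteq> \<zero>"
    proof -
      have "\<zero> [^] Suc k \<otimes> c = \<zero>" using c by simp
      then have "horner p' \<zero> = \<ominus> horner p \<zero>" using hp'[of \<zero>] pR by (simp add: minus_eq del: nat_pow_Suc)
      then show ?thesis using p0 pR by (metis horner_closed minus_minus minus_zero zero_closed)
    qed
    moreover have "set p' \<subseteq> ring_center R" unfolding p'_def
      by (rule set_padd[OF subfieldE(1)[OF subfield_center] sets(1,2)])
    moreover have "set q' \<subseteq> carrier R" unfolding q'_def by (rule set_padd_carrier[OF sets(3,4)])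
    ultimately show ?thesis by blast
  qed
qed simp

text \<open>For a zero \<open>x\<close> of \<open>P\<close> the homogenized identity exhibits a
  right multiple of \<open>\<one> \<oplus> f \<otimes> x\<close> that is a central polynomial in
  \<open>f\<close>. It is scaled to have the value \<open>\<one>\<close> at
  \<open>f = \<zero>\<close>.\<close>

lemma algebraic_inverse_polynomial:
  assumes "algebraic_over_center x" and x: "x \<in> carrier R"
  shows "\<exists>p q. set p \<subseteq> ring_center R \<and> set q \<subseteq> carrier R \<and> horner p \<zero> = \<one> \<and>
    (\<forall>f \<in> ring_center R. (\<one> \<oplus> f \<otimes> x) \<otimes> horner q f = horner p f)"
proof -
  obtain P where P: "set P \<subseteq> ring_center R" "P \<noteq> []" "last P \<noteq> \<zero>" "horner P x = \<zero>"
    using assms(1) by (auto simp: algebraic_over_center_def)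
  obtain p q where p: "set p \<subseteq> ring_center R" and q: "set q \<subseteq> carrier R" and p0: "horner p \<zero> \<noteq> \<zero>"
    and pq: "\<And>f. f \<in> ring_center R \<Longrightarrow>
      f [^] (length P - 1) \<otimes> horner P x = horner p f \<oplus> (\<one> \<oplus> f \<otimes> x) \<otimes> horner q f"
    using one_plus_mult_homogenize[OF P(2,1,3) x] by blast
  define t where "t = inv (horner p \<zero>)"
  have c0: "horner p \<zero> \<in> ring_center R" by (rule horner_center[OF p]) simp
  have t: "t \<in> ring_center R" and t0: "t \<otimes> horner p \<zero> = \<one>" using c0 p0 by (simp_all add: t_def)
  have pR: "set p \<subseteq> carrier R" using p by auto
  have mp: "horner (map ((\<otimes>) s) r) f = s \<otimes> horner r f"
    if "s \<in> ring_center R" "set r \<subseteq> carrier R" "f \<in> carrier R" for s r f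
    using that center_commute[OF that(1,3)] by (intro horner_map_mult) simp_all
  have "(\<one> \<oplus> f \<otimes> x) \<otimes> horner (map ((\<otimes>) (\<ominus> t)) q) f = horner (map ((\<otimes>) t) p) f"
    if f: "f \<in> ring_center R" for f
  proof -
    define z where "z = (\<one> \<oplus> f \<otimes> x) \<otimes> horner q f"
    have zR: "z \<in> carrier R" "horner p f \<in> carrier R" using f x q pR by (simp_all add: z_def)
    have "horner p f \<oplus> z = \<zero>" using pq[OF f] f P(4) by (simp add: z_def)
    then have z: "horner p f = \<ominus> z" using zR by (simp add: minus_equality)
    have "(\<one> \<oplus> f \<otimes> x) \<otimes> (\<ominus> t \<otimes> horner q f) = \<ominus> t \<otimes> z"
      unfolding z_def by (rule center_left_commute) (use t f x q in auto)
    then show ?thesis using mp[of "\<ominus> t" q f] mp[of t p f] t q pR f z zR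
      by (simp add: l_minus r_minus)
  qed
  moreover have "horner (map ((\<otimes>) t) p) \<zero> = \<one>" using mp[of t p \<zero>] t pR t0 by simp
  moreover have "set (map ((\<otimes>) t) p) \<subseteq> ring_center R" "set (map ((\<otimes>) (\<ominus> t)) q) \<subseteq> carrier R"
    using t p q by auto
  ultimately show ?thesis by blast
qed

end

context self_centralizing
begin

lemma linop_id: "linop (\<lambda>u. u)"
  by (simp add: linop_def)

lemma linop_plus:
  assumes "linop S" "linop T" shows "linop (\<lambda>u. S u \<oplus> T u)"
  unfolding linop_def
proof (intro conjI ballI)
  fix u v assume uv: "u \<in> carrier R" "v \<in> carrier R"
  show "S u \<oplus> T u \<in> carrier R" using assms uv by simp
  show "S (u \<oplus> v) \<oplus> T (u \<oplus> v) = S u \<oplus> T u \<oplus> (S v \<oplus> T v)"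
    using assms uv by (simp add: linop_add a_ac)
next
  fix l u assume "l \<in> L" "u \<in> carrier R"
  then show "S (l \<otimes> u) \<oplus> T (l \<otimes> u) = l \<otimes> (S u \<oplus> T u)"
    using assms by (simp add: linop_smult r_distr)
qed

lemma linop_scale:
  assumes "l \<in> L" "linop S" shows "linop (\<lambda>u. l \<otimes> S u)"
proof -
  have "l \<otimes> (m \<otimes> S u) = m \<otimes> (l \<otimes> S u)" if "m \<in> L" "u \<in> carrier R" for m u
    using that assms by (simp add: m_assoc[symmetric] L_commute)
  then show ?thesis using assms by (simp add: linop_def r_distr)
qed

end

section \<open>Curves in the normal subgroup and their tangents\<close>

locale bounded_normal_units = self_centralizing R L + normal_units R N
  for R (structure) and L N +
  fixes d :: nat
  assumes infinite_center: "infinite (ring_center R)"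
    and N_bounded: "a \<in> N \<Longrightarrow> locally_bounded d (\<lambda>u. u \<otimes> a)"
begin

text \<open>The quotient equals \<open>(z \<otimes> a \<otimes> inv z) \<otimes> inv a\<close>. Only
  \<open>a\<close> has to lie in \<open>N\<close>; \<open>z\<close> is an arbitrary unit, which
  leaves room for a free parameter.\<close>

lemma commutator_quotient:
  assumes z: "z \<in> carrier R" "z \<noteq> \<zero>" and a: "a \<in> N"
  shows "z \<otimes> inv (a \<otimes> z \<otimes> inv a) \<in> N"
proof -
  have "z \<otimes> inv (a \<otimes> z \<otimes> inv a) = (z \<otimes> a \<otimes> inv z) \<otimes> inv a"
    using z a by (simp add: inv_mult' mult_eq_zero_iff m_assoc)
  then show ?thesis using N_mult[OF N_conj[OF z a] N_inv[OF a]] by simp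
qed

text \<open>With \<open>z = \<one> \<oplus> f \<otimes> y\<close> and \<open>w\<close> the commutator of \<open>z\<close> and \<open>b\<close>, the element
  \<open>f \<otimes> inv (w \<ominus> \<one>) = (\<one> \<oplus> f \<otimes> y') \<otimes> inv (y \<ominus> y')\<close> is a polynomial in \<open>f\<close>, so that the bound
  survives the specialization \<open>f = \<zero>\<close>.\<close>
lemma algebraic_conj_difference:
  assumes b: "b \<in> N" and y: "y \<in> carrier R"
  shows "algebraic_over_center (y \<ominus> b \<otimes> y \<otimes> inv b)"
proof -
  define y' where "y' = b \<otimes> y \<otimes> inv b"
  define \<delta> where "\<delta> = y \<ominus> y'"
  have y': "y' \<in> carrier R" using b y by (simp add: y'_def)
  have \<delta>: "\<delta> \<in> carrier R" using y y' by (simp add: \<delta>_def)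
  have "algebraic_over_center \<delta>"
  proof (cases "\<delta> = \<zero>")
    case True
    then show ?thesis unfolding algebraic_over_center_def
      by (intro exI[of _ "[\<zero>, \<one>]"]) (use one_not_zero in auto)
  next
    case False
    define q where "q = [inv \<delta>, y' \<otimes> inv \<delta>]"
    have q: "set q \<subseteq> carrier R" using \<delta> False y' by (simp add: q_def)
    have hq: "horner q f = (\<one> \<oplus> f \<otimes> y') \<otimes> inv \<delta>" if "f \<in> ring_center R" for f
      using that \<delta> False y' by (simp add: q_def l_distr m_assoc)
    have bd: "locally_bounded d (\<lambda>u. u \<otimes> horner q f)"
      if f: "f \<in> ring_center R" "f \<noteq> \<zero>" "\<one> \<oplus> f \<otimes> y \<noteq> \<zero>" for f
    proof -
      define z z' where "z = \<one> \<oplus> f \<otimes> y" and "z' = \<one> \<oplus> f \<otimes> y'"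
      have z: "z \<in> carrier R" "z \<noteq> \<zero>" and z'R: "z' \<in> carrier R" using f y y' by (simp_all add: z_def z'_def)
      have z': "z' = b \<otimes> z \<otimes> inv b"
        using b y f center_left_commute[OF f(1), of b] by (simp add: z_def z'_def y'_def r_distr l_distr m_assoc)
      have z'0: "z' \<noteq> \<zero>" using z b unfolding z' by (simp add: mult_eq_zero_iff)
      define w where "w = z \<otimes> inv z'"
      have w: "w \<in> N" unfolding w_def z' by (rule commutator_quotient[OF z b])
      define g where "g = horner q f"
      have g: "g = z' \<otimes> inv \<delta>" using hq[OF f(1)] by (simp add: g_def z'_def)
      have gR: "g \<in> carrier R" using g z'R \<delta> False by simp
      have zz: "z = z' \<oplus> f \<otimes> \<delta>"
      proof -
        have "f \<in> carrier R" using f by simp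
        then show ?thesis using y y' unfolding z_def z'_def \<delta>_def by algebra
      qed
      have gw: "g \<otimes> w = g \<oplus> f"
      proof -
        have "g \<otimes> w = g \<otimes> (z' \<otimes> inv z' \<oplus> f \<otimes> \<delta> \<otimes> inv z')"
          using z'R z'0 \<delta> f unfolding w_def zz by (simp add: l_distr)
        also have "\<dots> = g \<oplus> g \<otimes> (f \<otimes> (\<delta> \<otimes> inv z'))"
          using z'R z'0 \<delta> f gR by (simp add: r_distr m_assoc)
        also have "g \<otimes> (f \<otimes> (\<delta> \<otimes> inv z')) = f \<otimes> (g \<otimes> (\<delta> \<otimes> inv z'))"
          by (rule center_left_commute) (use f gR \<delta> z'R z'0 in auto)
        also have "g \<otimes> (\<delta> \<otimes> inv z') = \<one>"
          using \<delta> False z'R z'0 unfolding g by (simp add: m_assoc)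
        finally show ?thesis using f by simp
      qed
      \<comment> \<open>This is right multiplication by
        \<open>inv f \<otimes> (w \<ominus> \<one>)\<close>, written as an affine change of right
        multiplication by \<open>w\<close>. It inverts right multiplication by
        \<open>horner q f\<close>.\<close>
      define S where "S u = inv f \<otimes> (u \<otimes> w) \<oplus> (\<ominus> (inv f)) \<otimes> u" for u
      have fi: "inv f \<in> ring_center R" using f by simp
      have S: "linop S" unfolding S_def
        by (intro linop_plus linop_scale linop_right_mult linop_id) (use fi w in auto)
      have "locally_bounded d S"
        by (rule locally_bounded_affine[OF linop_right_mult N_bounded[OF w] S, where l = "inv f" and m = "\<ominus> (inv f)"])
          (use w fi S_def in auto)
      then show ?thesis
      proof (rule locally_bounded_inverse[OF S])
        show "linop (\<lambda>u. u \<otimes> horner q f)" by (rule linop_right_mult) (use gR g_def in simp)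
        fix u assume u: "u \<in> carrier R"
        have "S (u \<otimes> g) = inv f \<otimes> (u \<otimes> (g \<otimes> w)) \<oplus> (\<ominus> (inv f)) \<otimes> (u \<otimes> g)"
          using u gR w by (simp add: S_def m_assoc)
        also have "\<dots> = inv f \<otimes> (u \<otimes> f)"
        proof -
          have "inv f \<in> carrier R" "f \<in> carrier R" using fi f by auto
          then show ?thesis unfolding gw using u gR by algebra
        qed
        also have "\<dots> = u" using u f center_commute[OF f(1) u] by simp
        finally show "S (u \<otimes> horner q f) = u" by (simp add: g_def)
      qed
    qed
    have "finite {f \<in> ring_center R. \<one> \<oplus> f \<otimes> y = \<zero>}"
    proof -
      have "{f \<in> ring_center R. \<one> \<oplus> f \<otimes> y = \<zero>} \<subseteq> {\<ominus> (inv y)}"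
      proof
        fix f assume "f \<in> {f \<in> ring_center R. \<one> \<oplus> f \<otimes> y = \<zero>}"
        then have f: "f \<in> carrier R" "\<one> \<oplus> f \<otimes> y = \<zero>" by auto
        then have fy: "f \<otimes> y = \<ominus> \<one>" using y by (metis add.m_comm m_closed minus_equality minus_minus one_closed)
        have "y \<noteq> \<zero>" using f one_not_zero by auto
        then have "f = f \<otimes> y \<otimes> inv y" using f y by simp
        also have "\<dots> = \<ominus> (inv y)" using fy y \<open>y \<noteq> \<zero>\<close> by (simp add: l_minus)
        finally show "f \<in> {\<ominus> (inv y)}" by simp
      qed
      then show ?thesis by (meson finite.emptyI finite.insertI finite_subset)
    qed
    then have "finite ({f \<in> ring_center R. \<one> \<oplus> f \<otimes> y = \<zero>} \<union> {\<zero>})" by simp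
    then have "infinite (ring_center R - ({f \<in> ring_center R. \<one> \<oplus> f \<otimes> y = \<zero>} \<union> {\<zero>}))"
      using infinite_center by (rule Diff_infinite_finite)
    moreover have "ring_center R - ({f \<in> ring_center R. \<one> \<oplus> f \<otimes> y = \<zero>} \<union> {\<zero>}) \<subseteq>
        {f \<in> ring_center R. locally_bounded d (\<lambda>u. u \<otimes> horner q f)}" using bd by auto
    ultimately have "infinite {f \<in> ring_center R. locally_bounded d (\<lambda>u. u \<otimes> horner q f)}"
      using infinite_super by blast
    then have "locally_bounded d (\<lambda>u. u \<otimes> horner q \<zero>)" by (rule locally_bounded_horner[OF q])
    moreover have "horner q \<zero> = inv \<delta>" using hq[of \<zero>] \<delta> False y' by simp
    ultimately have "locally_bounded d (\<lambda>u. u \<otimes> inv \<delta>)" by simp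
    then have "locally_bounded d (\<lambda>u. u \<otimes> \<delta>)"
      by (rule locally_bounded_inverse[rotated]) (use \<delta> False in \<open>auto intro!: linop_right_mult\<close>)
    then show ?thesis by (rule algebraic_if_locally_bounded[OF \<delta> _ infinite_center])
  qed
  then show ?thesis by (simp add: \<delta>_def y'_def)
qed

text \<open>The velocities at \<open>f = \<zero>\<close> of curves \<open>\<one> \<oplus> f \<otimes> q(f) / p(f)\<close> in \<open>N\<close>.\<close>
definition tangent :: "'a \<Rightarrow> bool" where
  "tangent c \<longleftrightarrow> (\<exists>p q. set p \<subseteq> ring_center R \<and> set q \<subseteq> carrier R \<and> horner p \<zero> = \<one> \<and> horner q \<zero> = c \<and>
    (\<forall>f \<in> ring_center R. horner p f \<noteq> \<zero> \<longrightarrow>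
      (\<exists>w \<in> N. horner p f \<otimes> w = horner p f \<oplus> f \<otimes> horner q f)))"

lemma tangent_carrier: "tangent c \<Longrightarrow> c \<in> carrier R"
  by (auto simp: tangent_def)

text \<open>Curves are multiplied pointwise. Because the denominators are central, the product of
  \<open>(A \<oplus> f \<otimes> B) / A\<close> and \<open>(A' \<oplus> f \<otimes> B') / A'\<close>
  is again of this shape, with denominator \<open>A \<otimes> A'\<close> and velocity polynomial
  \<open>Q\<close>; at \<open>f = \<zero>\<close> the velocities add up.\<close>

lemma tangent_add:
  assumes "tangent c" "tangent c'"
  shows "tangent (c \<oplus> c')"
proof -
  obtain p q where p: "set p \<subseteq> ring_center R" "set q \<subseteq> carrier R" "horner p \<zero> = \<one>" "horner q \<zero> = c"
    "\<And>f. f \<in> ring_center R \<Longrightarrow> horner p f \<noteq> \<zero> \<Longrightarrow> \<exists>w \<in> N. horner p f \<otimes> w = horner p f \<oplus> f \<otimes> horner q f"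
    using assms(1) by (auto simp: tangent_def)
  obtain p' q' where p': "set p' \<subseteq> ring_center R" "set q' \<subseteq> carrier R" "horner p' \<zero> = \<one>" "horner q' \<zero> = c'"
    "\<And>f. f \<in> ring_center R \<Longrightarrow> horner p' f \<noteq> \<zero> \<Longrightarrow> \<exists>w \<in> N. horner p' f \<otimes> w = horner p' f \<oplus> f \<otimes> horner q' f"
    using assms(2) by (auto simp: tangent_def)
  have pR: "set p \<subseteq> carrier R" "set p' \<subseteq> carrier R" using p(1) p'(1) by auto
  have mul: "horner (pmul r s) f = horner r f \<otimes> horner s f"
    if "set r \<subseteq> carrier R" "set s \<subseteq> carrier R" "f \<in> ring_center R" for r s f
    by (rule horner_pmul) (use that center_commute[OF that(3)] in auto)
  define q1 q2 q3 where "q1 = pmul q p'" and "q2 = pmul p q'" and "q3 = pmul q q'"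
  have q123: "set q1 \<subseteq> carrier R" "set q2 \<subseteq> carrier R" "set q3 \<subseteq> carrier R"
    unfolding q1_def q2_def q3_def using p p' pR by (auto intro!: set_pmul_carrier[THEN subsetD])
  define Q where "Q = padd (padd q1 q2) (\<zero> # q3)"
  have Q: "set Q \<subseteq> carrier R" unfolding Q_def using q123 by (intro set_padd_carrier) auto
  have hQ: "horner Q f = horner q f \<otimes> horner p' f \<oplus> horner p f \<otimes> horner q' f \<oplus> f \<otimes> (horner q f \<otimes> horner q' f)"
    if f: "f \<in> ring_center R" for f
  proof -
    have "set (padd q1 q2) \<subseteq> carrier R" by (rule set_padd_carrier[OF q123(1,2)])
    then have "horner Q f = horner q1 f \<oplus> horner q2 f \<oplus> f \<otimes> horner q3 f"
      using q123 f by (simp add: Q_def horner_padd)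
    then show ?thesis using mul[OF _ _ f] p p' pR by (simp add: q1_def q2_def q3_def)
  qed
  have P: "set (pmul p p') \<subseteq> ring_center R"
    by (rule set_pmul[OF subfieldE(1)[OF subfield_center] p(1) p'(1)])
  have "\<exists>w \<in> N. horner (pmul p p') f \<otimes> w = horner (pmul p p') f \<oplus> f \<otimes> horner Q f"
    if f: "f \<in> ring_center R" and nz: "horner (pmul p p') f \<noteq> \<zero>" for f
  proof -
    define A A' B B' where "A = horner p f" and "A' = horner p' f" and "B = horner q f" and "B' = horner q' f"
    have AC: "A \<in> ring_center R" "A' \<in> ring_center R"
      using horner_center p(1) p'(1) f by (auto simp: A_def A'_def)
    have BR: "B \<in> carrier R" "B' \<in> carrier R" using p(2) p'(2) f by (auto simp: B_def B'_def)
    have AA: "horner (pmul p p') f = A \<otimes> A'" unfolding A_def A'_def by (rule mul[OF pR f])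
    then have "A \<noteq> \<zero>" "A' \<noteq> \<zero>" using nz AC by (auto simp: mult_eq_zero_iff)
    then obtain w w' where w: "w \<in> N" "A \<otimes> w = A \<oplus> f \<otimes> B" "w' \<in> N" "A' \<otimes> w' = A' \<oplus> f \<otimes> B'"
      using p(5)[OF f] p'(5)[OF f] unfolding A_def A'_def B_def B'_def by blast
    have c: "A \<in> carrier R" "A' \<in> carrier R" "f \<in> carrier R" "w \<in> carrier R" "w' \<in> carrier R" using AC f w by auto
    have "A \<otimes> A' \<otimes> (w \<otimes> w') = (A \<otimes> w) \<otimes> (A' \<otimes> w')"
      using c center_left_commute[OF AC(2) c(4,5)] by (simp add: m_assoc)
    also have "\<dots> = (A \<oplus> f \<otimes> B) \<otimes> (A' \<oplus> f \<otimes> B')" by (simp add: w)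
    also have "\<dots> = A \<otimes> A' \<oplus> (f \<otimes> B \<otimes> A' \<oplus> A \<otimes> (f \<otimes> B') \<oplus> f \<otimes> B \<otimes> (f \<otimes> B'))"
      using c BR by algebra
    also have "A \<otimes> (f \<otimes> B') = f \<otimes> (A \<otimes> B')" by (rule center_left_commute[OF f c(1) BR(2)])
    also have "f \<otimes> B \<otimes> (f \<otimes> B') = f \<otimes> (f \<otimes> (B \<otimes> B'))"
      using c BR center_left_commute[OF f BR] by (simp add: m_assoc)
    also have "f \<otimes> B \<otimes> A' \<oplus> f \<otimes> (A \<otimes> B') \<oplus> f \<otimes> (f \<otimes> (B \<otimes> B')) = f \<otimes> horner Q f"
      unfolding hQ[OF f] A_def[symmetric] A'_def[symmetric] B_def[symmetric] B'_def[symmetric]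
      using c BR by (simp add: r_distr m_assoc)
    finally show ?thesis unfolding AA using N_mult[OF w(1,3)] by blast
  qed
  moreover have "horner (pmul p p') \<zero> = \<one>" using mul[OF pR, of \<zero>] p(3) p'(3) by simp
  moreover have "horner Q \<zero> = c \<oplus> c'" using hQ[of \<zero>] p p' by (simp, auto)
  ultimately show ?thesis unfolding tangent_def using P Q by blast
qed

text \<open>For \<open>f \<noteq> \<zero>\<close>, \<open>horner q f\<close> is a central multiple
  of \<open>w \<ominus> \<one>\<close> with \<open>w\<close> in \<open>N\<close>, so its right
  multiplication is bounded. Only zero and the finitely many zeros of \<open>p\<close> are excluded,
  and \<open>f = \<zero>\<close> is reached by specialization.\<close>

lemma tangent_bounded:
  assumes "tangent c"
  shows "locally_bounded d (\<lambda>u. u \<otimes> c)"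
proof -
  obtain p q where p: "set p \<subseteq> ring_center R" "set q \<subseteq> carrier R" "horner p \<zero> = \<one>" "horner q \<zero> = c"
    "\<And>f. f \<in> ring_center R \<Longrightarrow> horner p f \<noteq> \<zero> \<Longrightarrow> \<exists>w \<in> N. horner p f \<otimes> w = horner p f \<oplus> f \<otimes> horner q f"
    using assms(1) by (auto simp: tangent_def)
  have bd: "locally_bounded d (\<lambda>u. u \<otimes> horner q f)"
    if f: "f \<in> ring_center R" "f \<noteq> \<zero>" "horner p f \<noteq> \<zero>" for f
  proof -
    define A B where "A = horner p f" and "B = horner q f"
    have A: "A \<in> ring_center R" unfolding A_def by (rule horner_center[OF p(1) f(1)])
    have B: "B \<in> carrier R" using p(2) f(1) by (simp add: B_def)
    obtain w where w: "w \<in> N" "A \<otimes> w = A \<oplus> f \<otimes> B" using p(5)[OF f(1,3)] unfolding A_def B_def by blast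
    have fi: "inv f \<in> ring_center R" using f by simp
    have c: "A \<in> carrier R" "f \<in> carrier R" "w \<in> carrier R" "inv f \<in> carrier R" using A f w fi by auto
    have "f \<otimes> B = A \<otimes> w \<ominus> A" unfolding w(2) using c B by algebra
    then have "inv f \<otimes> (f \<otimes> B) = inv f \<otimes> (A \<otimes> w \<ominus> A)" by simp
    then have Beq: "B = inv f \<otimes> (A \<otimes> w \<ominus> A)" using f B by simp
    have "u \<otimes> B = (inv f \<otimes> A) \<otimes> (u \<otimes> w) \<oplus> (\<ominus> (inv f \<otimes> A)) \<otimes> u" if u: "u \<in> carrier R" for u
    proof -
      have "u \<otimes> (inv f \<otimes> A \<otimes> w) = inv f \<otimes> A \<otimes> (u \<otimes> w)"
        by (rule center_left_commute) (use fi A u w in auto)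
      moreover have "u \<otimes> (inv f \<otimes> A) = inv f \<otimes> A \<otimes> u"
        by (rule center_commute) (use fi A u in auto)
      moreover have "u \<otimes> B = u \<otimes> (inv f \<otimes> A \<otimes> w) \<ominus> u \<otimes> (inv f \<otimes> A)"
        unfolding Beq using c u by algebra
      ultimately show ?thesis using c u by (simp add: minus_eq l_minus)
    qed
    then show ?thesis unfolding B_def[symmetric]
      by (intro locally_bounded_affine[OF linop_right_mult N_bounded[OF w(1)],
            where l = "inv f \<otimes> A" and m = "\<ominus> (inv f \<otimes> A)"]
          linop_right_mult) (use w fi A B in auto)
  qed
  have pL: "set p \<subseteq> L" using p(1) by auto
  have "finite {f \<in> L. horner p f = \<zero>}"
    by (rule finite_horner_zeros[OF pL L_closed(1)]) (use p(3) one_not_zero in simp)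
  then have "finite ({f \<in> L. horner p f = \<zero>} \<union> {\<zero>})" by simp
  then have "infinite (ring_center R - ({f \<in> L. horner p f = \<zero>} \<union> {\<zero>}))"
    using infinite_center by (rule Diff_infinite_finite)
  moreover have "ring_center R - ({f \<in> L. horner p f = \<zero>} \<union> {\<zero>}) \<subseteq>
      {f \<in> ring_center R. locally_bounded d (\<lambda>u. u \<otimes> horner q f)}" using bd by auto
  ultimately have "infinite {f \<in> ring_center R. locally_bounded d (\<lambda>u. u \<otimes> horner q f)}"
    using infinite_super by blast
  then show ?thesis using locally_bounded_horner[OF p(2)] p(4) by simp
qed

text \<open>The curve consists of the commutators of \<open>\<one> \<oplus> f \<otimes> x\<close>
  with \<open>a\<close>, which equal \<open>\<one> \<oplus> f \<otimes> (x \<ominus> x') \<otimes>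
  inv z'\<close>. Algebraicity of the conjugate \<open>x'\<close> gives \<open>inv z'\<close> a
  central denominator.\<close>

lemma tangent_conj_difference:
  assumes x: "algebraic_over_center x" "x \<in> carrier R" and a: "a \<in> N"
  shows "tangent (x \<ominus> a \<otimes> x \<otimes> inv a)"
proof -
  define x' where "x' = a \<otimes> x \<otimes> inv a"
  have x': "x' \<in> carrier R" "algebraic_over_center x'"
    using algebraic_conj[OF x N_carrier[OF a] N_nonzero[OF a]] a x by (simp_all add: x'_def)
  obtain p q where p: "set p \<subseteq> ring_center R" "set q \<subseteq> carrier R" "horner p \<zero> = \<one>"
    "\<And>f. f \<in> ring_center R \<Longrightarrow> (\<one> \<oplus> f \<otimes> x') \<otimes> horner q f = horner p f"
    using algebraic_inverse_polynomial[OF x'(2,1)] by blast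
  define Q where "Q = map ((\<otimes>) (x \<ominus> x')) q"
  have Q: "set Q \<subseteq> carrier R" using p(2) x x' by (auto simp: Q_def)
  have hQ: "horner Q f = (x \<ominus> x') \<otimes> horner q f" if "f \<in> ring_center R" for f
    unfolding Q_def using p(2) x(2) x' that by (intro horner_map_mult) (auto simp: center_commute)
  have "\<exists>w \<in> N. horner p f \<otimes> w = horner p f \<oplus> f \<otimes> horner Q f"
    if f: "f \<in> ring_center R" and nz: "horner p f \<noteq> \<zero>" for f
  proof -
    define z z' where "z = \<one> \<oplus> f \<otimes> x" and "z' = \<one> \<oplus> f \<otimes> x'"
    define A B where "A = horner p f" and "B = horner q f"
    have AC: "A \<in> ring_center R" unfolding A_def by (rule horner_center[OF p(1) f])
    have c: "z \<in> carrier R" "z' \<in> carrier R" "A \<in> carrier R" "B \<in> carrier R" "f \<in> carrier R"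
      using f x x' p AC by (auto simp: z_def z'_def B_def)
    have zB: "z' \<otimes> B = A" using p(4)[OF f] by (simp add: z'_def A_def B_def)
    have "z' \<noteq> \<zero>" using zB nz c by (auto simp: A_def)
    have z': "z' = a \<otimes> z \<otimes> inv a"
      using a x f center_left_commute[OF f, of a] by (simp add: z_def z'_def x'_def r_distr l_distr m_assoc)
    have z0: "z \<noteq> \<zero>"
    proof
      assume "z = \<zero>"
      then have "z' = \<zero>" using z' a by simp
      with \<open>z' \<noteq> \<zero>\<close> show False ..
    qed
    define w where "w = z \<otimes> inv z'"
    have w: "w \<in> N" unfolding w_def z' by (rule commutator_quotient[OF c(1) z0 a])
    have "A \<otimes> w = z \<otimes> (inv z' \<otimes> A)"
      using center_commute[OF AC, of w] w c \<open>z' \<noteq> \<zero>\<close> by (simp add: w_def m_assoc)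
    also have "inv z' \<otimes> A = B" using zB c \<open>z' \<noteq> \<zero>\<close> by (metis inv_cancel_left(1))
    also have "z \<otimes> B = z' \<otimes> B \<oplus> f \<otimes> ((x \<ominus> x') \<otimes> B)"
      using c x(2) x'(1) unfolding z_def z'_def by algebra
    finally have "A \<otimes> w = A \<oplus> f \<otimes> horner Q f" using zB hQ[OF f] by (simp add: B_def)
    then show ?thesis using w by (auto simp: A_def)
  qed
  moreover have "horner Q \<zero> = x \<ominus> x'"
  proof -
    have "horner q \<zero> = \<one>" using p(4)[of \<zero>] p(2,3) x' by simp
    then show ?thesis using hQ[of \<zero>] x x' by simp
  qed
  ultimately show ?thesis unfolding tangent_def x'_def[symmetric] using p Q by blast
qed

text \<open>The inner difference \<open>x\<close> is algebraic over the center by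
  \<open>algebraic_conj_difference\<close>, as the outer difference needs in
  \<open>tangent_conj_difference\<close>. Since \<open>y\<close> is free, central multiples are
  again of this form.\<close>

definition double_differences :: "'a set" where
  "double_differences = {x \<ominus> a \<otimes> x \<otimes> inv a | x a b y. a \<in> N \<and> b \<in> N \<and> y \<in> carrier R \<and> x = y \<ominus> b \<otimes> y \<otimes> inv b}"

lemma double_difference_carrier: "c \<in> double_differences \<Longrightarrow> c \<in> carrier R"
  by (auto simp: double_differences_def)

lemma double_difference_tangent:
  assumes c: "c \<in> double_differences" and f: "f \<in> ring_center R"
  shows "tangent (f \<otimes> c)"
proof -
  obtain a b y where ab: "a \<in> N" "b \<in> N" "y \<in> carrier R"
    "c = (y \<ominus> b \<otimes> y \<otimes> inv b) \<ominus> a \<otimes> (y \<ominus> b \<otimes> y \<otimes> inv b) \<otimes> inv a"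
    using c by (auto simp: double_differences_def)
  have sc: "f \<otimes> (x \<ominus> a \<otimes> x \<otimes> inv a) = f \<otimes> x \<ominus> a \<otimes> (f \<otimes> x) \<otimes> inv a"
    if "a \<in> N" "x \<in> carrier R" for a x
    using that f center_left_commute[OF f, of a] by (simp add: minus_eq r_distr r_minus m_assoc)
  have "y \<ominus> b \<otimes> y \<otimes> inv b \<in> carrier R" using ab by simp
  then have "f \<otimes> c = (f \<otimes> y \<ominus> b \<otimes> (f \<otimes> y) \<otimes> inv b) \<ominus> a \<otimes> (f \<otimes> y \<ominus> b \<otimes> (f \<otimes> y) \<otimes> inv b) \<otimes> inv a"
    unfolding ab(4) by (simp only: sc[OF ab(1)] sc[OF ab(2,3)])
  moreover have "tangent \<dots>"
    by (rule tangent_conj_difference[OF algebraic_conj_difference]) (use ab f in auto)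
  ultimately show ?thesis by simp
qed

lemma linop_lsum:
  assumes "\<And>l c. (l, c) \<in> set ps \<Longrightarrow> l \<in> L \<and> c \<in> carrier R"
  shows "linop (\<lambda>u. lsum (\<lambda>(l, c). l \<otimes> (u \<otimes> c)) ps)"
  using assms
proof (induction ps)
  case Nil
  then show ?case by (simp add: linop_def)
next
  case (Cons p ps)
  obtain l c where p: "p = (l, c)" by (cases p)
  have l: "l \<in> L" and c: "c \<in> carrier R" using Cons.prems[of l c] p by auto
  have "linop (\<lambda>u. lsum (\<lambda>(l, c). l \<otimes> (u \<otimes> c)) ps)" using Cons by auto
  then have "linop (\<lambda>u. l \<otimes> (u \<otimes> c) \<oplus> lsum (\<lambda>(l, c). l \<otimes> (u \<otimes> c)) ps)"
    by (intro linop_plus linop_scale linop_right_mult l c)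
  then show ?case by (simp add: p)
qed

text \<open>The scalars are released from the center to L one at a time. While a scalar is still
  central, its term is tangent and can be absorbed into \<open>c0\<close>, to which the induction
  hypothesis applies; this is why a tangent summand is carried along.\<close>

lemma lsum_double_differences_bounded:
  assumes "\<And>l c. (l, c) \<in> set ps \<Longrightarrow> l \<in> L \<and> c \<in> double_differences" and "tangent c0"
  shows "locally_bounded d (\<lambda>u. lsum (\<lambda>(l, c). l \<otimes> (u \<otimes> c)) ps \<oplus> u \<otimes> c0)"
  using assms
proof (induction ps arbitrary: c0)
  case Nil
  note c0 = tangent_carrier[OF Nil(2)]
  show ?case
    by (rule locally_bounded_affine[OF linop_right_mult[OF c0] tangent_bounded[OF Nil(2)], where l = \<one> and m = \<zero>])
      (use c0 in \<open>auto simp: linop_def l_distr m_assoc\<close>)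
next
  case (Cons p ps)
  obtain l c where p: "p = (l, c)" by (cases p)
  note c0 = tangent_carrier[OF Cons.prems(2)]
  have l: "l \<in> L" and c: "c \<in> double_differences" using Cons.prems(1)[of l c] p by auto
  note cR = double_difference_carrier[OF c]
  let ?S = "\<lambda>u. lsum (\<lambda>(l, c). l \<otimes> (u \<otimes> c)) ps"
  have S: "linop ?S" by (rule linop_lsum) (use Cons.prems(1) double_difference_carrier in auto)
  have S0: "linop (\<lambda>u. ?S u \<oplus> u \<otimes> c0)" by (intro linop_plus S linop_right_mult c0)
  have aff: "linop (\<lambda>u. ?S u \<oplus> u \<otimes> c0 \<oplus> k \<otimes> (u \<otimes> c))" if k: "k \<in> L" for k
    by (intro linop_plus linop_scale S linop_right_mult c0 cR k)
  have "locally_bounded d (\<lambda>u. ?S u \<oplus> u \<otimes> c0 \<oplus> l \<otimes> (u \<otimes> c))"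
  proof (rule locally_bounded_extend_scalar[OF S0 cR l infinite_center])
    fix f assume f: "f \<in> ring_center R"
    have t: "tangent (c0 \<oplus> f \<otimes> c)"
      by (rule tangent_add[OF Cons.prems(2) double_difference_tangent[OF c f]])
    have "locally_bounded d (\<lambda>u. ?S u \<oplus> u \<otimes> (c0 \<oplus> f \<otimes> c))"
      by (rule Cons.IH[OF _ t]) (use Cons.prems(1) in auto)
    then show "locally_bounded d (\<lambda>u. ?S u \<oplus> u \<otimes> c0 \<oplus> f \<otimes> (u \<otimes> c))"
    proof (rule locally_bounded_affine[rotated, OF _ aff, where l = \<one> and m = \<zero>])
      have fc: "c0 \<oplus> f \<otimes> c \<in> carrier R" using c0 cR f by simp
      show "linop (\<lambda>u. ?S u \<oplus> u \<otimes> (c0 \<oplus> f \<otimes> c))" by (intro linop_plus S linop_right_mult fc)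
      fix u assume u: "u \<in> carrier R"
      have "u \<otimes> (f \<otimes> c) = f \<otimes> (u \<otimes> c)" by (rule center_left_commute[OF f u cR])
      then show "?S u \<oplus> u \<otimes> c0 \<oplus> f \<otimes> (u \<otimes> c) = \<one> \<otimes> (?S u \<oplus> u \<otimes> (c0 \<oplus> f \<otimes> c)) \<oplus> \<zero> \<otimes> u"
        using linop_closed[OF S u] u f c0 cR by (simp add: r_distr a_assoc)
    qed (use f in auto)
  qed
  then show ?case
  proof (rule locally_bounded_affine[OF aff[OF l], where l = \<one> and m = \<zero>])
    have "linop (\<lambda>u. l \<otimes> (u \<otimes> c) \<oplus> ?S u \<oplus> u \<otimes> c0)"
      by (intro linop_plus linop_scale S linop_right_mult c0 cR l)
    then show "linop (\<lambda>u. lsum (\<lambda>(l, c). l \<otimes> (u \<otimes> c)) (p # ps) \<oplus> u \<otimes> c0)" by (simp add: p)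
    show "lsum (\<lambda>(l, c). l \<otimes> (u \<otimes> c)) (p # ps) \<oplus> u \<otimes> c0 =
        \<one> \<otimes> (?S u \<oplus> u \<otimes> c0 \<oplus> l \<otimes> (u \<otimes> c)) \<oplus> \<zero> \<otimes> u" if u: "u \<in> carrier R" for u
      using linop_closed[OF S u] u l c0 cR by (simp add: p a_ac)
  qed auto
qed

end

section \<open>The trace form\<close>

context self_centralizing
begin

lemma lsum_eq_combine:
  "lsum (\<lambda>(\<psi>, g). \<psi> u \<otimes> g) qs = combine (map (\<lambda>(\<psi>, g). \<psi> u) qs) (map snd qs)"
  by (induction qs) auto

lemma functional_add_scaled:
  assumes "functional \<psi>" "functional \<chi>" "k \<in> L"
  shows "functional (\<lambda>u. \<chi> u \<oplus> k \<otimes> \<psi> u)"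
  unfolding functional_def
proof
  show "linop (\<lambda>u. \<chi> u \<oplus> k \<otimes> \<psi> u)"
    by (intro linop_plus linop_scale functional_linop assms)
qed (use assms in simp)

text \<open>The first sum is the trace of \<open>u \<mapsto> Z(u) \<otimes> y\<close> and the second one is \<open>Z(u)\<close>, where \<open>Z\<close> is the
  operator of finite rank given by \<open>ps\<close>.\<close>
theorem trace_zero_iff:
  assumes "\<And>\<psi> g. (\<psi>, g) \<in> set ps \<Longrightarrow> functional \<psi> \<and> g \<in> carrier R"
  shows "(\<forall>y \<in> carrier R. lsum (\<lambda>(\<psi>, g). \<psi> (g \<otimes> y)) ps = \<zero>) \<longleftrightarrow>
         (\<forall>u \<in> carrier R. lsum (\<lambda>(\<psi>, g). \<psi> u \<otimes> g) ps = \<zero>)"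
  using assms
proof (induction "length ps" arbitrary: ps rule: less_induct)
  case less
  show ?case
  proof (cases ps)
    case (Cons p qs)
    obtain \<psi> g where p: "p = (\<psi>, g)" by (cases p)
    have \<psi>: "functional \<psi>" and g: "g \<in> carrier R"
      using less.prems[of \<psi> g] Cons p by auto
    have qs: "functional \<chi> \<and> h \<in> carrier R" if "(\<chi>, h) \<in> set qs" for \<chi> h
      using less.prems[of \<chi> h] that Cons by auto
    have len: "length qs < length ps" using Cons by simp
    define tr where "tr qs y = lsum (\<lambda>(\<psi>, g). \<psi> (g \<otimes> y)) qs" for qs :: "(('a \<Rightarrow> 'a) \<times> 'a) list" and y
    define Z where "Z qs u = lsum (\<lambda>(\<psi>, g). \<psi> u \<otimes> g) qs" for qs :: "(('a \<Rightarrow> 'a) \<times> 'a) list" and u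
    have trps: "tr ps y = \<psi> (g \<otimes> y) \<oplus> tr qs y" and Zps: "Z ps u = \<psi> u \<otimes> g \<oplus> Z qs u" for y u
      by (simp_all add: tr_def Z_def Cons p)
    have trR: "tr qs y \<in> carrier R" and ZR: "Z qs y \<in> carrier R" if y: "y \<in> carrier R" for y
      unfolding tr_def Z_def using qs y by (auto intro!: lsum_closed)
    have IH: "(\<forall>y \<in> carrier R. tr rs y = \<zero>) \<longleftrightarrow> (\<forall>u \<in> carrier R. Z rs u = \<zero>)"
      if "length rs = length qs" "\<And>\<chi> h. (\<chi>, h) \<in> set rs \<Longrightarrow> functional \<chi> \<and> h \<in> carrier R" for rs
      using less.hyps[of rs] len that unfolding tr_def Z_def by simp
    have hs: "set (map snd qs) \<subseteq> carrier R" using qs by auto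
    have ZSpan: "Z qs u \<in> Span L (map snd qs)" if "u \<in> carrier R" for u
      unfolding Z_def lsum_eq_combine
      by (rule combine_in_Span[OF subfield_L hs]) (use qs that in auto)
    have "(\<forall>y \<in> carrier R. tr ps y = \<zero>) \<longleftrightarrow> (\<forall>u \<in> carrier R. Z ps u = \<zero>)"
    proof (cases "g \<in> Span L (map snd qs)")
      case True
      then obtain Ks where Ks: "set Ks \<subseteq> L" "length Ks = length qs" "g = combine Ks (map snd qs)"
        using Span_mem_iff_length_version[OF subfield_L hs] by auto
      \<comment> \<open>If \<open>g\<close> depends on the other vectors, its term is distributed
        over them by changing their functionals. Neither the operator nor the traces change, and one
        pair is saved.\<close>
      define add where "add k q = (case q of (\<chi>, h) \<Rightarrow> (\<lambda>u. \<chi> u \<oplus> k \<otimes> \<psi> u, h))" for k :: 'a and q :: "('a \<Rightarrow> 'a) \<times> 'a"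
      define rs where "rs = map2 add Ks qs"
      have rs: "functional \<chi> \<and> h \<in> carrier R" if "(\<chi>, h) \<in> set rs" for \<chi> h
      proof -
        have "(\<chi>, h) \<in> (\<lambda>(k, q). add k q) ` set (zip Ks qs)" using that by (simp add: rs_def)
        then obtain x where x: "x \<in> set (zip Ks qs)" "(\<chi>, h) = (\<lambda>(k, q). add k q) x" by blast
        obtain k q where "x = (k, q)" by (cases x)
        with x have kq: "(k, q) \<in> set (zip Ks qs)" "(\<chi>, h) = add k q" by simp_all
        obtain \<chi>' h' where q: "q = (\<chi>', h')" by (cases q)
        then have "k \<in> L" "(\<chi>', h') \<in> set qs"
          using Ks(1) kq(1) by (auto dest: set_zip_leftD set_zip_rightD)
        moreover have "\<chi> = (\<lambda>u. \<chi>' u \<oplus> k \<otimes> \<psi> u)" "h = h'" using kq(2) by (simp_all add: add_def q)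
        ultimately show ?thesis using qs functional_add_scaled[OF \<psi>] by auto
      qed
      have trc: "tr (map2 add Ks qs) y = tr qs y \<oplus> \<psi> (combine Ks (map snd qs) \<otimes> y)"
        if y: "y \<in> carrier R" and "length Ks = length qs" "set Ks \<subseteq> L"
          "\<And>\<chi> h. (\<chi>, h) \<in> set qs \<Longrightarrow> functional \<chi> \<and> h \<in> carrier R" for y Ks qs
        using that(2-4)
      proof (induction Ks qs rule: list_induct2)
        case Nil
        show ?case using linop_zero[OF functional_linop[OF \<psi>]] y by (simp add: tr_def)
      next
        case (Cons k Ks q qs)
        obtain \<chi> h where q: "q = (\<chi>, h)" by (cases q)
        have k: "k \<in> L" "set Ks \<subseteq> L" "set Ks \<subseteq> carrier R" using Cons.prems by auto
        have q': "functional \<chi>" "h \<in> carrier R"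
          and qs': "\<And>\<chi> h. (\<chi>, h) \<in> set qs \<Longrightarrow> functional \<chi> \<and> h \<in> carrier R"
          using Cons.prems(2) q by auto
        define C where "C = combine Ks (map snd qs)"
        have C: "C \<in> carrier R" unfolding C_def using k qs' by (intro combine_in_carrier) auto
        have tqs: "tr qs y \<in> carrier R" unfolding tr_def using qs' y by (auto intro!: lsum_closed)
        have IH': "tr (map2 add Ks qs) y = tr qs y \<oplus> \<psi> (C \<otimes> y)"
          unfolding C_def by (rule Cons.IH[OF k(2) qs'])
        have hy: "h \<otimes> y \<in> carrier R" "C \<otimes> y \<in> carrier R" using q' C y by auto
        have "(k \<otimes> h \<oplus> C) \<otimes> y = k \<otimes> (h \<otimes> y) \<oplus> C \<otimes> y" using k q' C y by (simp add: l_distr m_assoc)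
        then have psi: "\<psi> ((k \<otimes> h \<oplus> C) \<otimes> y) = k \<otimes> \<psi> (h \<otimes> y) \<oplus> \<psi> (C \<otimes> y)"
          using linop_add[OF functional_linop[OF \<psi>], of "k \<otimes> (h \<otimes> y)" "C \<otimes> y"]
            linop_smult[OF functional_linop[OF \<psi>] k(1) hy(1)] hy k(1) by simp
        have "tr (map2 add (k # Ks) (q # qs)) y = \<chi> (h \<otimes> y) \<oplus> k \<otimes> \<psi> (h \<otimes> y) \<oplus> (tr qs y \<oplus> \<psi> (C \<otimes> y))"
          using IH' by (simp add: tr_def add_def q)
        also have "\<dots> = (\<chi> (h \<otimes> y) \<oplus> tr qs y) \<oplus> (k \<otimes> \<psi> (h \<otimes> y) \<oplus> \<psi> (C \<otimes> y))"
          using tqs L_carrier[OF functional_L[OF q'(1) hy(1)]] L_carrier[OF functional_L[OF \<psi> hy(1)]]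
            L_carrier[OF functional_L[OF \<psi> hy(2)]] k(1) by (simp add: a_ac)
        finally show ?case by (simp add: psi C_def[symmetric] tr_def q)
      qed
      have Zc: "Z (map2 add Ks qs) y = Z qs y \<oplus> \<psi> y \<otimes> combine Ks (map snd qs)"
        if y: "y \<in> carrier R" and "length Ks = length qs" "set Ks \<subseteq> L"
          "\<And>\<chi> h. (\<chi>, h) \<in> set qs \<Longrightarrow> functional \<chi> \<and> h \<in> carrier R" for y Ks qs
        using that(2-4)
      proof (induction Ks qs rule: list_induct2)
        case Nil
        show ?case using L_carrier[OF functional_L[OF \<psi> y]] by (simp add: Z_def)
      next
        case (Cons k Ks q qs)
        obtain \<chi> h where q: "q = (\<chi>, h)" by (cases q)
        have k: "k \<in> L" "set Ks \<subseteq> L" "set Ks \<subseteq> carrier R" using Cons.prems by auto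
        have q': "functional \<chi>" "h \<in> carrier R"
          and qs': "\<And>\<chi> h. (\<chi>, h) \<in> set qs \<Longrightarrow> functional \<chi> \<and> h \<in> carrier R"
          using Cons.prems(2) q by auto
        define C where "C = combine Ks (map snd qs)"
        have C: "C \<in> carrier R" unfolding C_def using k qs' by (intro combine_in_carrier) auto
        have Zqs: "Z qs y \<in> carrier R" unfolding Z_def using qs' y by (auto intro!: lsum_closed)
        have IH': "Z (map2 add Ks qs) y = Z qs y \<oplus> \<psi> y \<otimes> C"
          unfolding C_def by (rule Cons.IH[OF k(2) qs'])
        have py: "\<psi> y \<in> L" "\<chi> y \<in> L" using \<psi> q' y by simp_all
        have "k \<otimes> \<psi> y = \<psi> y \<otimes> k" by (rule L_commute[OF k(1) py(1)])
        have "Z (map2 add (k # Ks) (q # qs)) y = (\<chi> y \<oplus> k \<otimes> \<psi> y) \<otimes> h \<oplus> (Z qs y \<oplus> \<psi> y \<otimes> C)"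
          using IH' by (simp add: Z_def add_def q)
        also have "\<dots> = (\<chi> y \<otimes> h \<oplus> Z qs y) \<oplus> \<psi> y \<otimes> (k \<otimes> h \<oplus> C)"
          unfolding \<open>k \<otimes> \<psi> y = _\<close> using Zqs py k(1) q'(2) C by (simp add: l_distr r_distr m_assoc a_ac)
        finally show ?case by (simp add: C_def Z_def q)
      qed
      have "tr rs y = tr ps y" if "y \<in> carrier R" for y
        using trc[OF that Ks(2,1) qs] trR[OF that] L_carrier[OF functional_L[OF \<psi>]] g that
        by (simp add: rs_def trps Ks(3)[symmetric] a_comm)
      moreover have "Z rs y = Z ps y" if "y \<in> carrier R" for y
        using Zc[OF that Ks(2,1) qs] ZR[OF that] L_carrier[OF functional_L[OF \<psi> that]] g that
        by (simp add: rs_def Zps Ks(3)[symmetric] a_comm)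
      moreover have "(\<forall>y \<in> carrier R. tr rs y = \<zero>) \<longleftrightarrow> (\<forall>u \<in> carrier R. Z rs u = \<zero>)"
        by (rule IH) (use Ks(2) rs in \<open>simp_all add: rs_def\<close>)
      ultimately show ?thesis by simp
    next
      case False
      have g0: "g \<noteq> \<zero>" using False Span_closed(2)[OF hs] by auto
      have gi: "inv g \<in> carrier R" using g g0 by simp
      show ?thesis
      proof
        assume tr0: "\<forall>y \<in> carrier R. tr ps y = \<zero>"
        \<comment> \<open>Replacing \<open>y\<close> by \<open>inv g \<otimes> y\<close> expresses
          \<open>\<psi>\<close> through the remaining pairs.\<close>
        have rel: "tr qs (inv g \<otimes> y) = \<ominus> \<psi> y" if y: "y \<in> carrier R" for y
        proof -
          have "\<psi> y \<oplus> tr qs (inv g \<otimes> y) = \<zero>"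
            using tr0[rule_format, of "inv g \<otimes> y"] trps[of "inv g \<otimes> y"] g g0 gi y by simp
          then show ?thesis using trR[of "inv g \<otimes> y"] L_carrier[OF functional_L[OF \<psi> y]] gi y
            by (metis a_comm m_closed minus_equality)
        qed
        \<comment> \<open>The L-linearity of \<open>\<psi>\<close>, read through \<open>rel\<close>,
          says that the equally short list \<open>rs\<close> has zero trace against every
          \<open>y\<close>. By induction its operator vanishes, so
          \<open>Z qs u \<otimes> inv g\<close> commutes with each \<open>l\<close>, and L is its
          own centralizer.\<close>
        have Zc: "Z qs u \<otimes> inv g \<in> L" if u: "u \<in> carrier R" for u
        proof (rule in_L_if_commute)
          show "Z qs u \<otimes> inv g \<in> carrier R" using ZR[OF u] gi by simp
          fix l assume l: "l \<in> L"
          define rs where "rs = map (\<lambda>(\<chi>, h). (\<chi>, h \<otimes> inv g \<otimes> l \<ominus> l \<otimes> (h \<otimes> inv g))) qs"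
          have rs: "functional \<chi> \<and> h \<in> carrier R" if "(\<chi>, h) \<in> set rs" for \<chi> h
            using that qs gi l by (auto simp: rs_def)
          have "tr rs y = \<zero>" if y: "y \<in> carrier R" for y
          proof -
            have "tr rs y = lsum (\<lambda>(\<chi>, h). \<chi> (h \<otimes> (inv g \<otimes> (l \<otimes> y))) \<ominus> l \<otimes> \<chi> (h \<otimes> (inv g \<otimes> y))) qs"
              unfolding tr_def rs_def lsum_map
            proof (rule lsum_cong, clarify)
              fix \<chi> h assume "(\<chi>, h) \<in> set qs"
              then have \<chi>: "functional \<chi>" and h: "h \<in> carrier R" using qs by auto
              have "(h \<otimes> inv g \<otimes> l \<ominus> l \<otimes> (h \<otimes> inv g)) \<otimes> y = h \<otimes> (inv g \<otimes> (l \<otimes> y)) \<ominus> l \<otimes> (h \<otimes> (inv g \<otimes> y))"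
                using h gi l y by (simp add: minus_eq l_distr l_minus m_assoc)
              then show "\<chi> ((h \<otimes> inv g \<otimes> l \<ominus> l \<otimes> (h \<otimes> inv g)) \<otimes> y) =
                  \<chi> (h \<otimes> (inv g \<otimes> (l \<otimes> y))) \<ominus> l \<otimes> \<chi> (h \<otimes> (inv g \<otimes> y))"
                using linop_minus[OF functional_linop[OF \<chi>]] linop_smult[OF functional_linop[OF \<chi>] l] h gi l y by simp
            qed
            also have "\<dots> = lsum (\<lambda>q. (case q of (\<chi>, h) \<Rightarrow> \<chi> (h \<otimes> (inv g \<otimes> (l \<otimes> y)))) \<ominus>
                (case q of (\<chi>, h) \<Rightarrow> l \<otimes> \<chi> (h \<otimes> (inv g \<otimes> y)))) qs"
              by (rule lsum_cong) auto
            also have "\<dots> = lsum (\<lambda>(\<chi>, h). \<chi> (h \<otimes> (inv g \<otimes> (l \<otimes> y)))) qs \<ominus>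
                lsum (\<lambda>(\<chi>, h). l \<otimes> \<chi> (h \<otimes> (inv g \<otimes> y))) qs"
              by (rule lsum_minus) (use qs gi l y in \<open>auto simp: case_prod_beta\<close>)
            also have "lsum (\<lambda>(\<chi>, h). l \<otimes> \<chi> (h \<otimes> (inv g \<otimes> y))) qs =
                lsum (\<lambda>q. l \<otimes> (case q of (\<chi>, h) \<Rightarrow> \<chi> (h \<otimes> (inv g \<otimes> y)))) qs"
              by (rule lsum_cong) auto
            also have "lsum (\<lambda>q. l \<otimes> (case q of (\<chi>, h) \<Rightarrow> \<chi> (h \<otimes> (inv g \<otimes> y)))) qs = l \<otimes> tr qs (inv g \<otimes> y)"
              unfolding tr_def by (rule lsum_mult_left) (use qs gi l y in auto)
            also have "lsum (\<lambda>(\<chi>, h). \<chi> (h \<otimes> (inv g \<otimes> (l \<otimes> y)))) qs = tr qs (inv g \<otimes> (l \<otimes> y))"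
              by (simp only: tr_def)
            also have "tr qs (inv g \<otimes> (l \<otimes> y)) \<ominus> l \<otimes> tr qs (inv g \<otimes> y) = \<zero>"
              using rel[of "l \<otimes> y"] rel[OF y] linop_smult[OF functional_linop[OF \<psi>] l y] l y
                L_carrier[OF functional_L[OF \<psi> y]]
              by (simp add: minus_eq r_minus l_neg)
            finally show ?thesis .
          qed
          moreover have "(\<forall>y \<in> carrier R. tr rs y = \<zero>) \<longleftrightarrow> (\<forall>u \<in> carrier R. Z rs u = \<zero>)"
            by (rule IH) (use rs in \<open>simp_all add: rs_def\<close>)
          ultimately have "Z rs u = \<zero>" using u by simp
          moreover have "Z rs u = Z qs u \<otimes> (inv g \<otimes> l) \<ominus> l \<otimes> (Z qs u \<otimes> inv g)"
          proof -
            have "Z rs u = lsum (\<lambda>q. (case q of (\<chi>, h) \<Rightarrow> \<chi> u \<otimes> h) \<otimes> (inv g \<otimes> l) \<ominus>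
                l \<otimes> ((case q of (\<chi>, h) \<Rightarrow> \<chi> u \<otimes> h) \<otimes> inv g)) qs"
              unfolding Z_def rs_def lsum_map
            proof (rule lsum_cong, clarify)
              fix \<chi> h assume "(\<chi>, h) \<in> set qs"
              then have \<chi>: "\<chi> u \<in> L" and h: "h \<in> carrier R" using qs u by auto
              have "\<chi> u \<otimes> (l \<otimes> (h \<otimes> inv g)) = l \<otimes> (\<chi> u \<otimes> (h \<otimes> inv g))"
                using \<chi> h l gi L_commute[OF \<chi> l] by (simp add: m_assoc[symmetric])
              then show "\<chi> u \<otimes> (h \<otimes> inv g \<otimes> l \<ominus> l \<otimes> (h \<otimes> inv g)) =
                  \<chi> u \<otimes> h \<otimes> (inv g \<otimes> l) \<ominus> l \<otimes> (\<chi> u \<otimes> h \<otimes> inv g)"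
                using \<chi> h l gi by (simp add: minus_eq r_distr r_minus m_assoc)
            qed
            also have "\<dots> = lsum (\<lambda>q. (case q of (\<chi>, h) \<Rightarrow> \<chi> u \<otimes> h) \<otimes> (inv g \<otimes> l)) qs \<ominus>
                lsum (\<lambda>q. l \<otimes> ((case q of (\<chi>, h) \<Rightarrow> \<chi> u \<otimes> h) \<otimes> inv g)) qs"
              by (rule lsum_minus) (use qs gi l u in \<open>auto simp: case_prod_beta\<close>)
            also have "lsum (\<lambda>q. l \<otimes> ((case q of (\<chi>, h) \<Rightarrow> \<chi> u \<otimes> h) \<otimes> inv g)) qs =
                l \<otimes> lsum (\<lambda>q. (case q of (\<chi>, h) \<Rightarrow> \<chi> u \<otimes> h) \<otimes> inv g) qs"
              by (rule lsum_mult_left) (use qs gi l u in auto)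
            also have "lsum (\<lambda>q. (case q of (\<chi>, h) \<Rightarrow> \<chi> u \<otimes> h) \<otimes> inv g) qs = Z qs u \<otimes> inv g"
              unfolding Z_def by (rule lsum_mult_right) (use qs gi l u in auto)
            also have "lsum (\<lambda>q. (case q of (\<chi>, h) \<Rightarrow> \<chi> u \<otimes> h) \<otimes> (inv g \<otimes> l)) qs = Z qs u \<otimes> (inv g \<otimes> l)"
              unfolding Z_def by (rule lsum_mult_right) (use qs gi l u in auto)
            finally show ?thesis .
          qed
          ultimately show "Z qs u \<otimes> inv g \<otimes> l = l \<otimes> (Z qs u \<otimes> inv g)"
            using ZR[OF u] gi l by (simp add: m_assoc)
        qed
        \<comment> \<open>\<open>Z qs u\<close> is both a multiple of \<open>g\<close> and in the
          span of the other vectors, which does not contain \<open>g\<close>.\<close>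
        have Z0: "Z qs u = \<zero>" if u: "u \<in> carrier R" for u
        proof (rule ccontr)
          assume nz: "Z qs u \<noteq> \<zero>"
          define k where "k = Z qs u \<otimes> inv g"
          have k: "k \<in> L" "k \<noteq> \<zero>" using Zc[OF u] nz ZR[OF u] g g0 by (auto simp: k_def mult_eq_zero_iff)
          have "k \<otimes> g = Z qs u" using ZR[OF u] g g0 by (simp add: k_def)
          then have "g = inv k \<otimes> Z qs u" using k g by (metis inv_cancel_left(1) L_carrier)
          then have "g \<in> Span L (map snd qs)" using Span_closed(6)[OF hs L_inv[OF k] ZSpan[OF u]] by simp
          then show False using False by simp
        qed
        then have tq: "\<forall>y \<in> carrier R. tr qs y = \<zero>" using IH[of qs] qs by blast
        have "\<psi> u = \<zero>" if u: "u \<in> carrier R" for u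
          using rel[OF u] tq gi u L_carrier[OF functional_L[OF \<psi> u]]
          by (metis m_closed minus_minus minus_zero)
        then show "\<forall>u \<in> carrier R. Z ps u = \<zero>" using Z0 g by (simp add: Zps)
      next
        assume Zz: "\<forall>u \<in> carrier R. Z ps u = \<zero>"
        have \<psi>0: "\<psi> u = \<zero>" if u: "u \<in> carrier R" for u
        proof (rule ccontr)
          assume nz: "\<psi> u \<noteq> \<zero>"
          have \<psi>u: "\<psi> u \<in> L" using \<psi> u by simp
          have "\<psi> u \<otimes> g \<oplus> Z qs u = \<zero>" using Zz u Zps by simp
          then have "\<psi> u \<otimes> g = \<ominus> Z qs u" using ZR[OF u] g \<psi>u by (simp add: minus_equality)
          then have "\<psi> u \<otimes> g \<in> Span L (map snd qs)" using Span_closed(4)[OF hs ZSpan[OF u]] by simp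
          then have "inv (\<psi> u) \<otimes> (\<psi> u \<otimes> g) \<in> Span L (map snd qs)"
            using Span_closed(6)[OF hs L_inv[OF \<psi>u nz]] by simp
          then show False using False nz \<psi>u g by simp
        qed
        then have "\<forall>u \<in> carrier R. Z qs u = \<zero>" using Zz Zps ZR g by simp
        then have "\<forall>y \<in> carrier R. tr qs y = \<zero>" using IH[of qs] qs by blast
        then show "\<forall>y \<in> carrier R. tr ps y = \<zero>" using \<psi>0 g by (simp add: trps)
      qed
    qed
    then show ?thesis by (simp only: tr_def Z_def)
  qed simp
qed

section \<open>The bound for the dimension\<close>

text \<open>The elements whose right multiplication commutes with \<open>\<Delta>\<close> form a
  division subring containing all conjugates of \<open>a\<close>, hence all of D by
  \<open>cartan_brauer_hua\<close>. Then \<open>\<Delta> u = \<Delta> \<one> \<otimes> u\<close>,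
  and L-linearity makes \<open>\<Delta> \<one>\<close> commute with L.\<close>

lemma scalar_if_commuting:
  assumes \<Delta>: "linop \<Delta>" and a: "a \<in> carrier R" "a \<notin> ring_center R"
    and comm: "\<And>z u. z \<in> carrier R \<Longrightarrow> z \<noteq> \<zero> \<Longrightarrow> u \<in> carrier R \<Longrightarrow>
      \<Delta> (u \<otimes> (z \<otimes> a \<otimes> inv z)) = \<Delta> u \<otimes> (z \<otimes> a \<otimes> inv z)"
  shows "\<exists>c \<in> L. \<forall>u \<in> carrier R. \<Delta> u = c \<otimes> u"
proof -
  define S where "S = {s \<in> carrier R. \<forall>u \<in> carrier R. \<Delta> (u \<otimes> s) = \<Delta> u \<otimes> s}"
  have "S = carrier R"
  proof (rule cartan_brauer_hua[of S a])
    show "S \<subseteq> carrier R" by (auto simp: S_def)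
    show "x \<ominus> y \<in> S" if "x \<in> S" "y \<in> S" for x y
    proof -
      have xy: "x \<in> carrier R" "y \<in> carrier R" using that by (auto simp: S_def)
      have "\<Delta> (u \<otimes> (x \<ominus> y)) = \<Delta> u \<otimes> (x \<ominus> y)" if u: "u \<in> carrier R" for u
      proof -
        have dist: "v \<otimes> (x \<ominus> y) = v \<otimes> x \<ominus> v \<otimes> y" if "v \<in> carrier R" for v
          using that xy by (simp add: minus_eq r_distr r_minus)
        show ?thesis using \<open>x \<in> S\<close> \<open>y \<in> S\<close> u xy \<Delta>
          by (simp add: dist linop_minus S_def)
      qed
      then show ?thesis using xy by (simp add: S_def)
    qed
    show "x \<otimes> y \<in> S" if "x \<in> S" "y \<in> S" for x y
    proof -
      have xy: "x \<in> carrier R" "y \<in> carrier R" using that by (auto simp: S_def)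
      have "\<Delta> (u \<otimes> (x \<otimes> y)) = \<Delta> u \<otimes> (x \<otimes> y)" if u: "u \<in> carrier R" for u
      proof -
        have "\<Delta> (u \<otimes> (x \<otimes> y)) = \<Delta> (u \<otimes> x \<otimes> y)" using xy u by (simp add: m_assoc)
        also have "\<dots> = \<Delta> u \<otimes> x \<otimes> y" using \<open>x \<in> S\<close> \<open>y \<in> S\<close> xy u by (simp add: S_def)
        finally show ?thesis using xy u \<Delta> by (simp add: m_assoc)
      qed
      then show ?thesis using xy by (simp add: S_def)
    qed
    show "inv x \<in> S" if x: "x \<in> S" "x \<noteq> \<zero>" for x
    proof -
      have xR: "x \<in> carrier R" using x by (simp add: S_def)
      have "\<Delta> (u \<otimes> inv x) = \<Delta> u \<otimes> inv x" if u: "u \<in> carrier R" for u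
      proof -
        have "\<forall>v \<in> carrier R. \<Delta> (v \<otimes> x) = \<Delta> v \<otimes> x" using x unfolding S_def by blast
        then have "\<Delta> (u \<otimes> inv x) \<otimes> x = \<Delta> (u \<otimes> inv x \<otimes> x)"
          using bspec[of _ _ "u \<otimes> inv x"] x xR u by (metis inv_closed' m_closed)
        also have "\<dots> = \<Delta> u" using x xR u by simp
        finally have "\<Delta> (u \<otimes> inv x) \<otimes> x \<otimes> inv x = \<Delta> u \<otimes> inv x" by simp
        then show ?thesis using x xR u \<Delta> by simp
      qed
      then show ?thesis using x xR by (simp add: S_def)
    qed
    show "z \<otimes> a \<otimes> inv z \<in> S" if "z \<in> carrier R" "z \<noteq> \<zero>" for z
      using comm[OF that] that a(1) by (simp add: S_def)
  qed (rule a)+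
  then have \<Delta>1: "\<Delta> u = \<Delta> \<one> \<otimes> u" if "u \<in> carrier R" for u
  proof -
    have "u \<in> S" using that \<open>S = carrier R\<close> by simp
    then have "\<Delta> (\<one> \<otimes> u) = \<Delta> \<one> \<otimes> u" unfolding S_def by blast
    then show ?thesis using that by simp
  qed
  have "\<Delta> \<one> \<in> L"
  proof (rule in_L_if_commute)
    show "\<Delta> \<one> \<otimes> l = l \<otimes> \<Delta> \<one>" if "l \<in> L" for l
      using \<Delta>1[of l] linop_smult[OF \<Delta> that, of \<one>] that by simp
  qed (use \<Delta> in simp)
  then show ?thesis using \<Delta>1 by blast
qed

lemma linop_compose:
  assumes "linop S" "linop T" shows "linop (\<lambda>u. S (T u))"
  unfolding linop_def
proof (intro conjI ballI)
  fix u v assume uv: "u \<in> carrier R" "v \<in> carrier R"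
  show "S (T u) \<in> carrier R" using assms uv by simp
  show "S (T (u \<oplus> v)) = S (T u) \<oplus> S (T v)"
    unfolding linop_add[OF assms(2) uv] by (rule linop_add) (use assms uv in auto)
next
  fix l u assume lu: "l \<in> L" "u \<in> carrier R"
  show "S (T (l \<otimes> u)) = l \<otimes> S (T u)"
    unfolding linop_smult[OF assms(2) lu] by (rule linop_smult) (use assms lu in auto)
qed

lemma functional_compose:
  assumes "functional \<phi>" "linop T" shows "functional (\<lambda>u. \<phi> (T u))"
  unfolding functional_def
proof
  show "linop (\<lambda>u. \<phi> (T u))" by (rule linop_compose[OF functional_linop[OF assms(1)] assms(2)])
qed (use assms in auto)

lemma linop_lsum':
  "(\<And>x. x \<in> set xs \<Longrightarrow> linop (F x)) \<Longrightarrow> linop (\<lambda>u. lsum (\<lambda>x. F x u) xs)"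
proof (induction xs)
  case (Cons x xs)
  have "linop (\<lambda>u. F x u \<oplus> lsum (\<lambda>x. F x u) xs)" by (rule linop_plus) (use Cons in auto)
  then show ?case by simp
qed (simp add: linop_def)

lemma lsum_in_Span:
  "set Us \<subseteq> carrier R \<Longrightarrow> (\<And>x. x \<in> set xs \<Longrightarrow> f x \<in> Span L Us) \<Longrightarrow> lsum f xs \<in> Span L Us"
  by (induction xs) (simp_all add: Span_closed(2,3) del: Span.simps)

lemma lsum_append4:
  assumes "\<And>i. i \<in> set xs \<Longrightarrow> f (A i) \<in> carrier R \<and> f (B i) \<in> carrier R \<and> f (C i) \<in> carrier R \<and> f (D i) \<in> carrier R"
  shows "lsum f (map A xs @ map B xs @ map C xs @ map D xs) =
    lsum (\<lambda>i. f (A i) \<oplus> (f (B i) \<oplus> (f (C i) \<oplus> f (D i)))) xs"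
  using assms by (subst lsum_append lsum_add, force)+ (simp add: lsum_map)

lemma functional_uminus:
  assumes "functional \<phi>" shows "functional (\<lambda>u. \<ominus> \<phi> u)"
  unfolding functional_def
proof
  have "linop (\<lambda>u. \<ominus> \<one> \<otimes> \<phi> u)" by (intro linop_scale functional_linop assms) simp
  moreover have "\<ominus> \<one> \<otimes> \<phi> u = \<ominus> \<phi> u" if "u \<in> carrier R" for u
    using assms that by (simp add: l_minus)
  ultimately show "linop (\<lambda>u. \<ominus> \<phi> u)" by (simp add: linop_def)
qed (use assms in simp)

end

context bounded_normal_units
begin

text \<open>If the operator \<open>Y\<close> is orthogonal, for the trace form, to right multiplication by all double
  differences, then each \<open>u \<mapsto> Y(u \<otimes> a) \<ominus> Y(u) \<otimes> a\<close> is a scalar multiple of right multiplication by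
  \<open>a\<close>. These scalars are additive in \<open>a\<close>, so that \<open>Y\<close> commutes with commutators.\<close>
lemma scalar_if_orthogonal:
  assumes nc: "\<not> N \<subseteq> ring_center R" and Y: "linop Y"
    and rel: "\<And>a b u. a \<in> N \<Longrightarrow> b \<in> N \<Longrightarrow> u \<in> carrier R \<Longrightarrow>
      Y u \<ominus> Y (u \<otimes> inv b) \<otimes> b \<ominus> Y (u \<otimes> inv a) \<otimes> a \<oplus> Y (u \<otimes> inv b \<otimes> inv a) \<otimes> a \<otimes> b = \<zero>"
  shows "\<exists>c \<in> L. \<forall>u \<in> carrier R. Y u = c \<otimes> u"
proof -
  obtain b0 where b0: "b0 \<in> N" "b0 \<notin> ring_center R" using nc by blast
  have ex: "\<exists>k \<in> L. \<forall>u \<in> carrier R. Y (u \<otimes> a) = Y u \<otimes> a \<oplus> k \<otimes> (u \<otimes> a)" if a: "a \<in> N" for a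
  proof -
    define \<Delta> where "\<Delta> u = Y u \<oplus> (\<ominus> \<one>) \<otimes> (Y (u \<otimes> inv a) \<otimes> a)" for u
    have aR: "a \<in> carrier R" "inv a \<in> carrier R" using a by auto
    have Ya: "linop (\<lambda>u. Y (u \<otimes> inv a) \<otimes> a)"
      using Y linop_right_mult[OF aR(1)] linop_right_mult[OF aR(2)] by (auto simp: linop_def)
    have \<Delta>: "linop \<Delta>" unfolding \<Delta>_def by (intro linop_plus linop_scale Y Ya) simp
    have \<Delta>': "\<Delta> u = Y u \<ominus> Y (u \<otimes> inv a) \<otimes> a" if "u \<in> carrier R" for u
      using that Y aR by (simp add: \<Delta>_def minus_eq l_minus)
    have comm: "\<Delta> (u \<otimes> b) = \<Delta> u \<otimes> b" if b: "b \<in> N" and u: "u \<in> carrier R" for b u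
    proof -
      define A B C D where "A = Y (u \<otimes> b)" and "B = Y u" and "C = Y (u \<otimes> b \<otimes> inv a)" and "D = Y (u \<otimes> inv a)"
      have ABCD: "A \<in> carrier R" "B \<in> carrier R" "C \<in> carrier R" "D \<in> carrier R"
        using Y u b aR by (simp_all add: A_def B_def C_def D_def)
      \<comment> \<open>Taken at \<open>u \<otimes> b\<close>, the hypothesis says precisely that
        the defect \<open>\<Delta>\<close> commutes with right multiplication by
        \<open>b\<close>.\<close>
      have r: "A \<ominus> B \<otimes> b \<ominus> C \<otimes> a \<oplus> D \<otimes> a \<otimes> b = \<zero>"
        using rel[OF a b, of "u \<otimes> b"] u b by (simp add: A_def B_def C_def D_def)
      have "\<Delta> (u \<otimes> b) = (A \<ominus> B \<otimes> b \<ominus> C \<otimes> a \<oplus> D \<otimes> a \<otimes> b) \<oplus> (B \<ominus> D \<otimes> a) \<otimes> b"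
      proof -
        have "\<Delta> (u \<otimes> b) = A \<ominus> C \<otimes> a" using \<Delta>'[of "u \<otimes> b"] u b by (simp add: A_def C_def)
        also have "\<dots> = (A \<ominus> B \<otimes> b \<ominus> C \<otimes> a \<oplus> D \<otimes> a \<otimes> b) \<oplus> (B \<ominus> D \<otimes> a) \<otimes> b"
          using ABCD aR(1) N_carrier[OF b] by algebra
        finally show ?thesis .
      qed
      also have "\<dots> = (B \<ominus> D \<otimes> a) \<otimes> b" unfolding r using ABCD aR b by simp
      finally show ?thesis using \<Delta>'[OF u] by (simp add: B_def D_def)
    qed
    obtain k where k: "k \<in> L" "\<And>u. u \<in> carrier R \<Longrightarrow> \<Delta> u = k \<otimes> u"
      using scalar_if_commuting[OF \<Delta> N_carrier[OF b0(1)] b0(2)] comm N_conj b0(1) by blast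
    have "Y (u \<otimes> a) = Y u \<otimes> a \<oplus> k \<otimes> (u \<otimes> a)" if u: "u \<in> carrier R" for u
    proof -
      have YR: "Y (u \<otimes> a) \<in> carrier R" "Y u \<otimes> a \<in> carrier R" using Y u aR by auto
      have "k \<otimes> (u \<otimes> a) = Y (u \<otimes> a) \<ominus> Y u \<otimes> a"
        using k(2)[of "u \<otimes> a"] \<Delta>'[of "u \<otimes> a"] u a by simp
      then have "Y u \<otimes> a \<oplus> k \<otimes> (u \<otimes> a) = Y u \<otimes> a \<oplus> (Y (u \<otimes> a) \<ominus> Y u \<otimes> a)" by simp
      also have "\<dots> = Y (u \<otimes> a)" using YR by (metis a_comm add.inv_closed minus_eq r_neg2 a_assoc l_neg r_zero a_closed)
      finally show ?thesis by simp
    qed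
    then show ?thesis using k(1) by blast
  qed
  have comm: "Y (u \<otimes> (a \<otimes> b \<otimes> inv a \<otimes> inv b)) = Y u \<otimes> (a \<otimes> b \<otimes> inv a \<otimes> inv b)"
    if a: "a \<in> N" and b: "b \<in> N" and u: "u \<in> carrier R" for a b u
  proof -
    obtain k where k: "k \<in> L" "\<And>u. u \<in> carrier R \<Longrightarrow> Y (u \<otimes> a) = Y u \<otimes> a \<oplus> k \<otimes> (u \<otimes> a)"
      using ex[OF a] by blast
    obtain l where l: "l \<in> L" "\<And>u. u \<in> carrier R \<Longrightarrow> Y (u \<otimes> b) = Y u \<otimes> b \<oplus> l \<otimes> (u \<otimes> b)"
      using ex[OF b] by blast
    have ab: "a \<in> carrier R" "b \<in> carrier R" "k \<in> carrier R" "l \<in> carrier R" using a b k l by auto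
    have Yab: "Y (v \<otimes> a \<otimes> b) = Y v \<otimes> (a \<otimes> b) \<oplus> (k \<oplus> l) \<otimes> (v \<otimes> a \<otimes> b)" if v: "v \<in> carrier R" for v
    proof -
      have "Y (v \<otimes> a \<otimes> b) = (Y v \<otimes> a \<oplus> k \<otimes> (v \<otimes> a)) \<otimes> b \<oplus> l \<otimes> (v \<otimes> a \<otimes> b)"
        using l(2)[of "v \<otimes> a"] k(2)[OF v] v ab by simp
      also have "\<dots> = Y v \<otimes> (a \<otimes> b) \<oplus> (k \<oplus> l) \<otimes> (v \<otimes> a \<otimes> b)"
        using linop_closed[OF Y v] v ab by algebra
      finally show ?thesis .
    qed
    have Yba: "Y (v \<otimes> b \<otimes> a) = Y v \<otimes> (b \<otimes> a) \<oplus> (k \<oplus> l) \<otimes> (v \<otimes> b \<otimes> a)" if v: "v \<in> carrier R" for v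
    proof -
      have "Y (v \<otimes> b \<otimes> a) = (Y v \<otimes> b \<oplus> l \<otimes> (v \<otimes> b)) \<otimes> a \<oplus> k \<otimes> (v \<otimes> b \<otimes> a)"
        using k(2)[of "v \<otimes> b"] l(2)[OF v] v ab by simp
      also have "\<dots> = Y v \<otimes> (b \<otimes> a) \<oplus> (k \<oplus> l) \<otimes> (v \<otimes> b \<otimes> a)"
        using linop_closed[OF Y v] v ab by algebra
      finally show ?thesis .
    qed
    \<comment> \<open>Since \<open>u \<otimes> w \<otimes> b \<otimes> a = u \<otimes> a \<otimes>
      b\<close>, the two expansions of \<open>Y\<close> carry the same correction with scalar
      \<open>k \<oplus> l\<close>, and it cancels.\<close>
    define w where "w = a \<otimes> b \<otimes> inv a \<otimes> inv b"
    have w: "w \<in> carrier R" using a b by (simp add: w_def)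
    have wba: "w \<otimes> (b \<otimes> a) = a \<otimes> b" using a b by (simp add: w_def m_assoc)
    have uwba: "u \<otimes> w \<otimes> b \<otimes> a = u \<otimes> a \<otimes> b" using wba u w ab by (simp add: m_assoc)
    have YR: "Y u \<in> carrier R" "Y (u \<otimes> w) \<in> carrier R" using Y u w by auto
    have uab: "(k \<oplus> l) \<otimes> (u \<otimes> a \<otimes> b) \<in> carrier R" using u ab by simp
    have "Y (u \<otimes> w) \<otimes> (b \<otimes> a) \<oplus> (k \<oplus> l) \<otimes> (u \<otimes> a \<otimes> b) = Y u \<otimes> (a \<otimes> b) \<oplus> (k \<oplus> l) \<otimes> (u \<otimes> a \<otimes> b)"
      using Yab[OF u] Yba[of "u \<otimes> w"] u w by (simp add: uwba)
    then have "Y (u \<otimes> w) \<otimes> (b \<otimes> a) = Y u \<otimes> (a \<otimes> b)" using YR ab uab by simp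
    also have "\<dots> = Y u \<otimes> w \<otimes> (b \<otimes> a)" using YR w ab by (simp add: m_assoc wba)
    finally have "Y (u \<otimes> w) = Y u \<otimes> w"
      using mult_cancel_right'[of "b \<otimes> a" "Y (u \<otimes> w)" "Y u \<otimes> w"] a b YR w by (simp add: mult_eq_zero_iff)
    then show ?thesis by (simp add: w_def)
  qed
  obtain a b where ab: "a \<in> N" "b \<in> N" "a \<otimes> b \<otimes> inv a \<otimes> inv b \<notin> ring_center R"
    using exists_noncentral_commutator[OF infinite_center nc] by blast
  show ?thesis
  proof (rule scalar_if_commuting[OF Y _ ab(3)])
    show "a \<otimes> b \<otimes> inv a \<otimes> inv b \<in> carrier R" using ab by simp
    fix z u assume z: "z \<in> carrier R" "z \<noteq> \<zero>" and u: "u \<in> carrier R"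
    \<comment> \<open>A conjugate of a commutator is the commutator of the conjugates, which lie in
      \<open>N\<close> again.\<close>
    define a' b' where "a' = z \<otimes> a \<otimes> inv z" and "b' = z \<otimes> b \<otimes> inv z"
    have ab': "a' \<in> N" "b' \<in> N" using N_conj[OF z] ab by (simp_all add: a'_def b'_def)
    have "z \<otimes> (a \<otimes> b \<otimes> inv a \<otimes> inv b) \<otimes> inv z = a' \<otimes> b' \<otimes> inv a' \<otimes> inv b'"
      using conj_mult[OF z] conj_inv[OF z] ab by (simp add: a'_def b'_def)
    then show "Y (u \<otimes> (z \<otimes> (a \<otimes> b \<otimes> inv a \<otimes> inv b) \<otimes> inv z)) = Y u \<otimes> (z \<otimes> (a \<otimes> b \<otimes> inv a \<otimes> inv b) \<otimes> inv z)"
      using comm[OF ab' u] by simp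
  qed
qed

theorem independent_length_le_bound:
  assumes nc: "\<not> N \<subseteq> ring_center R" and E: "independent L E"
  shows "length E \<le> d"
proof (rule ccontr)
  assume "\<not> length E \<le> d"
  then have len: "Suc d \<le> length E" by simp
  \<comment> \<open>A suffix of \<open>d + 1\<close> independent vectors. They are numbered from the
    end, so that \<open>E'\<close> is ordered like a Krylov list, with \<open>e d\<close> at its
    head.\<close>
  define E' where "E' = drop (length E - Suc d) E"
  have lenE: "length E' = Suc d" using len by (simp add: E'_def)
  have "independent L (take (length E - Suc d) E @ E')" using E by (simp add: E'_def)
  then have indE: "independent L E'" by (rule independent_split(1)[OF subfield_L])
  define e where "e i = E' ! (d - i)" for i
  have E'_eq: "E' = map e (rev [0..<Suc d])"
    by (rule nth_equalityI) (use lenE in \<open>auto simp: e_def rev_nth simp del: upt_Suc\<close>)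
  have eR: "e i \<in> carrier R" for i
    using independent_in_carrier[OF indE] lenE by (auto simp: e_def)
  \<comment> \<open>The values that a shift operator would take at the first \<open>d\<close> of the
    vectors.\<close>
  define \<tau> where "\<tau> i = (if i < d then e (Suc i) else \<zero>)" for i
  have \<tau>R: "\<tau> i \<in> carrier R" for i using eR by (simp add: \<tau>_def)
  define good where "good ps \<longleftrightarrow> (\<forall>l c. (l, c) \<in> set ps \<longrightarrow> l \<in> L \<and> c \<in> double_differences)" for ps :: "('a \<times> 'a) list"
  define op where "op ps u = lsum (\<lambda>(l, c). l \<otimes> (u \<otimes> c)) ps" for ps u
  have opR: "op ps u \<in> carrier R" if "good ps" "u \<in> carrier R" for ps u
    unfolding op_def using that double_difference_carrier by (auto simp: good_def intro!: lsum_closed)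
  \<comment> \<open>The values of admissible operators at \<open>e 0, ..., e (d - 1)\<close>.
    Entries from index \<open>d\<close> on are unrestricted, which forces \<open>\<phi>\<close> to
    ignore them.\<close>
  define W where "W = {x. (\<forall>i::nat. x i \<in> carrier R) \<and> (\<exists>ps. good ps \<and> (\<forall>i<d. x i = op ps (e i)))}"
  have "\<exists>\<phi>. (\<forall>x. (\<forall>i. x i \<in> carrier R) \<longrightarrow> \<phi> x \<in> L) \<and>
    (\<forall>x y. (\<forall>i. x i \<in> carrier R) \<longrightarrow> (\<forall>i. y i \<in> carrier R) \<longrightarrow> \<phi> (\<lambda>i. x i \<oplus> y i) = \<phi> x \<oplus> \<phi> y) \<and>
    (\<forall>l \<in> L. \<forall>x. (\<forall>i. x i \<in> carrier R) \<longrightarrow> \<phi> (\<lambda>i. l \<otimes> x i) = l \<otimes> \<phi> x) \<and>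
    (\<forall>x \<in> W. \<phi> x = \<zero>) \<and> \<phi> \<tau> = \<one>"
  proof (rule exists_separating_functional)
    show "x i \<in> carrier R" if "x \<in> W" for x i using that by (simp add: W_def)
    show "(\<lambda>i. \<zero>) \<in> W" unfolding W_def by (auto intro!: exI[of _ "[]"] simp: good_def op_def)
    show "(\<lambda>i. x i \<oplus> y i) \<in> W" if xy: "x \<in> W" "y \<in> W" for x y
    proof -
      obtain ps qs where ps: "good ps" "\<And>i. i < d \<Longrightarrow> x i = op ps (e i)"
        and qs: "good qs" "\<And>i. i < d \<Longrightarrow> y i = op qs (e i)"
        using xy unfolding W_def by blast
      have g: "good (ps @ qs)" using ps qs by (auto simp: good_def)
      have "op (ps @ qs) (e i) = op ps (e i) \<oplus> op qs (e i)" for i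
        unfolding op_def using ps qs eR double_difference_carrier
        by (intro lsum_append) (auto simp: good_def)
      then show ?thesis using xy g ps qs by (auto simp: W_def intro!: exI[of _ "ps @ qs"])
    qed
    show "(\<lambda>i. l \<otimes> x i) \<in> W" if l: "l \<in> L" and x: "x \<in> W" for l x
    proof -
      obtain ps where ps: "good ps" "\<And>i. i < d \<Longrightarrow> x i = op ps (e i)" using x unfolding W_def by blast
      define qs where "qs = map (\<lambda>(m, c). (l \<otimes> m, c)) ps"
      have g: "good qs" using ps l by (auto simp: good_def qs_def)
      have "op qs (e i) = l \<otimes> op ps (e i)" for i
      proof -
        have "op qs (e i) = lsum (\<lambda>q. l \<otimes> (case q of (m, c) \<Rightarrow> m \<otimes> (e i \<otimes> c))) ps"
          unfolding op_def qs_def lsum_map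
          by (rule lsum_cong) (use ps l eR double_difference_carrier in \<open>auto simp: good_def m_assoc\<close>)
        also have "\<dots> = l \<otimes> op ps (e i)" unfolding op_def
          by (rule lsum_mult_left) (use ps l eR double_difference_carrier in \<open>auto simp: good_def\<close>)
        finally show ?thesis .
      qed
      then show ?thesis using x l g ps by (auto simp: W_def intro!: exI[of _ qs])
    qed
    show "\<tau> i \<in> carrier R" for i by (rule \<tau>R)
    show "\<tau> \<notin> W"
    proof
      assume "\<tau> \<in> W"
      then obtain ps where ps: "good ps" "\<And>i. i < d \<Longrightarrow> e (Suc i) = op ps (e i)"
        by (auto simp: W_def \<tau>_def)
      obtain a where a: "a \<in> N" using nc by blast
      have t0: "tangent \<zero>"
        using tangent_conj_difference[of \<zero> a] a algebraic_over_centerI[of "[\<zero>, \<one>]" \<zero>] one_not_zero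
        by (auto simp: minus_eq)
      have bd: "locally_bounded d (\<lambda>u. op ps u \<oplus> u \<otimes> \<zero>)"
        unfolding op_def using lsum_double_differences_bounded[of ps, OF _ t0] ps(1) by (auto simp: good_def)
      define T where "T = (\<lambda>u. op ps u \<oplus> u \<otimes> \<zero>)"
      have Te: "T (e i) = e (Suc i)" if "i < d" for i
        using ps(2)[OF that] eR opR[OF ps(1)] by (simp add: T_def)
      have pow: "(T ^^ i) (e 0) = e i" if "i \<le> d" for i
        using that by (induction i) (auto simp: Te)
      have "krylov T (e 0) k = map e (rev [0..<k])" if "k \<le> Suc d" for k
        using that by (induction k) (auto simp: pow)
      then have "krylov T (e 0) (Suc d) = E'" unfolding E'_eq by blast
      then show False using bd indE eR[of 0] unfolding T_def locally_bounded_def by metis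
    qed
  qed
  then obtain \<phi> where \<phi>: "\<forall>x. (\<forall>i. x i \<in> carrier R) \<longrightarrow> \<phi> x \<in> L"
    "\<forall>x y. (\<forall>i. x i \<in> carrier R) \<longrightarrow> (\<forall>i. y i \<in> carrier R) \<longrightarrow> \<phi> (\<lambda>i. x i \<oplus> y i) = \<phi> x \<oplus> \<phi> y"
    "\<forall>l \<in> L. \<forall>x. (\<forall>i. x i \<in> carrier R) \<longrightarrow> \<phi> (\<lambda>i. l \<otimes> x i) = l \<otimes> \<phi> x"
    "\<forall>x \<in> W. \<phi> x = \<zero>" and \<phi>\<tau>: "\<phi> \<tau> = \<one>"
    by (elim exE conjE)
  have \<phi>L: "\<phi> x \<in> L" if "\<And>i. x i \<in> carrier R" for x
    using that by (intro \<phi>(1)[rule_format])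
  have \<phi>add: "\<phi> (\<lambda>i. x i \<oplus> y i) = \<phi> x \<oplus> \<phi> y"
    if "\<And>i. x i \<in> carrier R" "\<And>i. y i \<in> carrier R" for x y
    using that by (intro \<phi>(2)[rule_format])
  have \<phi>smult: "\<phi> (\<lambda>i. l \<otimes> x i) = l \<otimes> \<phi> x" if "l \<in> L" "\<And>i. x i \<in> carrier R" for l x
    using that by (intro \<phi>(3)[rule_format])
  have \<phi>W: "\<phi> x = \<zero>" if "x \<in> W" for x
    using that by (rule \<phi>(4)[rule_format])
  define \<psi> where "\<psi> i u = \<phi> (\<lambda>j. if j = i then u else \<zero>)" for i u
  have \<psi>: "functional (\<psi> i)" for i
    unfolding functional_def linop_def
  proof (intro conjI ballI)
    fix u v assume uv: "u \<in> carrier R" "v \<in> carrier R"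
    have L: "\<psi> i u \<in> L" unfolding \<psi>_def by (rule \<phi>L) (use uv in auto)
    then show "\<psi> i u \<in> carrier R" by simp
    have "(\<lambda>j. (if j = i then u else \<zero>) \<oplus> (if j = i then v else \<zero>)) = (\<lambda>j. if j = i then u \<oplus> v else \<zero>)"
      by auto
    then show "\<psi> i (u \<oplus> v) = \<psi> i u \<oplus> \<psi> i v"
      using \<phi>add[of "\<lambda>j. if j = i then u else \<zero>" "\<lambda>j. if j = i then v else \<zero>"] uv by (simp add: \<psi>_def)
  next
    fix l u assume lu: "l \<in> L" "u \<in> carrier R"
    then have "(\<lambda>j. l \<otimes> (if j = i then u else \<zero>)) = (\<lambda>j. if j = i then l \<otimes> u else \<zero>)" by auto
    then show "\<psi> i (l \<otimes> u) = l \<otimes> \<psi> i u"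
      using \<phi>smult[of l "\<lambda>j. if j = i then u else \<zero>"] lu by (simp add: \<psi>_def)
  next
    fix u assume "u \<in> carrier R"
    then show "\<psi> i u \<in> L" unfolding \<psi>_def by (intro \<phi>L) auto
  qed
  have zeroW: "\<phi> x = \<zero>" if "\<And>i. x i \<in> carrier R" "\<And>i. i < d \<Longrightarrow> x i = \<zero>" for x
    by (rule \<phi>W) (use that in \<open>auto simp: W_def good_def op_def intro!: exI[of _ "[]"]\<close>)
  have expand: "\<phi> x = lsum (\<lambda>i. \<psi> i (x i)) [0..<d]" if x: "\<And>i. x i \<in> carrier R" for x
  proof -
    have \<psi>R: "\<psi> i (x i) \<in> carrier R" for i using functional_L[OF \<psi> x] by simp
    have trunc: "\<phi> (\<lambda>j. if j < k then x j else \<zero>) = lsum (\<lambda>i. \<psi> i (x i)) [0..<k]" for k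
    proof (induction k)
      case 0
      show ?case using zeroW[of "\<lambda>j. \<zero>"] by simp
    next
      case (Suc k)
      have "(\<lambda>j. if j < Suc k then x j else \<zero>) =
          (\<lambda>j. (if j < k then x j else \<zero>) \<oplus> (if j = k then x k else \<zero>))"
        using x by (auto simp: less_Suc_eq)
      then have "\<phi> (\<lambda>j. if j < Suc k then x j else \<zero>) =
          \<phi> (\<lambda>j. if j < k then x j else \<zero>) \<oplus> \<psi> k (x k)"
        using \<phi>add[of "\<lambda>j. if j < k then x j else \<zero>" "\<lambda>j. if j = k then x k else \<zero>"] x by (simp add: \<psi>_def)
      also have "\<dots> = lsum (\<lambda>i. \<psi> i (x i)) ([0..<k] @ [k])"
        using lsum_append[of "[0..<k]" "[k]" "\<lambda>i. \<psi> i (x i)"] \<psi>R by (simp add: Suc)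
      finally show ?case by simp
    qed
    have "x = (\<lambda>j. (if j < d then x j else \<zero>) \<oplus> (if j < d then \<zero> else x j))" using x by auto
    then have "\<phi> x = \<phi> (\<lambda>j. (if j < d then x j else \<zero>) \<oplus> (if j < d then \<zero> else x j))" by simp
    also have "\<dots> = \<phi> (\<lambda>j. if j < d then x j else \<zero>) \<oplus> \<phi> (\<lambda>j. if j < d then \<zero> else x j)"
      by (rule \<phi>add) (use x in auto)
    also have "\<phi> (\<lambda>j. if j < d then \<zero> else x j) = \<zero>" by (rule zeroW) (use x in auto)
    finally show ?thesis using trunc[of d] \<psi>R by simp
  qed
  have orth: "lsum (\<lambda>i. \<psi> i (e i \<otimes> c)) [0..<d] = \<zero>" if c: "c \<in> double_differences" for c
  proof -
    have cR: "c \<in> carrier R" by (rule double_difference_carrier[OF c])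
    have "(\<lambda>i. e i \<otimes> c) \<in> W" unfolding W_def
      using eR cR c by (auto intro!: exI[of _ "[(\<one>, c)]"] simp: good_def op_def)
    then have "\<phi> (\<lambda>i. e i \<otimes> c) = \<zero>" by (rule \<phi>W)
    then show ?thesis using expand[of "\<lambda>i. e i \<otimes> c"] eR cR by simp
  qed
  \<comment> \<open>For a double difference \<open>c\<close>, the sum in \<open>orth\<close> is the
    trace of \<open>Y\<close> followed by right multiplication by \<open>c\<close>.\<close>
  define Y where "Y u = lsum (\<lambda>i. \<psi> i u \<otimes> e i) [0..<d]" for u
  have Yl: "linop Y" unfolding Y_def
    by (intro linop_lsum' linop_compose[OF linop_right_mult] functional_linop \<psi> eR)
  have \<psi>R [simp]: "\<psi> i u \<in> carrier R" if "u \<in> carrier R" for i u using functional_L[OF \<psi> that] by simp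
  have "\<exists>c \<in> L. \<forall>u \<in> carrier R. Y u = c \<otimes> u"
  proof (rule scalar_if_orthogonal[OF nc Yl])
    fix a b u assume a: "a \<in> N" and b: "b \<in> N" and u: "u \<in> carrier R"
    have ab: "a \<in> carrier R" "b \<in> carrier R" "inv a \<in> carrier R" "inv b \<in> carrier R" using a b by auto
    \<comment> \<open>The four terms of a double difference, with \<open>y\<close> isolated: factors
      to the right of \<open>y\<close> go into the functional, factors to the left of
      \<open>y\<close> into the vector. \<open>trace_zero_iff\<close> then applies to these pairs
      with \<open>y\<close> arbitrary and yields an operator identity for \<open>Y\<close>.\<close>
    define A B C D where "A = (\<lambda>i. (\<psi> i, e i))" and "B = (\<lambda>i. (\<lambda>u. \<ominus> \<psi> i (u \<otimes> inv b), e i \<otimes> b))"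
      and "C = (\<lambda>i. (\<lambda>u. \<ominus> \<psi> i (u \<otimes> inv a), e i \<otimes> a))"
      and "D = (\<lambda>i. (\<lambda>u. \<psi> i (u \<otimes> (inv b \<otimes> inv a)), e i \<otimes> a \<otimes> b))"
    define ps where "ps = map A [0..<d] @ map B [0..<d] @ map C [0..<d] @ map D [0..<d]"
    have fun_ps: "functional \<chi> \<and> h \<in> carrier R" if "(\<chi>, h) \<in> set ps" for \<chi> h
    proof -
      have "functional (fst p) \<and> snd p \<in> carrier R" if p: "p \<in> set ps" for p
      proof -
        obtain i where "p = A i \<or> p = B i \<or> p = C i \<or> p = D i"
          using p unfolding ps_def set_append set_map by blast
        moreover have "functional (\<lambda>u. \<psi> i (u \<otimes> c))" if "c \<in> carrier R" for c
          by (rule functional_compose[OF \<psi> linop_right_mult[OF that]])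
        ultimately show ?thesis using ab eR \<psi>
          by (auto simp: A_def B_def C_def D_def intro!: functional_uminus)
      qed
      from this[OF that] show ?thesis by simp
    qed
    have "lsum (\<lambda>(\<psi>, g). \<psi> (g \<otimes> y)) ps = \<zero>" if y: "y \<in> carrier R" for y
    proof -
      define x where "x = y \<ominus> b \<otimes> y \<otimes> inv b"
      define c where "c = x \<ominus> a \<otimes> x \<otimes> inv a"
      have c: "c \<in> double_differences" unfolding double_differences_def c_def using a b y x_def by blast
      have xc: "x \<in> carrier R" "c \<in> carrier R" using y ab by (simp_all add: x_def c_def)
      have "lsum (\<lambda>(\<psi>, g). \<psi> (g \<otimes> y)) ps = lsum (\<lambda>i. \<psi> i (e i \<otimes> y) \<oplus> (\<ominus> \<psi> i (e i \<otimes> b \<otimes> y \<otimes> inv b) \<oplus>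
          (\<ominus> \<psi> i (e i \<otimes> a \<otimes> y \<otimes> inv a) \<oplus> \<psi> i (e i \<otimes> a \<otimes> b \<otimes> y \<otimes> (inv b \<otimes> inv a))))) [0..<d]"
        unfolding ps_def by (subst lsum_append4) (use y ab eR in \<open>simp_all add: A_def B_def C_def D_def\<close>)
      also have "\<dots> = lsum (\<lambda>i. \<psi> i (e i \<otimes> c)) [0..<d]"
      proof (rule lsum_cong)
        fix i
        define p q r s where "p = e i \<otimes> y" and "q = e i \<otimes> b \<otimes> y \<otimes> inv b" and "r = e i \<otimes> a \<otimes> y \<otimes> inv a"
          and "s = e i \<otimes> a \<otimes> b \<otimes> y \<otimes> (inv b \<otimes> inv a)"
        have pqrs: "p \<in> carrier R" "q \<in> carrier R" "r \<in> carrier R" "s \<in> carrier R"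
          using y ab eR by (simp_all add: p_def q_def r_def s_def)
        have "e i \<otimes> c = p \<ominus> q \<ominus> (r \<ominus> s)"
          using y ab eR[of i] by (simp add: c_def x_def p_def q_def r_def s_def minus_eq r_distr l_distr r_minus l_minus m_assoc)
        then have "\<psi> i (e i \<otimes> c) = \<psi> i p \<ominus> \<psi> i q \<ominus> (\<psi> i r \<ominus> \<psi> i s)"
          using linop_minus[OF functional_linop[OF \<psi>]] pqrs by simp
        also have "\<dots> = \<psi> i p \<oplus> (\<ominus> \<psi> i q \<oplus> (\<ominus> \<psi> i r \<oplus> \<psi> i s))"
          using pqrs by (simp add: minus_eq minus_add a_assoc)
        finally show "\<psi> i p \<oplus> (\<ominus> \<psi> i q \<oplus> (\<ominus> \<psi> i r \<oplus> \<psi> i s)) = \<psi> i (e i \<otimes> c)" by simp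
      qed
      also have "\<dots> = \<zero>" by (rule orth[OF c])
      finally show ?thesis .
    qed
    then have Z0: "lsum (\<lambda>(\<psi>, g). \<psi> u \<otimes> g) ps = \<zero>" using trace_zero_iff[OF fun_ps] u by blast
    define f where "f v k = (\<lambda>i. \<psi> i v \<otimes> e i \<otimes> k)" for v k
    have fR: "f v k i \<in> carrier R" if "v \<in> carrier R" "k \<in> carrier R" for v k i
      using that eR by (simp add: f_def)
    have Yf: "Y v \<otimes> k = lsum (f v k) [0..<d]" if "v \<in> carrier R" "k \<in> carrier R" for v k
      unfolding Y_def f_def by (rule lsum_mult_right[symmetric]) (use that eR in auto)
    have "lsum (\<lambda>(\<psi>, g). \<psi> u \<otimes> g) ps = lsum (\<lambda>i. f u \<one> i \<oplus> (\<ominus> f (u \<otimes> inv b) b i \<oplus>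
        (\<ominus> f (u \<otimes> inv a) a i \<oplus> f (u \<otimes> inv b \<otimes> inv a) (a \<otimes> b) i))) [0..<d]"
      unfolding ps_def
      by (subst lsum_append4) (use u ab eR in \<open>simp_all add: A_def B_def C_def D_def f_def m_assoc l_minus\<close>)
    also have "\<dots> = lsum (f u \<one>) [0..<d] \<oplus> (\<ominus> lsum (f (u \<otimes> inv b) b) [0..<d] \<oplus>
        (\<ominus> lsum (f (u \<otimes> inv a) a) [0..<d] \<oplus> lsum (f (u \<otimes> inv b \<otimes> inv a) (a \<otimes> b)) [0..<d]))"
      using u ab fR by (simp add: lsum_add lsum_uminus)
    also have "\<dots> = Y u \<otimes> \<one> \<oplus> (\<ominus> (Y (u \<otimes> inv b) \<otimes> b) \<oplus>
        (\<ominus> (Y (u \<otimes> inv a) \<otimes> a) \<oplus> Y (u \<otimes> inv b \<otimes> inv a) \<otimes> (a \<otimes> b)))"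
      using u ab by (simp add: Yf[symmetric])
    also have "\<dots> = Y u \<ominus> Y (u \<otimes> inv b) \<otimes> b \<ominus> Y (u \<otimes> inv a) \<otimes> a \<oplus> Y (u \<otimes> inv b \<otimes> inv a) \<otimes> a \<otimes> b"
      using u ab linop_closed[OF Yl] by (simp add: minus_eq a_assoc m_assoc)
    finally show "Y u \<ominus> Y (u \<otimes> inv b) \<otimes> b \<ominus> Y (u \<otimes> inv a) \<otimes> a \<oplus> Y (u \<otimes> inv b \<otimes> inv a) \<otimes> a \<otimes> b = \<zero>"
      using Z0 by simp
  qed
  then obtain c where c: "c \<in> L" "\<And>u. u \<in> carrier R \<Longrightarrow> Y u = c \<otimes> u" by blast
  define rest where "rest = map e (rev [0..<d])"
  have restR: "set rest \<subseteq> carrier R" using eR by (auto simp: rest_def)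
  have "E' = e d # rest" unfolding E'_eq rest_def by simp
  then have ed: "e d \<notin> Span L rest" and ind_rest: "independent L rest"
    using independent_backwards[of L "e d" rest] indE by auto
  \<comment> \<open>A nonzero multiple of \<open>e d\<close> cannot lie in the span of the other
    \<open>e i\<close>, which contains all values of \<open>Y\<close>.\<close>
  have "c = \<zero>"
  proof (rule ccontr)
    assume c0: "c \<noteq> \<zero>"
    have "\<psi> i (e d) \<otimes> e i \<in> Span L rest" if "i \<in> set [0..<d]" for i
    proof -
      have "e i \<in> set rest" using that by (simp add: rest_def)
      then show ?thesis
        using Span_closed(6)[OF restR functional_L[OF \<psi> eR] Span_closed(7)[OF restR]] by blast
    qed
    then have "Y (e d) \<in> Span L rest" unfolding Y_def by (rule lsum_in_Span[OF restR])
    then have "inv c \<otimes> (c \<otimes> e d) \<in> Span L rest"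
      using Span_closed(6)[OF restR L_inv[OF c(1) c0]] c(2)[OF eR] by simp
    then show False using ed c(1) c0 eR by simp
  qed
  \<comment> \<open>Now \<open>Y\<close> vanishes, so independence of the \<open>e i\<close> kills
    its coefficients \<open>\<psi> i u\<close>. Then \<open>\<phi>\<close> vanishes identically,
    against \<open>\<phi> \<tau> = \<one>\<close>.\<close>
  have \<psi>0: "\<psi> i u = \<zero>" if i: "i < d" and u: "u \<in> carrier R" for i u
  proof -
    have ind': "independent L (map e [0..<d])"
      by (rule independent_same_set[OF subfield_L _ _ ind_rest]) (simp_all add: rest_def)
    have "combine (map (\<lambda>i. \<psi> i u) xs) (map e xs) = lsum (\<lambda>i. \<psi> i u \<otimes> e i) xs" for xs
      by (induction xs) auto
    then have "combine (map (\<lambda>i. \<psi> i u) [0..<d]) (map e [0..<d]) = \<zero>"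
      using c(2)[OF u] \<open>c = \<zero>\<close> u by (simp add: Y_def)
    moreover have "set (map (\<lambda>i. \<psi> i u) [0..<d]) \<subseteq> L" using functional_L[OF \<psi> u] by auto
    moreover have "set (map e [0..<d]) \<subseteq> carrier R" using eR by auto
    ultimately have "set (map (\<lambda>i. \<psi> i u) [0..<d]) \<subseteq> {\<zero>}"
      using ind' L_independent_iff by (metis length_map)
    then show ?thesis using i by (auto simp: image_subset_iff)
  qed
  have "lsum (\<lambda>i. \<psi> i (\<tau> i)) [0..<d] = lsum (\<lambda>i. \<zero>) [0..<d]"
    by (rule lsum_cong) (use \<psi>0 \<tau>R in auto)
  also have "\<dots> = \<zero>" using lsum_mult_left[of "[0..<d]" "\<lambda>i. \<zero>" \<zero>] by simp
  finally show False using \<phi>\<tau> expand[OF \<tau>R] one_not_zero by simp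
qed

end

section \<open>From the dimension over L to the dimension over the center\<close>

context ring
begin

lemma lsum_zero: "(\<And>x. x \<in> set xs \<Longrightarrow> f x = \<zero>) \<Longrightarrow> lsum f xs = \<zero>"
  by (induction xs) auto

lemma lsum_swap:
  assumes "\<And>x y. x \<in> set xs \<Longrightarrow> y \<in> set ys \<Longrightarrow> f x y \<in> carrier R"
  shows "lsum (\<lambda>x. lsum (f x) ys) xs = lsum (\<lambda>y. lsum (\<lambda>x. f x y) xs) ys"
  using assms
proof (induction xs)
  case Nil
  show ?case using lsum_zero[of ys "\<lambda>y. \<zero>"] by simp
next
  case (Cons x xs)
  then have "lsum (\<lambda>x. lsum (f x) ys) (x # xs) = lsum (f x) ys \<oplus> lsum (\<lambda>y. lsum (\<lambda>x. f x y) xs) ys"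
    by simp
  also have "\<dots> = lsum (\<lambda>y. f x y \<oplus> lsum (\<lambda>x. f x y) xs) ys"
    by (rule lsum_add[symmetric]) (use Cons.prems in auto)
  finally show ?case by simp
qed

lemma combine_map_map: "combine (map f xs) (map g xs) = lsum (\<lambda>x. f x \<otimes> g x) xs"
  by (induction xs) auto

lemma finsum_atMost_eq_combine:
  fixes c y :: "nat \<Rightarrow> 'a"
  assumes "\<And>i. i \<le> m \<Longrightarrow> c i \<in> carrier R" "\<And>i. y i \<in> carrier R"
  shows "(\<Oplus>i \<in> {..m}. c i \<otimes> y i) = combine (map c (rev [0..<Suc m])) (map y (rev [0..<Suc m]))"
  using assms(1)
proof (induction m)
  case (Suc m)
  have "(\<Oplus>i \<in> {..Suc m}. c i \<otimes> y i) = c (Suc m) \<otimes> y (Suc m) \<oplus> (\<Oplus>i \<in> {..m}. c i \<otimes> y i)"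
    by (rule finsum_Suc) (use Suc.prems assms(2) in auto)
  then show ?case using Suc by simp
qed (use assms in simp)

end

context self_centralizing
begin

text \<open>A homogeneous system with more unknowns than equations, solved by elimination of one
  equation and one unknown at a time.\<close>

lemma exists_linear_relation:
  assumes "finite J" "distinct ks" "card J < length ks"
    and "\<And>k j. k \<in> set ks \<Longrightarrow> j \<in> J \<Longrightarrow> x k j \<in> L"
  shows "\<exists>t. (\<forall>k \<in> set ks. t k \<in> L) \<and> (\<exists>k \<in> set ks. t k \<noteq> \<zero>) \<and>
    (\<forall>j \<in> J. lsum (\<lambda>k. t k \<otimes> x k j) ks = \<zero>)"
  using assms
proof (induction J arbitrary: ks x rule: finite_induct)
  case empty
  then show ?case using one_not_zero by (cases ks) (auto intro!: exI[of _ "\<lambda>_. \<one>"])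
next
  case (insert j0 J)
  show ?case
  proof (cases "\<forall>k \<in> set ks. x k j0 = \<zero>")
    case True
    obtain t where t: "\<forall>k \<in> set ks. t k \<in> L" "\<exists>k \<in> set ks. t k \<noteq> \<zero>"
      "\<forall>j \<in> J. lsum (\<lambda>k. t k \<otimes> x k j) ks = \<zero>"
      using insert.IH[of ks x] insert.prems insert.hyps by auto
    have "lsum (\<lambda>k. t k \<otimes> x k j0) ks = \<zero>" by (rule lsum_zero) (use True t(1) in auto)
    then show ?thesis using t by (intro exI[of _ t]) auto
  next
    case False
    then obtain k0 where k0: "k0 \<in> set ks" "x k0 j0 \<noteq> \<zero>" by blast
    obtain as bs where ks: "ks = as @ k0 # bs" using split_list[OF k0(1)] by blast
    define ls where "ls = as @ bs"
    have ls: "distinct ls" "k0 \<notin> set ls" "set ls \<subseteq> set ks" "length ks = Suc (length ls)"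
      using insert.prems(1) by (auto simp: ls_def ks)
    define h where "h = x k0 j0"
    have h: "h \<in> L" "h \<noteq> \<zero>" using k0 insert.prems(3) by (auto simp: h_def)
    have xL: "x k j \<in> L" if "k \<in> set ks" "j \<in> insert j0 J" for k j using that insert.prems(3) by blast
    \<comment> \<open>Fraction-free elimination with the pivot \<open>h = x k0 j0\<close>; the
      coefficients \<open>y k j0\<close> vanish.\<close>
    define y where "y k j = h \<otimes> x k j \<ominus> x k j0 \<otimes> x k0 j" for k j
    have yL: "y k j \<in> L" if "k \<in> set ls" "j \<in> insert j0 J" for k j
      unfolding y_def using that ls(3) h(1) xL k0(1) by auto
    obtain \<mu> where \<mu>: "\<forall>k \<in> set ls. \<mu> k \<in> L" "\<exists>k \<in> set ls. \<mu> k \<noteq> \<zero>"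
      "\<forall>j \<in> J. lsum (\<lambda>k. \<mu> k \<otimes> y k j) ls = \<zero>"
      using insert.IH[of ls y] insert.prems insert.hyps ls yL by auto
    define s where "s = lsum (\<lambda>k. \<mu> k \<otimes> x k j0) ls"
    have lsumL: "lsum f zs \<in> L" if "\<And>z. z \<in> set zs \<Longrightarrow> f z \<in> L" for f :: "_ \<Rightarrow> 'a" and zs
      using that by (induction zs) auto
    have s: "s \<in> L" unfolding s_def using \<mu>(1) xL ls(3) by (intro lsumL) auto
    \<comment> \<open>Back substitution: the factor \<open>h\<close> undoes the scaling, and the
      value at \<open>k0\<close> is determined by the equation \<open>j0\<close>.\<close>
    define t where "t k = (if k = k0 then \<ominus> s else \<mu> k \<otimes> h)" for k
    have tL: "t k \<in> L" if "k \<in> set ks" for k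
      using that s \<mu>(1) h by (auto simp: t_def ks ls_def)
    have rel: "lsum (\<lambda>k. t k \<otimes> x k j) ks = lsum (\<lambda>k. \<mu> k \<otimes> y k j) ls" if j: "j \<in> insert j0 J" for j
    proof -
      have carr: "t k \<otimes> x k j \<in> carrier R" if "k \<in> set ks" for k
        using tL[OF that] xL[OF that j] by simp
      have carr2: "\<mu> k \<in> carrier R \<and> x k j \<in> carrier R \<and> x k j0 \<in> carrier R" if "k \<in> set ls" for k
        using that \<mu>(1) xL j ls(3) by auto
      have xk0: "x k0 j \<in> carrier R" using xL k0 j by simp
      have "lsum (\<lambda>k. t k \<otimes> x k j) ks = lsum (\<lambda>k. t k \<otimes> x k j) as \<oplus> (t k0 \<otimes> x k0 j \<oplus> lsum (\<lambda>k. t k \<otimes> x k j) bs)"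
        unfolding ks by (subst lsum_append) (use carr in \<open>auto simp: ks\<close>)
      also have "\<dots> = lsum (\<lambda>k. t k \<otimes> x k j) as \<oplus> lsum (\<lambda>k. t k \<otimes> x k j) bs \<oplus> t k0 \<otimes> x k0 j"
      proof -
        have "lsum (\<lambda>k. t k \<otimes> x k j) as \<in> carrier R" "lsum (\<lambda>k. t k \<otimes> x k j) bs \<in> carrier R"
          "t k0 \<otimes> x k0 j \<in> carrier R"
          using carr by (auto simp: ks intro!: lsum_closed)
        then show ?thesis by (simp add: a_ac)
      qed
      also have "lsum (\<lambda>k. t k \<otimes> x k j) as \<oplus> lsum (\<lambda>k. t k \<otimes> x k j) bs = lsum (\<lambda>k. t k \<otimes> x k j) ls"
        unfolding ls_def by (rule lsum_append[symmetric]) (use carr in \<open>auto simp: ks\<close>)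
      also have "lsum (\<lambda>k. t k \<otimes> x k j) ls = lsum (\<lambda>k. \<mu> k \<otimes> h \<otimes> x k j) ls"
        by (rule lsum_cong) (use ls(2) in \<open>auto simp: t_def\<close>)
      also have "t k0 \<otimes> x k0 j = \<ominus> (s \<otimes> x k0 j)" using s xk0 by (simp add: t_def l_minus)
      also have "s \<otimes> x k0 j = lsum (\<lambda>k. \<mu> k \<otimes> x k j0 \<otimes> x k0 j) ls"
        unfolding s_def by (rule lsum_mult_right[symmetric]) (use carr2 xk0 in auto)
      also have "lsum (\<lambda>k. \<mu> k \<otimes> h \<otimes> x k j) ls \<oplus> \<ominus> lsum (\<lambda>k. \<mu> k \<otimes> x k j0 \<otimes> x k0 j) ls =
          lsum (\<lambda>k. \<mu> k \<otimes> h \<otimes> x k j \<ominus> \<mu> k \<otimes> x k j0 \<otimes> x k0 j) ls"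
        unfolding minus_eq[symmetric] by (rule lsum_minus[symmetric]) (use carr2 xk0 h in auto)
      also have "\<dots> = lsum (\<lambda>k. \<mu> k \<otimes> y k j) ls"
      proof (rule lsum_cong)
        fix k assume "k \<in> set ls"
        then show "\<mu> k \<otimes> h \<otimes> x k j \<ominus> \<mu> k \<otimes> x k j0 \<otimes> x k0 j = \<mu> k \<otimes> y k j"
          using carr2[of k] xk0 h by (simp add: y_def minus_eq r_distr r_minus m_assoc)
      qed
      finally show ?thesis .
    qed
    have "lsum (\<lambda>k. \<mu> k \<otimes> y k j0) ls = \<zero>"
    proof (rule lsum_zero)
      fix k assume k: "k \<in> set ls"
      have "y k j0 = \<zero>"
        using L_commute[OF h(1), of "x k j0"] xL[of k j0] k ls(3) h by (auto simp: y_def h_def[symmetric] subset_iff minus_eq r_neg)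
      then show "\<mu> k \<otimes> y k j0 = \<zero>" using \<mu>(1) k by simp
    qed
    then have "\<forall>j \<in> insert j0 J. lsum (\<lambda>k. t k \<otimes> x k j) ks = \<zero>" using rel \<mu>(3) by auto
    moreover have "\<exists>k \<in> set ks. t k \<noteq> \<zero>"
    proof -
      obtain k where k: "k \<in> set ls" "\<mu> k \<noteq> \<zero>" using \<mu>(2) by blast
      then have "k \<noteq> k0" "k \<in> set ks" using ls by auto
      moreover have "\<mu> k \<otimes> h \<noteq> \<zero>" using k \<mu>(1) h by (simp add: mult_eq_zero_iff)
      ultimately show ?thesis by (auto simp: t_def)
    qed
    ultimately show ?thesis using tL by blast
  qed
qed

lemma center_independent_length_le:
  assumes bound: "\<And>E. independent L E \<Longrightarrow> length E \<le> d" and Bs: "independent (ring_center R) Bs"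
  shows "length Bs \<le> d\<^sup>2"
proof (rule ccontr)
  assume "\<not> length Bs \<le> d\<^sup>2"
  define n where "n = length Bs"
  have BsR: "set Bs \<subseteq> carrier R" by (rule independent_in_carrier[OF Bs])
  have "\<exists>E. independent L E \<and> (\<forall>E'. independent L E' \<longrightarrow> length E' \<le> length E)"
    by (rule ex_has_greatest_nat[of _ "[]" _ "Suc d"]) (use bound in \<open>auto simp: less_Suc_eq_le\<close>)
  then obtain E where E: "independent L E" and max: "\<And>E'. independent L E' \<Longrightarrow> length E' \<le> length E" by blast
  define m where "m = length E"
  have md: "m \<le> d" using bound[OF E] by (simp add: m_def)
  have ER: "set E \<subseteq> carrier R" by (rule independent_in_carrier[OF E])
  have span: "v \<in> Span L E" if "v \<in> carrier R" for v
  proof (rule ccontr)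
    assume "v \<notin> Span L E"
    then have "independent L (v # E)" using that E by (intro li_Cons)
    from max[OF this] show False by simp
  qed
  have "\<exists>Ks. set Ks \<subseteq> L \<and> length Ks = length E \<and> v = combine Ks E" if "v \<in> carrier R" for v
    using span[OF that] Span_mem_iff_length_version[OF subfield_L ER] by blast
  then obtain co where co: "\<And>v. v \<in> carrier R \<Longrightarrow> set (co v) \<subseteq> L \<and> length (co v) = m \<and> v = combine (co v) E"
    unfolding m_def by metis
  have coL: "co v ! j \<in> L" if "v \<in> carrier R" "j < m" for v j
    using co[OF that(1)] that(2) nth_mem[of j "co v"] by auto
  have Ej: "E ! j \<in> carrier R" if "j < m" for j using ER that nth_mem[of j E] by (auto simp: m_def)
  have Bk: "Bs ! k \<in> carrier R" if "k < n" for k using BsR that nth_mem[of k Bs] by (auto simp: n_def)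
  have co_sum: "v = lsum (\<lambda>j. co v ! j \<otimes> E ! j) [0..<m]" if v: "v \<in> carrier R" for v
  proof -
    have "map (\<lambda>j. co v ! j) [0..<m] = co v" "map (\<lambda>j. E ! j) [0..<m] = E"
      using co[OF v] by (auto intro: nth_equalityI simp: m_def)
    then show ?thesis using co[OF v] combine_map_map[of "\<lambda>j. co v ! j" "[0..<m]" "\<lambda>j. E ! j"] by simp
  qed
  \<comment> \<open>The unknowns are the \<open>n\<close> coefficients \<open>l k\<close>. There is
    one equation for each pair of a basis vector \<open>E ! i\<close> and a coordinate
    \<open>j\<close> of its image, hence \<open>m * m\<close> equations.\<close>
  have "card ({..<m} \<times> {..<m}) < length [0..<n]"
  proof -
    have "m * m \<le> d\<^sup>2" using md by (simp add: power2_eq_square mult_mono)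
    then show ?thesis using \<open>\<not> length Bs \<le> d\<^sup>2\<close> by (simp add: n_def card_cartesian_product)
  qed
  then have "\<exists>l. (\<forall>k \<in> set [0..<n]. l k \<in> L) \<and> (\<exists>k \<in> set [0..<n]. l k \<noteq> \<zero>) \<and>
      (\<forall>p \<in> {..<m} \<times> {..<m}. lsum (\<lambda>k. l k \<otimes> co (E ! fst p \<otimes> Bs ! k) ! snd p) [0..<n] = \<zero>)"
    by (intro exists_linear_relation) (use coL Ej Bk in auto)
  then obtain l where l0: "\<forall>k \<in> set [0..<n]. l k \<in> L" "\<exists>k \<in> set [0..<n]. l k \<noteq> \<zero>"
    "\<forall>p \<in> {..<m} \<times> {..<m}. lsum (\<lambda>k. l k \<otimes> co (E ! fst p \<otimes> Bs ! k) ! snd p) [0..<n] = \<zero>"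
    by blast
  have l: "l k \<in> L" if "k < n" for k using l0(1) that by simp
  have rel: "lsum (\<lambda>k. l k \<otimes> co (E ! i \<otimes> Bs ! k) ! j) [0..<n] = \<zero>" if "i < m" "j < m" for i j
    using bspec[OF l0(3), of "(i, j)"] that by simp
  define T where "T u = lsum (\<lambda>k. l k \<otimes> (u \<otimes> Bs ! k)) [0..<n]" for u
  have T: "linop T" unfolding T_def
    by (intro linop_lsum' linop_scale linop_right_mult) (use l Bk in auto)
  have TE: "T (E ! i) = \<zero>" if i: "i < m" for i
  proof -
    have c: "E ! i \<otimes> Bs ! k \<in> carrier R" if "k < n" for k using Ej[OF i] Bk[OF that] by simp
    have "T (E ! i) = lsum (\<lambda>k. lsum (\<lambda>j. l k \<otimes> co (E ! i \<otimes> Bs ! k) ! j \<otimes> E ! j) [0..<m]) [0..<n]"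
      unfolding T_def
    proof (rule lsum_cong)
      fix k assume "k \<in> set [0..<n]"
      then have k: "k < n" by simp
      have "l k \<otimes> (E ! i \<otimes> Bs ! k) = l k \<otimes> lsum (\<lambda>j. co (E ! i \<otimes> Bs ! k) ! j \<otimes> E ! j) [0..<m]"
        using co_sum[OF c[OF k]] by simp
      also have "\<dots> = lsum (\<lambda>j. l k \<otimes> (co (E ! i \<otimes> Bs ! k) ! j \<otimes> E ! j)) [0..<m]"
        by (rule lsum_mult_left[symmetric]) (use coL[OF c[OF k]] Ej l[OF k] in auto)
      also have "\<dots> = lsum (\<lambda>j. l k \<otimes> co (E ! i \<otimes> Bs ! k) ! j \<otimes> E ! j) [0..<m]"
        by (rule lsum_cong) (use coL[OF c[OF k]] Ej l[OF k] in \<open>auto simp: m_assoc\<close>)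
      finally show "l k \<otimes> (E ! i \<otimes> Bs ! k) = lsum (\<lambda>j. l k \<otimes> co (E ! i \<otimes> Bs ! k) ! j \<otimes> E ! j) [0..<m]" .
    qed
    also have "\<dots> = lsum (\<lambda>j. lsum (\<lambda>k. l k \<otimes> co (E ! i \<otimes> Bs ! k) ! j \<otimes> E ! j) [0..<n]) [0..<m]"
      by (rule lsum_swap) (use coL[OF c] Ej l in auto)
    also have "\<dots> = \<zero>"
    proof (rule lsum_zero)
      fix j assume "j \<in> set [0..<m]"
      then have j: "j < m" by simp
      have "lsum (\<lambda>k. l k \<otimes> co (E ! i \<otimes> Bs ! k) ! j \<otimes> E ! j) [0..<n] =
          lsum (\<lambda>k. l k \<otimes> co (E ! i \<otimes> Bs ! k) ! j) [0..<n] \<otimes> E ! j"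
        by (rule lsum_mult_right) (use coL[OF c _] Ej[OF j] l j in auto)
      then show "lsum (\<lambda>k. l k \<otimes> co (E ! i \<otimes> Bs ! k) ! j \<otimes> E ! j) [0..<n] = \<zero>"
        using rel[OF i j] Ej[OF j] by simp
    qed
    finally show ?thesis .
  qed
  have T0: "T u = \<zero>" if u: "u \<in> carrier R" for u
  proof -
    obtain Ks where Ks: "set Ks \<subseteq> L" "u = combine Ks E" using co[OF u] by blast
    have "T u = combine Ks (map T E)" using linop_combine[OF T Ks(1) ER] Ks(2) by simp
    also have "map T E = map (\<lambda>_. \<zero>) E"
      using TE by (auto simp: in_set_conv_nth m_def)
    also have "combine Ks (map (\<lambda>_. \<zero>) E) = \<zero>"
    proof -
      have "set Ks \<subseteq> carrier R" using Ks(1) by auto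
      then show ?thesis by (induction Ks E rule: combine.induct) auto
    qed
    finally show ?thesis .
  qed
  have "set (map l [0..<n]) \<subseteq> {\<zero>}"
  proof (rule generalized_polynomial_identity[OF Bs])
    show "length (map l [0..<n]) = length Bs" by (simp add: n_def)
    show "set (map l [0..<n]) \<subseteq> carrier R" using l by auto
    show "combine (map l [0..<n]) (map ((\<otimes>) u) Bs) = \<zero>" if u: "u \<in> carrier R" for u
    proof -
      have "map ((\<otimes>) u) Bs = map (\<lambda>k. u \<otimes> Bs ! k) [0..<n]"
        by (rule nth_equalityI) (auto simp: n_def)
      then show ?thesis using T0[OF u] combine_map_map[of l "[0..<n]" "\<lambda>k. u \<otimes> Bs ! k"] by (simp add: T_def)
    qed
  qed
  then show False using l0(2) by (auto simp: image_subset_iff)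
qed

end

context div_ring
begin

text \<open>Normality turns a degree bound for elements into one for all starting vectors: with
  \<open>b = v \<otimes> a \<otimes> inv v\<close> one has
  \<open>b [^] i \<otimes> v = v \<otimes> a [^] i\<close>, so an annihilating polynomial of
  \<open>b\<close> with left coefficients, multiplied by \<open>v\<close> on the right, is a
  dependence of the Krylov list of \<open>v\<close>.\<close>

lemma independent_length_le_if_left_annihilated:
  assumes inf: "infinite (ring_center R)" and K: "subfield K R"
    and N: "normal_units R N" "\<not> N \<subseteq> ring_center R"
    and ann: "\<And>a. a \<in> N \<Longrightarrow> \<exists>m \<le> d. \<exists>c. left_annihilates R K m c a"
    and Bs: "independent (ring_center R) Bs"
  shows "length Bs \<le> d\<^sup>2"
proof -
  obtain L where L: "K \<subseteq> L" "L \<subseteq> carrier R" "centralizer L = L"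
    using exists_self_centralizer[OF subfieldE(3,4)[OF K]] by blast
  interpret self_centralizing R L by unfold_locales (rule L(2), rule L(3))
  interpret normal_units R N by (rule N(1))
  have bounded: "locally_bounded d (\<lambda>u. u \<otimes> a)" if a: "a \<in> N" for a
    unfolding locally_bounded_def
  proof
    fix v assume v: "v \<in> carrier R"
    define T where "T = (\<lambda>u. u \<otimes> a)"
    have T: "linop T" unfolding T_def by (rule linop_right_mult) (use a in simp)
    \<comment> \<open>The degree \<open>m\<close> may be smaller than \<open>d\<close>, so the
      dependence must be carried over to the longer list.\<close>
    have mono: "independent L (krylov T v k) \<Longrightarrow> j \<le> k \<Longrightarrow> independent L (krylov T v j)" for j k
    proof (induction k)
      case (Suc k)
      then show ?case using independent_backwards(2)[of L _ "krylov T v k"] by (cases "j = Suc k") auto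
    qed simp
    have "\<exists>m \<le> d. \<not> independent L (krylov T v (Suc m))"
    proof (cases "v = \<zero>")
      case True
      then have "v \<in> Span L []" by simp
      then have "\<not> independent L (krylov T v (Suc 0))" using independent_backwards(1)[of L v "[]"] by auto
      then show ?thesis by blast
    next
      case False
      define b where "b = v \<otimes> a \<otimes> inv v"
      have bN: "b \<in> N" unfolding b_def by (rule N_conj[OF v False a])
      then obtain m c where m: "m \<le> d" "left_annihilates R K m c b" using ann by blast
      then have c: "\<And>i. i \<le> m \<Longrightarrow> c i \<in> K" "c m \<noteq> \<zero>" "(\<Oplus>i \<in> {..m}. c i \<otimes> (b [^] i)) = \<zero>"
        by (auto simp: left_annihilates_def)
      have cR: "c i \<in> carrier R" "c i \<in> L" if "i \<le> m" for i using c(1)[OF that] L by auto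
      have bv: "b \<otimes> v = v \<otimes> a" using v False a by (simp add: b_def)
      have bpow: "b [^] i \<otimes> v = v \<otimes> a [^] i" for i :: nat
      proof (induction i)
        case (Suc i)
        have "b [^] Suc i \<otimes> v = b [^] i \<otimes> (b \<otimes> v)" using bN v by (simp add: m_assoc)
        also have "\<dots> = b [^] i \<otimes> v \<otimes> a" using bN v a by (simp add: bv m_assoc)
        also have "\<dots> = v \<otimes> a [^] Suc i" using v a by (simp add: Suc m_assoc)
        finally show ?case .
      qed (use v in simp)
      have powR: "b [^] i \<in> carrier R" "a [^] i \<in> carrier R" for i :: nat using bN a by simp_all
      define Ks where "Ks = map c (rev [0..<Suc m])"
      have Ks: "set Ks \<subseteq> L" using cR by (auto simp: Ks_def)
      have KsR: "set Ks \<subseteq> carrier R" using Ks by auto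
      have "combine Ks (map (\<lambda>i. b [^] i) (rev [0..<Suc m])) = \<zero>"
        using c(3) finsum_atMost_eq_combine[of m c "\<lambda>i. b [^] i"] cR powR by (simp only: Ks_def)
      then have "combine Ks (map (\<lambda>i. b [^] i) (rev [0..<Suc m])) \<otimes> v = \<zero>" using v by simp
      moreover have "set (map (\<lambda>i. b [^] i) (rev [0..<Suc m])) \<subseteq> carrier R" using powR by auto
      ultimately have "combine Ks (map (\<lambda>i. b [^] i \<otimes> v) (rev [0..<Suc m])) = \<zero>"
        using combine_l_distr[OF KsR _ v] by (simp only: map_map o_def)
      moreover have "krylov T v (Suc m) = map (\<lambda>i. b [^] i \<otimes> v) (rev [0..<Suc m])"
        using krylov_right_mult[of a v "Suc m"] a v by (simp only: T_def bpow rev_map N_carrier)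
      ultimately have "combine Ks (krylov T v (Suc m)) = \<zero>" by simp
      moreover have "length Ks = length (krylov T v (Suc m))" by (simp add: Ks_def)
      moreover have "\<not> set Ks \<subseteq> {\<zero>}" using c(2) by (auto simp: Ks_def)
      ultimately have "\<not> independent L (krylov T v (Suc m))"
        using L_independent_iff[OF set_krylov_carrier[OF T v]] Ks by blast
      then show ?thesis using m(1) by blast
    qed
    then show "\<not> independent L (krylov (\<lambda>u. u \<otimes> a) v (Suc d))" using mono T_def by (metis Suc_le_mono)
  qed
  interpret bounded_normal_units R L N d by unfold_locales (rule inf, rule bounded)
  show ?thesis by (rule center_independent_length_le[OF independent_length_le_bound[OF N(2)] Bs])
qed

end

section \<open>The opposite ring and right algebraic elements\<close>

definition opposite_ring :: "('a, 'b) ring_scheme \<Rightarrow> ('a, 'b) ring_scheme" where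
  "opposite_ring R = R\<lparr>mult := \<lambda>x y. y \<otimes>\<^bsub>R\<^esub> x\<rparr>"

lemma opposite_ring_simps [simp]:
  "carrier (opposite_ring R) = carrier R" "\<zero>\<^bsub>opposite_ring R\<^esub> = \<zero>\<^bsub>R\<^esub>" "\<one>\<^bsub>opposite_ring R\<^esub> = \<one>\<^bsub>R\<^esub>"
  "add (opposite_ring R) = add R" "x \<otimes>\<^bsub>opposite_ring R\<^esub> y = y \<otimes>\<^bsub>R\<^esub> x"
  by (simp_all add: opposite_ring_def)

lemma opposite_ring_Units: "Units (opposite_ring R) = Units R"
  by (auto simp: Units_def)

lemma opposite_ring_m_inv: "inv\<^bsub>opposite_ring R\<^esub> x = inv\<^bsub>R\<^esub> x"
  by (simp add: m_inv_def conj_commute)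

lemma opposite_ring_finsum: "finsum (opposite_ring R) = finsum R"
  unfolding finsum_def by simp

context div_ring
begin

lemma ring_opposite: "ring (opposite_ring R)"
proof (rule ringI)
  show "abelian_group (opposite_ring R)"
    using abelian_group_axioms unfolding abelian_group_def abelian_monoid_def abelian_group_axioms_def
    by simp
  show "monoid (opposite_ring R)"
    by (rule monoidI) (auto simp: m_assoc)
qed (auto simp: l_distr r_distr)

lemma div_ring_opposite: "div_ring (opposite_ring R)"
  by (intro div_ring.intro ring_opposite div_ring_axioms.intro)
    (simp_all add: one_not_zero opposite_ring_Units div_ring_Units)

lemma ring_center_opposite: "ring_center (opposite_ring R) = ring_center R"
  unfolding ring_center_def opposite_ring_simps by (intro Collect_cong conj_cong refl ball_cong eq_commute)

lemma normal_units_opposite: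
  assumes "normal_units R N" shows "normal_units (opposite_ring R) N"
proof -
  interpret normal_units R N by (rule assms)
  show ?thesis
  proof (intro normal_units.intro div_ring_opposite normal_units_axioms.intro)
    fix z x assume z: "z \<in> carrier (opposite_ring R)" "z \<noteq> \<zero>\<^bsub>opposite_ring R\<^esub>" and x: "x \<in> N"
    \<comment> \<open>Conjugation by \<open>z\<close> in the opposite ring is conjugation by
      \<open>inv z\<close> in \<open>R\<close>.\<close>
    then have "inv z \<otimes> x \<otimes> inv (inv z) \<in> N" by (intro N_conj) auto
    then show "z \<otimes>\<^bsub>opposite_ring R\<^esub> x \<otimes>\<^bsub>opposite_ring R\<^esub> inv\<^bsub>opposite_ring R\<^esub> z \<in> N"
      using z x by (simp add: opposite_ring_m_inv m_assoc)
  qed (use N_sub N_mult N_inv in \<open>auto simp: opposite_ring_m_inv\<close>)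
qed

lemma subfield_opposite:
  assumes K: "subfield K R" shows "subfield K (opposite_ring R)"
proof -
  interpret O: div_ring "opposite_ring R" by (rule div_ring_opposite)
  have minus: "\<ominus>\<^bsub>opposite_ring R\<^esub> x = \<ominus> x" for x
    unfolding a_inv_def by simp
  show ?thesis
  proof (rule O.subfield_if_commutative)
    show "inv\<^bsub>opposite_ring R\<^esub> x \<in> K" if "x \<in> K" "x \<noteq> \<zero>\<^bsub>opposite_ring R\<^esub>" for x
      using subfield_m_inv(1)[OF K, of x] that by (simp add: opposite_ring_m_inv)
    show "x \<otimes>\<^bsub>opposite_ring R\<^esub> y = y \<otimes>\<^bsub>opposite_ring R\<^esub> x" if "x \<in> K" "y \<in> K" for x y
      using subfieldE(4)[OF K] that by simp
  qed (use subringE[OF subfieldE(1)[OF K]] subfieldE(3)[OF K] in \<open>auto simp: minus\<close>)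
qed

lemma nat_pow_opposite: "x \<in> carrier R \<Longrightarrow> x [^]\<^bsub>opposite_ring R\<^esub> (i::nat) = x [^] i"
proof (induction i)
  case (Suc i)
  interpret O: div_ring "opposite_ring R" by (rule div_ring_opposite)
  have "x [^]\<^bsub>opposite_ring R\<^esub> Suc i = x \<otimes> x [^] i" using Suc by simp
  also have "\<dots> = x [^] Suc i" using nat_pow_comm[of x i 1] Suc.prems by simp
  finally show ?case .
qed (simp add: nat_pow_def)

lemma left_annihilates_opposite:
  assumes "a \<in> carrier R" "right_annihilates R K m c a"
  shows "left_annihilates (opposite_ring R) K m c a"
  using assms by (simp add: left_annihilates_def right_annihilates_def opposite_ring_finsum nat_pow_opposite)

text \<open>Central scalars act the same way from both sides, so the spans in the two rings
  coincide.\<close>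

lemma independent_center_opposite:
  assumes "independent (ring_center R) Bs"
  shows "ring.independent (opposite_ring R) (ring_center R) Bs"
proof -
  interpret O: div_ring "opposite_ring R" by (rule div_ring_opposite)
  have line: "O.line_extension (ring_center R) u E = line_extension (ring_center R) u E" if "u \<in> carrier R" for u E
    using that center_commute by (auto simp: O.line_extension_mem_iff line_extension_mem_iff set_eq_iff)
  have span: "set Us \<subseteq> carrier R \<Longrightarrow> O.Span (ring_center R) Us = Span (ring_center R) Us" for Us
    by (induction Us) (auto simp: line)
  show ?thesis using assms
  proof (induction Bs rule: list.induct)
    case (Cons b Bs)
    have "set Bs \<subseteq> carrier R" using independent_in_carrier[OF Cons.prems] by simp
    then show ?case using Cons independent_backwards[OF Cons.prems] span
      by (intro O.li_Cons) auto
  qed simp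
qed

lemma independent_length_le_if_right_annihilated:
  assumes "infinite (ring_center R)" and "subfield K R"
    and N: "normal_units R N" "\<not> N \<subseteq> ring_center R"
    and ann: "\<And>a. a \<in> N \<Longrightarrow> \<exists>m \<le> d. \<exists>c. right_annihilates R K m c a"
    and Bs: "independent (ring_center R) Bs"
  shows "length Bs \<le> d\<^sup>2"
proof -
  interpret N: normal_units R N by (rule N(1))
  show ?thesis
  proof (rule div_ring.independent_length_le_if_left_annihilated[OF div_ring_opposite, of K N d Bs])
    show "\<exists>m \<le> d. \<exists>c. left_annihilates (opposite_ring R) K m c a" if "a \<in> N" for a
      using ann[OF that] left_annihilates_opposite N.N_carrier[OF that] by blast
    show "ring.independent (opposite_ring R) (ring_center (opposite_ring R)) Bs"
      using independent_center_opposite[OF Bs] by (simp add: ring_center_opposite)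
  qed (use assms subfield_opposite normal_units_opposite in \<open>simp_all add: ring_center_opposite\<close>)
qed

lemma dim_le_if_independent_bounded:
  assumes "\<And>Bs. independent (ring_center R) Bs \<Longrightarrow> length Bs \<le> b"
  shows "dim_le R (ring_center R) b"
proof -
  have "\<exists>Bs. independent (ring_center R) Bs \<and> (\<forall>Cs. independent (ring_center R) Cs \<longrightarrow> length Cs \<le> length Bs)"
    by (rule ex_has_greatest_nat[of _ "[]" _ "Suc b"]) (use assms in \<open>auto simp: less_Suc_eq_le\<close>)
  then obtain Bs where Bs: "independent (ring_center R) Bs"
    and max: "\<And>Cs. independent (ring_center R) Cs \<Longrightarrow> length Cs \<le> length Bs" by blast
  have BR: "set Bs \<subseteq> carrier R" by (rule independent_in_carrier[OF Bs])
  have "v \<in> Span (ring_center R) Bs" if "v \<in> carrier R" for v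
  proof (rule ccontr)
    assume "v \<notin> Span (ring_center R) Bs"
    then have "independent (ring_center R) (v # Bs)" using that Bs by (intro li_Cons)
    from max[OF this] show False by simp
  qed
  then have "Span (ring_center R) Bs = carrier R"
    using Span_subgroup_props(1)[OF subfield_center BR] by blast
  then have "dimension (length Bs) (ring_center R) (carrier R)"
    using dimension_independent[OF Bs] by simp
  then show ?thesis using assms[OF Bs] by (auto simp: dim_le_def)
qed

end

lemma left_algebraic_boundedD:
  assumes "left_algebraic_bounded R K S d" "a \<in> S"
  shows "\<exists>m \<le> d. \<exists>c. left_annihilates R K m c a"
proof -
  have ex: "\<exists>m c. left_annihilates R K m c a" and deg: "left_degree R K a \<le> d"
    using assms by (auto simp: left_algebraic_bounded_def left_algebraic_def)
  from ex have "\<exists>c. left_annihilates R K (left_degree R K a) c a"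
    unfolding left_degree_def by (rule LeastI_ex)
  with deg show ?thesis by blast
qed

lemma right_algebraic_boundedD:
  assumes "right_algebraic_bounded R K S d" "a \<in> S"
  shows "\<exists>m \<le> d. \<exists>c. right_annihilates R K m c a"
proof -
  have ex: "\<exists>m c. right_annihilates R K m c a" and deg: "right_degree R K a \<le> d"
    using assms by (auto simp: right_algebraic_bounded_def right_algebraic_def)
  from ex have "\<exists>c. right_annihilates R K (right_degree R K a) c a"
    unfolding right_degree_def by (rule LeastI_ex)
  with deg show ?thesis by blast
qed

text \<open>A nonzero constant annihilates nothing. This excludes \<open>d = 0\<close> for
  commutative D, where the dimension is 1.\<close>

lemma (in div_ring) annihilator_degree_pos:
  assumes "subfield K R" "a \<in> carrier R" "left_annihilates R K m c a \<or> right_annihilates R K m c a"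
  shows "m \<ge> 1"
proof (rule ccontr)
  assume "\<not> m \<ge> 1"
  then have m: "m = 0" by simp
  have "c 0 \<in> K" using assms(3) by (auto simp: m left_annihilates_def right_annihilates_def)
  then have "c 0 \<in> carrier R" using subfieldE(3)[OF assms(1)] by blast
  then show False using assms(3) by (auto simp: m left_annihilates_def right_annihilates_def)
qed

theorem theorem4p4:
  fixes D :: "('a, 'b) ring_scheme" and K :: "'a set" and n d :: nat
  assumes "div_ring D"
    and "infinite (ring_center D)"
    and "subfield K D"
    and "n \<ge> 1"
    and "left_algebraic_bounded D K (derived_subgroup D n) d \<or>
         right_algebraic_bounded D K (derived_subgroup D n) d"
  shows "dim_le D (ring_center D) (d^2)"
proof -
  interpret div_ring D by (rule assms(1))
  interpret N: normal_units D "derived_subgroup D n" by (rule normal_units_derived_subgroup)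
  note alg = left_algebraic_boundedD[of D K "derived_subgroup D n" d]
    right_algebraic_boundedD[of D K "derived_subgroup D n" d]
  show ?thesis
  proof (cases "ring_center D = carrier D")
    \<comment> \<open>Here the derived subgroup is central and the main argument does not apply. Its
      element \<open>\<one>\<close> already forces \<open>d \<ge> 1\<close>.\<close>
    case True
    interpret M: normal "derived_subgroup D n" "units_of D" by (rule derived_subgroup_normal)
    have "\<one>\<^bsub>D\<^esub> \<in> derived_subgroup D n"
      using subgroup.one_closed[OF M.subgroup_axioms] by (simp add: units_of_one)
    then have "d \<ge> 1" using assms(5) alg annihilator_degree_pos[OF assms(3) one_closed]
      by (meson le_trans)
    then have "1 \<le> d\<^sup>2" by simp
    moreover have "dimension 1 (ring_center D) (carrier D)"
      using dimension_one[OF subfield_center] True by simp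
    ultimately show ?thesis by (auto simp: dim_le_def)
  next
    case False
    note nc = derived_subgroup_noncentral[OF assms(2) False, of n]
    show ?thesis
      using assms(5) alg independent_length_le_if_left_annihilated[OF assms(2,3) N.normal_units_axioms nc, of d]
        independent_length_le_if_right_annihilated[OF assms(2,3) N.normal_units_axioms nc, of d]
      by (intro dim_le_if_independent_bounded) blast
  qed
qed

end
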